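(* Let $p$ be a UPLang program with distinguished integer input variable $\mathit{in}$ whose execution is uniquely determined by the value of $\mathit{in}$. Then $p$ and $\mathit{Enc}_{RW}(p)$ are equi-safe: $p$ is safe if and only if $\mathit{Enc}_{RW}(p)$ is safe.
   Context: UPLang is a deterministic imperative language with types $\mathit{Int}$ ($\mathbb{Z}$), $\mathit{Addr}$ ($\mathbb{N}$) and $\mathit{Obj}$ (a non-recursive algebraic data type of heap objects with a distinguished constant $\mathit{defObj}$). A heap is a finite sequence of objects, initially empty ($\mathsf{emptyHeap}$). $\mathsf{allocate}(h,o)=(h\,{+\!\!+}\,[o],|h|+1)$; $\mathsf{read}(h,a)=h[a-1]$ if $0<a\le|h|$, else $\mathit{defObj}$; $\mathsf{write}(h,a,o)=h[a-1\mapsto o]$ if $0<a\le|h|$, else $h$; $\mathbf{null}=0$. Statements: $x:=e$, $p:=\mathbf{alloc}(e)$ (stores the address returned by $\mathsf{allocate}$), $x:=\mathbf{read}(p)$ (stores $\mathsf{read}(h,s(p))$), $\mathbf{write}(p,e)$, $\mathbf{skip}$, sequencing, $\mathbf{if}$, $\mathbf{while}$ (guard $0$ is false), $\mathbf{assume}(e)$, $\mathbf{assert}(e)$, $\mathbf{assume}(P(\bar e))$, $\mathbf{assert}(P(\bar e))$ for uninterpreted predicate symbols $P$; no arithmetic on $\mathit{Addr}$ variables. Under an interpretation $\mathcal{I}$ (assigning to each predicate of arity $n$ a set of $n$-tuples of argument values), the partial big-step semantics $\delta_{\mathcal{I}}(S,s,h)$ returns an outcome in $\{\top,\bot(P,\bar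 v)\}$, a stack and a heap: a failing $\mathbf{assert}(e)$ (value $0$) yields $\bot(F,())$ with $F$ a special $0$-ary symbol, a failing $\mathbf{assert}(P(\bar e))$ (argument values $\bar v\notin\mathcal{I}(P)$) yields $\bot(P,\bar v)$, failures propagate through sequencing and loops, and a failing $\mathbf{assume}$ or non-terminating loop makes the result undefined. A program $p$ is safe if there is an interpretation $\mathcal{I}$ such that for every stack $s$, $\delta_{\mathcal{I}}(p,s,\mathsf{emptyHeap})$ does not have outcome $\bot(P,\bar v)$ for any $P,\bar v$; two programs are equi-safe if one is safe iff the other is. The macro $\mathit{havoc}(x)$, using an integer variable $\mathit{seed}$, stands for: $x:=-(\mathit{seed}\%2);\ \mathit{seed}:=\mathit{seed}/2;\ \mathbf{while}\ \mathit{seed}\%2=1\ \mathbf{do}\ \{\mathit{seed}:=\mathit{seed}/2;\ x:=2\times x+(\mathit{seed}\%2);\ \mathit{seed}:=\mathit{seed}/2\};\ \mathit{seed}:=\mathit{seed}/2$. The encoding $\mathit{Enc}_{RW}(p)$ introduces predicates $R$ with argument types $(\mathit{Int},\mathit{Int},\mathit{Int})$ and $W$ with argument types $(\mathit{Int},\mathit{Int},\mathit{Obj})$, and is obtained by: (1) redeclaring all $\mathit{Addr}$ variables of $p$ as $\mathit{Int}$ variables; (2) introducing fresh $\mathit{Int}$ variables $\mathit{cnt}_{alloc},\mathit{cnt},\mathit{cnt}_{last},t,\mathit{last}_{Addr}$ ($\mathit{last}_{Addr}$ left uninitialised, so its value comes from the initial stack) and prepending $\mathit{cnt}_{alloc}:=0;\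 \mathit{cnt}:=0;\ \mathit{cnt}_{last}:=0;\ t:=0;\ \mathbf{assert}(W(\mathit{in},0,\mathit{defObj}))$; (3) replacing each $q:=\mathbf{alloc}(e)$ by $\mathit{cnt}_{alloc}:=\mathit{cnt}_{alloc}+1;\ q:=\mathit{cnt}_{alloc};\ \mathit{cnt}:=\mathit{cnt}+1;\ \mathbf{assert}(W(\mathit{in},\mathit{cnt},e));\ \mathbf{if}\ \mathit{last}_{Addr}=q\ \{\mathit{cnt}_{last}:=\mathit{cnt}\}$; each $x:=\mathbf{read}(q)$ by $\mathit{cnt}:=\mathit{cnt}+1;\ \mathbf{if}\ \mathit{last}_{Addr}=q\ \mathbf{then}\ \{\mathbf{assert}(R(\mathit{in},\mathit{cnt},\mathit{cnt}_{last}));\ t:=\mathit{cnt}_{last}\}\ \mathbf{else}\ \{\mathit{havoc}(t);\ \mathbf{assume}(R(\mathit{in},\mathit{cnt},t))\};\ \mathit{havoc}(x);\ \mathbf{assume}(W(\mathit{in},t,x))$; and each $\mathbf{write}(q,e)$ by $\mathit{cnt}:=\mathit{cnt}+1;\ \mathbf{if}\ (0<q\le\mathit{cnt}_{alloc})\ \{\mathbf{assert}(W(\mathit{in},\mathit{cnt},e));\ \mathbf{if}\ \mathit{last}_{Addr}=q\ \{\mathit{cnt}_{last}:=\mathit{cnt}\}\}$, where $\mathbf{if}\ e\ \{S\}$ abbreviates $\mathbf{if}\ e\ \mathbf{then}\ \{S\}\ \mathbf{else}\ \{\mathbf{skip}\}$.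
   Formalization: Added: in each q:=alloc(e), q does not occur in e (Enc sets q before evaluating e), and p never assigns in; without either the claim fails. "Execution determined by in" is read as: the whole sequence of steps with their values is the same. *)

theory Defs
  imports Main
begin

section \<open>Types, objects and expressions of UPLang\<close>

datatype ty = IntT | AddrT | ObjT

datatype val = IntV int | AddrV nat | ObjV nat "val list"

text \<open>An algebraic data type of heap objects is the list of its constructors, each given by the list
  of its argument types; \<open>ObjV c vs\<close> is the \<open>c\<close>-th constructor applied to \<open>vs\<close>.\<close>

record adt =
  ctors :: "ty list list"
  def_obj :: val

inductive has_type :: "ty list list \<Rightarrow> val \<Rightarrow> ty \<Rightarrow> bool" for D where
  "has_type D (IntV i) IntT"
| "has_type D (AddrV a) AddrT"
| "c < length D \<Longrightarrow> list_all2 (has_type D) vs (D ! c) \<Longrightarrow> has_type D (ObjV c vs) ObjT"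

text \<open>The first conjunct says that the data type is non-recursive.\<close>

definition wf_adt :: "adt \<Rightarrow> bool" where
  "wf_adt A \<longleftrightarrow> (\<forall>ts \<in> set (ctors A). ObjT \<notin> set ts) \<and> has_type (ctors A) (def_obj A) ObjT"

datatype binop = Plus | Minus | Times | Div | Mod | Less | Leq | And | Or

text \<open>\<open>Sel c i e\<close> selects the \<open>i\<close>-th argument of constructor \<open>c\<close>; \<open>IsCtor c e\<close> tests for constructor \<open>c\<close>.
  Only \<open>Eq\<close> applies to addresses and objects.\<close>

datatype (vars: 'v) exp =
    Var 'v | Num int | Null | DefObj
  | Neg "'v exp" | Not "'v exp" | Bin binop "'v exp" "'v exp" | Eq "'v exp" "'v exp"
  | Ctor nat "'v exp list" | Sel nat nat "'v exp" | IsCtor nat "'v exp"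

inductive wt_exp :: "ty list list \<Rightarrow> ('v \<Rightarrow> ty) \<Rightarrow> 'v exp \<Rightarrow> ty \<Rightarrow> bool" for D \<Gamma> where
  "wt_exp D \<Gamma> (Var x) (\<Gamma> x)"
| "wt_exp D \<Gamma> (Num i) IntT"
| "wt_exp D \<Gamma> Null AddrT"
| "wt_exp D \<Gamma> DefObj ObjT"
| "wt_exp D \<Gamma> e IntT \<Longrightarrow> wt_exp D \<Gamma> (Neg e) IntT"
| "wt_exp D \<Gamma> e IntT \<Longrightarrow> wt_exp D \<Gamma> (Not e) IntT"
| "wt_exp D \<Gamma> e1 IntT \<Longrightarrow> wt_exp D \<Gamma> e2 IntT \<Longrightarrow> wt_exp D \<Gamma> (Bin b e1 e2) IntT"
| "wt_exp D \<Gamma> e1 t \<Longrightarrow> wt_exp D \<Gamma> e2 t \<Longrightarrow> wt_exp D \<Gamma> (Eq e1 e2) IntT"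
| "c < length D \<Longrightarrow> list_all2 (wt_exp D \<Gamma>) es (D ! c) \<Longrightarrow> wt_exp D \<Gamma> (Ctor c es) ObjT"
| "c < length D \<Longrightarrow> i < length (D ! c) \<Longrightarrow> wt_exp D \<Gamma> e ObjT \<Longrightarrow> wt_exp D \<Gamma> (Sel c i e) (D ! c ! i)"
| "wt_exp D \<Gamma> e ObjT \<Longrightarrow> wt_exp D \<Gamma> (IsCtor c e) IntT"

type_synonym 'v stack = "'v \<Rightarrow> val"
type_synonym heap = "val list"

definition of_bool_val :: "bool \<Rightarrow> val" where
  "of_bool_val b = IntV (if b then 1 else 0)"

definition is_true :: "val \<Rightarrow> bool" where
  "is_true v \<longleftrightarrow> v \<noteq> IntV 0"

fun default_val :: "adt \<Rightarrow> ty \<Rightarrow> val" where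
  "default_val A IntT = IntV 0"
| "default_val A AddrT = AddrV 0"
| "default_val A ObjT = def_obj A"

fun to_int :: "val \<Rightarrow> int" where
  "to_int (IntV i) = i"
| "to_int _ = 0"

fun eval_bin :: "binop \<Rightarrow> int \<Rightarrow> int \<Rightarrow> val" where
  "eval_bin Plus i j = IntV (i + j)"
| "eval_bin Minus i j = IntV (i - j)"
| "eval_bin Times i j = IntV (i * j)"
| "eval_bin Div i j = IntV (i div j)"
| "eval_bin Mod i j = IntV (i mod j)"
| "eval_bin Less i j = of_bool_val (i < j)"
| "eval_bin Leq i j = of_bool_val (i \<le> j)"
| "eval_bin And i j = of_bool_val (i \<noteq> 0 \<and> j \<noteq> 0)"
| "eval_bin Or i j = of_bool_val (i \<noteq> 0 \<or> j \<noteq> 0)"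

text \<open>Expressions are total: a selector applied to an object built by another constructor yields the
  default value of the selected type.\<close>

fun eval :: "adt \<Rightarrow> 'v stack \<Rightarrow> 'v exp \<Rightarrow> val" where
  "eval A s (Var x) = s x"
| "eval A s (Num i) = IntV i"
| "eval A s Null = AddrV 0"
| "eval A s DefObj = def_obj A"
| "eval A s (Neg e) = IntV (- to_int (eval A s e))"
| "eval A s (Not e) = of_bool_val (to_int (eval A s e) = 0)"
| "eval A s (Bin b e1 e2) = eval_bin b (to_int (eval A s e1)) (to_int (eval A s e2))"
| "eval A s (Eq e1 e2) = of_bool_val (eval A s e1 = eval A s e2)"
| "eval A s (Ctor c es) = ObjV c (map (eval A s) es)"
| "eval A s (Sel c i e) =
     (case eval A s e of
        ObjV c' vs \<Rightarrow> if c' = c then vs ! i else default_val A (ctors A ! c ! i)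
      | _ \<Rightarrow> default_val A (ctors A ! c ! i))"
| "eval A s (IsCtor c e) =
     (case eval A s e of ObjV c' vs \<Rightarrow> of_bool_val (c' = c) | _ \<Rightarrow> of_bool_val False)"

section \<open>Heaps\<close>

definition allocate :: "heap \<Rightarrow> val \<Rightarrow> heap \<times> nat" where
  "allocate h obj = (h @ [obj], length h + 1)"

definition heap_read :: "adt \<Rightarrow> heap \<Rightarrow> nat \<Rightarrow> val" where
  "heap_read A h a = (if 0 < a \<and> a \<le> length h then h ! (a - 1) else def_obj A)"

definition heap_write :: "heap \<Rightarrow> nat \<Rightarrow> val \<Rightarrow> heap" where
  "heap_write h a obj = (if 0 < a \<and> a \<le> length h then h[a - 1 := obj] else h)"

section \<open>Programs\<close>

datatype ('v, 'p) stmt =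
    Skip
  | Assign 'v "'v exp"
  | Alloc 'v "'v exp"
  | Read 'v 'v
  | Write 'v "'v exp"
  | Seq "('v, 'p) stmt" "('v, 'p) stmt"  (infixr \<open>;;\<close> 60)
  | If "'v exp" "('v, 'p) stmt" "('v, 'p) stmt"
  | While "'v exp" "('v, 'p) stmt"
  | Assume "'v exp"
  | Assert "'v exp"
  | AssumeP 'p "'v exp list"
  | AssertP 'p "'v exp list"

inductive wt_stmt :: "ty list list \<Rightarrow> ('p \<Rightarrow> ty list) \<Rightarrow> ('v \<Rightarrow> ty) \<Rightarrow> ('v, 'p) stmt \<Rightarrow> bool"
  for D \<Pi> \<Gamma> where
  "wt_stmt D \<Pi> \<Gamma> Skip"
| "wt_exp D \<Gamma> e (\<Gamma> x) \<Longrightarrow> wt_stmt D \<Pi> \<Gamma> (Assign x e)"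
| "\<Gamma> q = AddrT \<Longrightarrow> wt_exp D \<Gamma> e ObjT \<Longrightarrow> wt_stmt D \<Pi> \<Gamma> (Alloc q e)"
| "\<Gamma> x = ObjT \<Longrightarrow> \<Gamma> q = AddrT \<Longrightarrow> wt_stmt D \<Pi> \<Gamma> (Read x q)"
| "\<Gamma> q = AddrT \<Longrightarrow> wt_exp D \<Gamma> e ObjT \<Longrightarrow> wt_stmt D \<Pi> \<Gamma> (Write q e)"
| "wt_stmt D \<Pi> \<Gamma> S1 \<Longrightarrow> wt_stmt D \<Pi> \<Gamma> S2 \<Longrightarrow> wt_stmt D \<Pi> \<Gamma> (S1 ;; S2)"
| "wt_exp D \<Gamma> e IntT \<Longrightarrow> wt_stmt D \<Pi> \<Gamma> S1 \<Longrightarrow> wt_stmt D \<Pi> \<Gamma> S2 \<Longrightarrow> wt_stmt D \<Pi> \<Gamma> (If e S1 S2)"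
| "wt_exp D \<Gamma> e IntT \<Longrightarrow> wt_stmt D \<Pi> \<Gamma> S \<Longrightarrow> wt_stmt D \<Pi> \<Gamma> (While e S)"
| "wt_exp D \<Gamma> e IntT \<Longrightarrow> wt_stmt D \<Pi> \<Gamma> (Assume e)"
| "wt_exp D \<Gamma> e IntT \<Longrightarrow> wt_stmt D \<Pi> \<Gamma> (Assert e)"
| "list_all2 (wt_exp D \<Gamma>) es (\<Pi> P) \<Longrightarrow> wt_stmt D \<Pi> \<Gamma> (AssumeP P es)"
| "list_all2 (wt_exp D \<Gamma>) es (\<Pi> P) \<Longrightarrow> wt_stmt D \<Pi> \<Gamma> (AssertP P es)"

text \<open>A program consists of the type of heap objects, the variable declarations, the argument types
  of the uninterpreted predicates, and a statement.\<close>

record ('v, 'p) program =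
  obj_type :: adt
  decl :: "'v \<Rightarrow> ty"
  pred_args :: "'p \<Rightarrow> ty list"
  body :: "('v, 'p) stmt"

definition wf_program :: "('v, 'p) program \<Rightarrow> bool" where
  "wf_program p \<longleftrightarrow> wf_adt (obj_type p) \<and>
     wt_stmt (ctors (obj_type p)) (pred_args p) (decl p) (body p)"

definition is_stack :: "('v, 'p) program \<Rightarrow> 'v stack \<Rightarrow> bool" where
  "is_stack p s \<longleftrightarrow> (\<forall>x. has_type (ctors (obj_type p)) (s x) (decl p x))"

type_synonym 'p interp = "'p \<Rightarrow> val list set"

definition is_interp :: "('v, 'p) program \<Rightarrow> 'p interp \<Rightarrow> bool" where
  "is_interp p I \<longleftrightarrow>
     (\<forall>P. I P \<subseteq> {vs. list_all2 (has_type (ctors (obj_type p))) vs (pred_args p P)})"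

section \<open>Big-step semantics and safety\<close>

text \<open>\<open>Bot None []\<close> is the failure of an \<open>Assert\<close> (the special symbol \<open>F\<close>);
  \<open>Bot (Some P) vs\<close> is the failure of an \<open>AssertP\<close>.\<close>

datatype 'p outcome = Top | Bot "'p option" "val list"

text \<open>The semantics is a partial function, represented by its graph; see \<open>big_step_deterministic\<close>.\<close>

inductive big_step ::
  "adt \<Rightarrow> 'p interp \<Rightarrow> ('v, 'p) stmt \<Rightarrow> 'v stack \<Rightarrow> heap \<Rightarrow> 'p outcome \<Rightarrow> 'v stack \<Rightarrow> heap \<Rightarrow> bool"
  for A I where
  BSkip: "big_step A I Skip s h Top s h"
| BAssign: "big_step A I (Assign x e) s h Top (s(x := eval A s e)) h"
| BAlloc: "allocate h (eval A s e) = (h', a) \<Longrightarrow>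
    big_step A I (Alloc q e) s h Top (s(q := AddrV a)) h'"
| BRead: "s q = AddrV a \<Longrightarrow> big_step A I (Read x q) s h Top (s(x := heap_read A h a)) h"
| BWrite: "s q = AddrV a \<Longrightarrow> big_step A I (Write q e) s h Top s (heap_write h a (eval A s e))"
| BSeq: "big_step A I S1 s h Top s' h' \<Longrightarrow> big_step A I S2 s' h' r s'' h'' \<Longrightarrow>
    big_step A I (S1 ;; S2) s h r s'' h''"
| BSeqFail: "big_step A I S1 s h (Bot P vs) s' h' \<Longrightarrow>
    big_step A I (S1 ;; S2) s h (Bot P vs) s' h'"
| BIfTrue: "is_true (eval A s e) \<Longrightarrow> big_step A I S1 s h r s' h' \<Longrightarrow>
    big_step A I (If e S1 S2) s h r s' h'"
| BIfFalse: "\<not> is_true (eval A s e) \<Longrightarrow> big_step A I S2 s h r s' h' \<Longrightarrow>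
    big_step A I (If e S1 S2) s h r s' h'"
| BWhileTrue: "is_true (eval A s e) \<Longrightarrow> big_step A I (S ;; While e S) s h r s' h' \<Longrightarrow>
    big_step A I (While e S) s h r s' h'"
| BWhileFalse: "\<not> is_true (eval A s e) \<Longrightarrow> big_step A I (While e S) s h Top s h"
| BAssume: "is_true (eval A s e) \<Longrightarrow> big_step A I (Assume e) s h Top s h"
| BAssert: "is_true (eval A s e) \<Longrightarrow> big_step A I (Assert e) s h Top s h"
| BAssertFail: "\<not> is_true (eval A s e) \<Longrightarrow> big_step A I (Assert e) s h (Bot None []) s h"
| BAssumeP: "map (eval A s) es \<in> I P \<Longrightarrow> big_step A I (AssumeP P es) s h Top s h"
| BAssertP: "map (eval A s) es \<in> I P \<Longrightarrow> big_step A I (AssertP P es) s h Top s h"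
| BAssertPFail: "map (eval A s) es \<notin> I P \<Longrightarrow>
    big_step A I (AssertP P es) s h (Bot (Some P) (map (eval A s) es)) s h"

inductive_cases BSkipE: "big_step A I Skip s h r s' h'"
inductive_cases BAssignE: "big_step A I (Assign x e) s h r s' h'"
inductive_cases BAllocE: "big_step A I (Alloc q e) s h r s' h'"
inductive_cases BReadE: "big_step A I (Read x q) s h r s' h'"
inductive_cases BWriteE: "big_step A I (Write q e) s h r s' h'"
inductive_cases BSeqE: "big_step A I (S1 ;; S2) s h r s' h'"
inductive_cases BIfE: "big_step A I (If e S1 S2) s h r s' h'"
inductive_cases BWhileE: "big_step A I (While e S) s h r s' h'"
inductive_cases BAssumeE: "big_step A I (Assume e) s h r s' h'"
inductive_cases BAssertE: "big_step A I (Assert e) s h r s' h'"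
inductive_cases BAssumePE: "big_step A I (AssumeP P es) s h r s' h'"
inductive_cases BAssertPE: "big_step A I (AssertP P es) s h r s' h'"

lemmas big_step_elims = BSkipE BAssignE BAllocE BReadE BWriteE BSeqE BIfE BWhileE
  BAssumeE BAssertE BAssumePE BAssertPE

lemma big_step_deterministic:
  assumes "big_step A I S s h r s' h'" and "big_step A I S s h r2 s2 h2"
  shows "r2 = r \<and> s2 = s' \<and> h2 = h'"
  using assms
proof (induction arbitrary: r2 s2 h2 rule: big_step.induct)
  case (BSeq S1 s h s' h' S2 r s'' h'')
  from BSeq.prems show ?case
    by (rule BSeqE) (use BSeq.IH in blast)+
next
  case (BSeqFail S1 s h P vs s' h' S2)
  from BSeqFail.prems show ?case
    by (rule BSeqE) (use BSeqFail.IH in blast)+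
next
  case (BIfTrue s e S1 h r s' h' S2)
  from BIfTrue.prems show ?case
    by (rule BIfE) (use BIfTrue.IH BIfTrue.hyps in blast)+
next
  case (BIfFalse s e S2 h r s' h' S1)
  from BIfFalse.prems show ?case
    by (rule BIfE) (use BIfFalse.IH BIfFalse.hyps in blast)+
next
  case (BWhileTrue s e S h r s' h')
  from BWhileTrue.prems show ?case
    by (rule BWhileE) (use BWhileTrue.IH BWhileTrue.hyps in blast)+
next
  case (BWhileFalse s e S h)
  from BWhileFalse.prems show ?case
    by (rule BWhileE) (use BWhileFalse.hyps in blast)+
qed (erule big_step_elims; simp)+

definition safe :: "('v, 'p) program \<Rightarrow> bool" where
  "safe p \<longleftrightarrow> (\<exists>I. is_interp p I \<and>
     (\<forall>s. is_stack p s \<longrightarrow>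
        \<not> (\<exists>P vs s' h'. big_step (obj_type p) I (body p) s [] (Bot P vs) s' h')))"

definition equi_safe :: "('v, 'p) program \<Rightarrow> ('w, 'q) program \<Rightarrow> bool" where
  "equi_safe p p' \<longleftrightarrow> (safe p \<longleftrightarrow> safe p')"

section \<open>Executions determined by an input variable\<close>

text \<open>The execution of a program, including one that diverges or is blocked by an assumption, is
  recorded as the sequence of its atomic steps, each with the values involved in it. The final
  outcome of the big-step semantics alone would not do: it is undefined for both diverging and
  blocked runs, and it does not tell which objects went through the heap on the way.\<close>

datatype ('v, 'p) event =
    ESkip
  | EAssign 'v val
  | EAlloc 'v val nat
  | ERead 'v nat val
  | EWrite nat val
  | EBranch bool
  | EAssume
  | EAssert bool
  | EAssumeP 'p "val list"
  | EAssertP 'p "val list" bool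

datatype ('v, 'p) config =
    Run "('v, 'p) stmt" "'v stack" heap
  | Halt "'p outcome" "'v stack" heap

inductive step ::
  "adt \<Rightarrow> 'p interp \<Rightarrow> ('v, 'p) config \<Rightarrow> ('v, 'p) event \<Rightarrow> ('v, 'p) config \<Rightarrow> bool"
  for A I where
  SSkip: "step A I (Run Skip s h) ESkip (Halt Top s h)"
| SAssign: "eval A s e = v \<Longrightarrow>
    step A I (Run (Assign x e) s h) (EAssign x v) (Halt Top (s(x := v)) h)"
| SAlloc: "eval A s e = v \<Longrightarrow> allocate h v = (h', a) \<Longrightarrow>
    step A I (Run (Alloc q e) s h) (EAlloc q v a) (Halt Top (s(q := AddrV a)) h')"
| SRead: "s q = AddrV a \<Longrightarrow> heap_read A h a = v \<Longrightarrow>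
    step A I (Run (Read x q) s h) (ERead x a v) (Halt Top (s(x := v)) h)"
| SWrite: "s q = AddrV a \<Longrightarrow> eval A s e = v \<Longrightarrow>
    step A I (Run (Write q e) s h) (EWrite a v) (Halt Top s (heap_write h a v))"
| SSeq: "step A I (Run S1 s h) ev (Run S1' s' h') \<Longrightarrow>
    step A I (Run (S1 ;; S2) s h) ev (Run (S1' ;; S2) s' h')"
| SSeqTop: "step A I (Run S1 s h) ev (Halt Top s' h') \<Longrightarrow>
    step A I (Run (S1 ;; S2) s h) ev (Run S2 s' h')"
| SSeqFail: "step A I (Run S1 s h) ev (Halt (Bot P vs) s' h') \<Longrightarrow>
    step A I (Run (S1 ;; S2) s h) ev (Halt (Bot P vs) s' h')"
| SIfTrue: "is_true (eval A s e) \<Longrightarrow>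
    step A I (Run (If e S1 S2) s h) (EBranch True) (Run S1 s h)"
| SIfFalse: "\<not> is_true (eval A s e) \<Longrightarrow>
    step A I (Run (If e S1 S2) s h) (EBranch False) (Run S2 s h)"
| SWhileTrue: "is_true (eval A s e) \<Longrightarrow>
    step A I (Run (While e S) s h) (EBranch True) (Run (S ;; While e S) s h)"
| SWhileFalse: "\<not> is_true (eval A s e) \<Longrightarrow>
    step A I (Run (While e S) s h) (EBranch False) (Halt Top s h)"
| SAssume: "is_true (eval A s e) \<Longrightarrow> step A I (Run (Assume e) s h) EAssume (Halt Top s h)"
| SAssert: "is_true (eval A s e) \<Longrightarrow>
    step A I (Run (Assert e) s h) (EAssert True) (Halt Top s h)"
| SAssertFail: "\<not> is_true (eval A s e) \<Longrightarrow>
    step A I (Run (Assert e) s h) (EAssert False) (Halt (Bot None []) s h)"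
| SAssumeP: "map (eval A s) es = vs \<Longrightarrow> vs \<in> I P \<Longrightarrow>
    step A I (Run (AssumeP P es) s h) (EAssumeP P vs) (Halt Top s h)"
| SAssertP: "map (eval A s) es = vs \<Longrightarrow> vs \<in> I P \<Longrightarrow>
    step A I (Run (AssertP P es) s h) (EAssertP P vs True) (Halt Top s h)"
| SAssertPFail: "map (eval A s) es = vs \<Longrightarrow> vs \<notin> I P \<Longrightarrow>
    step A I (Run (AssertP P es) s h) (EAssertP P vs False) (Halt (Bot (Some P) vs) s h)"

inductive steps ::
  "adt \<Rightarrow> 'p interp \<Rightarrow> ('v, 'p) config \<Rightarrow> ('v, 'p) event list \<Rightarrow> ('v, 'p) config \<Rightarrow> bool"
  for A I where
  steps_Nil: "steps A I C [] C"
| steps_Cons: "step A I C ev C' \<Longrightarrow> steps A I C' evs C'' \<Longrightarrow> steps A I C (ev # evs) C''"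

text \<open>As \<open>step\<close> is deterministic, the set of all finite prefixes of the execution represents the
  (possibly infinite) execution.\<close>

definition execution :: "('v, 'p) program \<Rightarrow> 'p interp \<Rightarrow> 'v stack \<Rightarrow> ('v, 'p) event list set" where
  "execution p I s = {evs. \<exists>C. steps (obj_type p) I (Run (body p) s []) evs C}"

definition determined_by :: "('v, 'p) program \<Rightarrow> 'v \<Rightarrow> bool" where
  "determined_by p inp \<longleftrightarrow>
     (\<forall>I s s'. is_interp p I \<longrightarrow> is_stack p s \<longrightarrow> is_stack p s' \<longrightarrow> s inp = s' inp \<longrightarrow>
        execution p I s = execution p I s')"

subsection \<open>Agreement of the two semantics\<close>

inductive_cases HaltE: "step A I (Halt r s h) ev C"

lemma steps_append: "steps A I C evs C' \<Longrightarrow> steps A I C' evs' C'' \<Longrightarrow> steps A I C (evs @ evs') C''"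
  by (induction rule: steps.induct) (auto intro: steps.intros)

lemma steps_Seq_Top:
  fixes S1 S2 :: "('v, 'p) stmt"
  assumes "steps A I (Run S1 s h) evs (Halt Top s' h')"
  shows "steps A I (Run (S1 ;; S2) s h) evs (Run S2 s' h')"
  using assms
proof (induction "Run S1 s h" evs "Halt Top s' h' :: ('v, 'p) config" arbitrary: S1 s h
    rule: steps.induct)
  case (steps_Cons ev C' evs)
  show ?case
  proof (cases C')
    case (Run S1' s1 h1)
    then show ?thesis using steps_Cons by (metis SSeq steps.steps_Cons)
  next
    case (Halt r s1 h1)
    then have "evs = [] \<and> C' = Halt Top s' h'"
      using steps_Cons(2) by (auto elim: steps.cases HaltE)
    then show ?thesis using steps_Cons(1) SSeqTop steps.intros by metis
  qed
qed

lemma steps_Seq_Bot: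
  fixes S1 S2 :: "('v, 'p) stmt"
  assumes "steps A I (Run S1 s h) evs (Halt (Bot P vs) s' h')"
  shows "steps A I (Run (S1 ;; S2) s h) evs (Halt (Bot P vs) s' h')"
  using assms
proof (induction "Run S1 s h" evs "Halt (Bot P vs) s' h' :: ('v, 'p) config" arbitrary: S1 s h
    rule: steps.induct)
  case (steps_Cons ev C' evs)
  show ?case
  proof (cases C')
    case (Run S1' s1 h1)
    then show ?thesis using steps_Cons by (metis SSeq steps.steps_Cons)
  next
    case (Halt r s1 h1)
    then have "evs = [] \<and> C' = Halt (Bot P vs) s' h'"
      using steps_Cons(2) by (auto elim: steps.cases HaltE)
    then show ?thesis using steps_Cons(1) SSeqFail steps.intros by metis
  qed
qed

lemma big_step_imp_steps:
  "big_step A I S s h r s' h' \<Longrightarrow> \<exists>evs. steps A I (Run S s h) evs (Halt r s' h')"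
proof (induction rule: big_step.induct)
  case (BSeq S1 s h s' h' S2 r s'' h'')
  then show ?case by (meson steps_Seq_Top steps_append)
next
  case (BSeqFail S1 s h P vs s' h' S2)
  then show ?case by (meson steps_Seq_Bot)
qed (blast intro: step.intros steps.intros)+

fun completes ::
  "adt \<Rightarrow> 'p interp \<Rightarrow> ('v, 'p) config \<Rightarrow> 'p outcome \<Rightarrow> 'v stack \<Rightarrow> heap \<Rightarrow> bool" where
  "completes A I (Run S s h) r s' h' = big_step A I S s h r s' h'"
| "completes A I (Halt r0 s0 h0) r s' h' = (r = r0 \<and> s' = s0 \<and> h' = h0)"

lemma step_completes:
  "step A I C ev C' \<Longrightarrow> completes A I C' r s' h' \<Longrightarrow> completes A I C r s' h'"
proof (induction arbitrary: r s' h' rule: step.induct)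
  case (SSeq S1 s h ev S1' s1 h1 S2)
  from SSeq.prems have "big_step A I (S1' ;; S2) s1 h1 r s' h'" by simp
  then show ?case
    by (rule BSeqE) (use SSeq.IH in \<open>auto intro: big_step.intros\<close>)
qed (auto intro: big_step.intros)

lemma steps_completes:
  "steps A I C evs C' \<Longrightarrow> completes A I C' r s' h' \<Longrightarrow> completes A I C r s' h'"
  by (induction rule: steps.induct) (auto intro: step_completes)

theorem big_step_iff_steps:
  "big_step A I S s h r s' h' \<longleftrightarrow> (\<exists>evs. steps A I (Run S s h) evs (Halt r s' h'))"
  using big_step_imp_steps steps_completes[of A I "Run S s h" _ "Halt r s' h'" r s' h'] by auto

section \<open>The encoding\<close>

text \<open>Freshness of the introduced variables and predicates is by construction. \<open>HTag\<close> and \<open>HArg\<close> are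
  used to havoc variables of type \<open>ObjT\<close>.\<close>

datatype 'v enc_var =
    Old 'v | CntAlloc | Cnt | CntLast | T | LastAddr | Seed | HTag | HArg nat

datatype 'p enc_pred = OldP 'p | R | W

fun redeclare :: "ty \<Rightarrow> ty" where
  "redeclare AddrT = IntT"
| "redeclare t = t"

fun enc_val :: "val \<Rightarrow> val" where
  "enc_val (IntV i) = IntV i"
| "enc_val (AddrV a) = IntV (int a)"
| "enc_val (ObjV c vs) = ObjV c (map enc_val vs)"

text \<open>Since addresses become integers, so do the address components of heap objects.\<close>

definition enc_adt :: "adt \<Rightarrow> adt" where
  "enc_adt A = \<lparr>ctors = map (map redeclare) (ctors A), def_obj = enc_val (def_obj A)\<rparr>"

fun enc_exp :: "'v exp \<Rightarrow> 'v enc_var exp" where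
  "enc_exp (Var x) = Var (Old x)"
| "enc_exp (Num i) = Num i"
| "enc_exp Null = Num 0"
| "enc_exp DefObj = DefObj"
| "enc_exp (Neg e) = Neg (enc_exp e)"
| "enc_exp (Not e) = Not (enc_exp e)"
| "enc_exp (Bin b e1 e2) = Bin b (enc_exp e1) (enc_exp e2)"
| "enc_exp (Eq e1 e2) = Eq (enc_exp e1) (enc_exp e2)"
| "enc_exp (Ctor c es) = Ctor c (map enc_exp es)"
| "enc_exp (Sel c i e) = Sel c i (enc_exp e)"
| "enc_exp (IsCtor c e) = IsCtor c (enc_exp e)"

definition havoc :: "'v enc_var \<Rightarrow> ('v enc_var, 'q) stmt" where
  "havoc x =
     Assign x (Neg (Bin Mod (Var Seed) (Num 2))) ;;
     Assign Seed (Bin Div (Var Seed) (Num 2)) ;;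
     While (Eq (Bin Mod (Var Seed) (Num 2)) (Num 1))
      (Assign Seed (Bin Div (Var Seed) (Num 2)) ;;
       Assign x (Bin Plus (Bin Times (Num 2) (Var x)) (Bin Mod (Var Seed) (Num 2))) ;;
       Assign Seed (Bin Div (Var Seed) (Num 2))) ;;
     Assign Seed (Bin Div (Var Seed) (Num 2))"

text \<open>For a variable of type \<open>ObjT\<close>, a constructor and its arguments, which are all integers after
  the redeclaration, are chosen by \<open>havoc\<close>. A tag that denotes no constructor yields \<open>DefObj\<close>.\<close>

definition havoc_args :: "nat \<Rightarrow> ('v enc_var, 'q) stmt" where
  "havoc_args n = foldr (\<lambda>i S. havoc (HArg i) ;; S) [0..<n] Skip"

definition havoc_obj :: "ty list list \<Rightarrow> 'v enc_var \<Rightarrow> ('v enc_var, 'q) stmt" where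
  "havoc_obj D x =
     havoc HTag ;;
     foldr (\<lambda>c S. If (Eq (Var HTag) (Num (int c)))
                    (havoc_args (length (D ! c)) ;;
                     Assign x (Ctor c (map (\<lambda>i. Var (HArg i)) [0..<length (D ! c)])))
                    S)
       [0..<length D] (Assign x DefObj)"

fun enc_stmt :: "ty list list \<Rightarrow> 'v \<Rightarrow> ('v, 'p) stmt \<Rightarrow> ('v enc_var, 'p enc_pred) stmt" where
  "enc_stmt D inp Skip = Skip"
| "enc_stmt D inp (Assign x e) = Assign (Old x) (enc_exp e)"
| "enc_stmt D inp (Alloc q e) =
     Assign CntAlloc (Bin Plus (Var CntAlloc) (Num 1)) ;;
     Assign (Old q) (Var CntAlloc) ;;
     Assign Cnt (Bin Plus (Var Cnt) (Num 1)) ;;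
     AssertP W [Var (Old inp), Var Cnt, enc_exp e] ;;
     If (Eq (Var LastAddr) (Var (Old q))) (Assign CntLast (Var Cnt)) Skip"
| "enc_stmt D inp (Read x q) =
     Assign Cnt (Bin Plus (Var Cnt) (Num 1)) ;;
     If (Eq (Var LastAddr) (Var (Old q)))
      (AssertP R [Var (Old inp), Var Cnt, Var CntLast] ;;
       Assign T (Var CntLast))
      (havoc T ;;
       AssumeP R [Var (Old inp), Var Cnt, Var T]) ;;
     havoc_obj D (Old x) ;;
     AssumeP W [Var (Old inp), Var T, Var (Old x)]"
| "enc_stmt D inp (Write q e) =
     Assign Cnt (Bin Plus (Var Cnt) (Num 1)) ;;
     If (Bin And (Bin Less (Num 0) (Var (Old q))) (Bin Leq (Var (Old q)) (Var CntAlloc)))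
      (AssertP W [Var (Old inp), Var Cnt, enc_exp e] ;;
       If (Eq (Var LastAddr) (Var (Old q))) (Assign CntLast (Var Cnt)) Skip)
      Skip"
| "enc_stmt D inp (S1 ;; S2) = enc_stmt D inp S1 ;; enc_stmt D inp S2"
| "enc_stmt D inp (If e S1 S2) = If (enc_exp e) (enc_stmt D inp S1) (enc_stmt D inp S2)"
| "enc_stmt D inp (While e S) = While (enc_exp e) (enc_stmt D inp S)"
| "enc_stmt D inp (Assume e) = Assume (enc_exp e)"
| "enc_stmt D inp (Assert e) = Assert (enc_exp e)"
| "enc_stmt D inp (AssumeP P es) = AssumeP (OldP P) (map enc_exp es)"
| "enc_stmt D inp (AssertP P es) = AssertP (OldP P) (map enc_exp es)"

fun enc_decl :: "('v \<Rightarrow> ty) \<Rightarrow> 'v enc_var \<Rightarrow> ty" where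
  "enc_decl \<Gamma> (Old x) = redeclare (\<Gamma> x)"
| "enc_decl \<Gamma> _ = IntT"

fun enc_pred_args :: "('p \<Rightarrow> ty list) \<Rightarrow> 'p enc_pred \<Rightarrow> ty list" where
  "enc_pred_args \<Pi> (OldP P) = map redeclare (\<Pi> P)"
| "enc_pred_args \<Pi> R = [IntT, IntT, IntT]"
| "enc_pred_args \<Pi> W = [IntT, IntT, ObjT]"

definition Enc_RW :: "'v \<Rightarrow> ('v, 'p) program \<Rightarrow> ('v enc_var, 'p enc_pred) program" where
  "Enc_RW inp p =
    \<lparr>obj_type = enc_adt (obj_type p),
     decl = enc_decl (decl p),
     pred_args = enc_pred_args (pred_args p),
     body =
       Assign CntAlloc (Num 0) ;;
       Assign Cnt (Num 0) ;;
       Assign CntLast (Num 0) ;;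
       Assign T (Num 0) ;;
       AssertP W [Var (Old inp), Num 0, DefObj] ;;
       enc_stmt (ctors (obj_type p)) inp (body p)\<rparr>"

section \<open>Side conditions on programs\<close>

fun assigned :: "('v, 'p) stmt \<Rightarrow> 'v set" where
  "assigned (Assign x e) = {x}"
| "assigned (Alloc q e) = {q}"
| "assigned (Read x q) = {x}"
| "assigned (S1 ;; S2) = assigned S1 \<union> assigned S2"
| "assigned (If e S1 S2) = assigned S1 \<union> assigned S2"
| "assigned (While e S) = assigned S"
| "assigned _ = {}"

text \<open>The encoding refers to the input value through the variable \<open>inp\<close> throughout the run, so an
  input variable is never overwritten.\<close>

definition input_var :: "('v, 'p) program \<Rightarrow> 'v \<Rightarrow> bool" where
  "input_var p inp \<longleftrightarrow> decl p inp = IntT \<and> inp \<notin> assigned (body p)"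

text \<open>The encoding of \<open>q := alloc(e)\<close> assigns \<open>q\<close> before it evaluates \<open>e\<close>, which preserves the
  meaning only if \<open>q\<close> does not occur in \<open>e\<close>.\<close>

fun alloc_fresh :: "('v, 'p) stmt \<Rightarrow> bool" where
  "alloc_fresh (Alloc q e) \<longleftrightarrow> q \<notin> vars e"
| "alloc_fresh (S1 ;; S2) \<longleftrightarrow> alloc_fresh S1 \<and> alloc_fresh S2"
| "alloc_fresh (If e S1 S2) \<longleftrightarrow> alloc_fresh S1 \<and> alloc_fresh S2"
| "alloc_fresh (While e S) \<longleftrightarrow> alloc_fresh S"
| "alloc_fresh _ \<longleftrightarrow> True"

end

(*
  If the encoding is safe, then so is the program: fix the stack and let last_Addr range over all
  addresses. The run of the encoding with last_Addr = a shows, by its assertions, that R and W hold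
  of every access to a, so each of these runs can pass the assumptions made at accesses to other
  addresses. A failing run of the program therefore yields a failing run of the encoding.

  Conversely, interpret W(i, k, o) as "the k-th heap operation on input i stores o" and R(i, k, t) as
  "the k-th heap operation on input i reads from an address last written by operation t". As the
  execution is determined by the input, both are functional, so the assumptions of the encoding force
  each read to return the object that the program reads.
*)
theory Submission
  imports Defs
begin

section \<open>Encoding along a renaming of addresses\<close>

text \<open>Once addresses are integers, the address variables of an initial stack may hold any
  integer, also a negative one, so this stack need not be the \<open>enc_val\<close> image of a
  program stack. Values are therefore encoded along an injective renaming of addresses, which for
  the second implication is also surjective, so that every stack decodes. The predicates, however,
  are interpreted through \<open>enc_val\<close>, once for all runs. What reconciles the two is that
  a pair of renamings decodes the same integers into two stacks with the same input: their events
  coincide, so the values in events contain only addresses at which the renamings agree. In the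
  first implication the runs for different values of \<open>last_Addr\<close> cannot be treated one
  after the other: each gets past its assumptions only by facts that the others assert. The
  induction along the program run carries all values at once and ends in a dichotomy: some value
  makes the encoding fail, or for every value the seed can be chosen so that the encoding follows
  the program.\<close>

fun enc_with :: "(nat \<Rightarrow> int) \<Rightarrow> val \<Rightarrow> val" where
  "enc_with g (IntV i) = IntV i"
| "enc_with g (AddrV a) = IntV (g a)"
| "enc_with g (ObjV c vs) = ObjV c (map (enc_with g) vs)"

lemma enc_with_int: "enc_with int = enc_val"
proof
  show "enc_with int v = enc_val v" for v by (induction v) auto
qed

text \<open>Injectivity preserves \<open>Eq\<close> on addresses; \<open>0\<close> is kept because
  \<open>Null\<close> becomes \<open>Num 0\<close>, and the default object because
  \<open>enc_adt\<close> fixes it as \<open>enc_val\<close> of the original one.\<close>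

definition renaming :: "adt \<Rightarrow> (nat \<Rightarrow> int) \<Rightarrow> bool" where
  "renaming A g \<longleftrightarrow> inj g \<and> g 0 = 0 \<and> enc_with g (def_obj A) = enc_val (def_obj A)"

lemma renaming_int: "renaming A int"
  by (simp add: renaming_def enc_with_int)

section \<open>Typing and injectivity of encoded values\<close>

inductive_cases has_type_IntT: "has_type D v IntT"
inductive_cases has_type_AddrT: "has_type D v AddrT"
inductive_cases has_type_ObjT: "has_type D v ObjT"

lemma has_type_enc_with:
  "has_type D v t \<Longrightarrow> has_type (map (map redeclare) D) (enc_with g v) (redeclare t)"
proof (induction rule: has_type.induct)
  case (3 c vs)
  then have "list_all2 (has_type (map (map redeclare) D)) (map (enc_with g) vs) (map redeclare (D ! c))"
    by (auto simp: list_all2_conv_all_nth)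
  with 3 show ?case by (auto intro: has_type.intros)
qed (auto intro: has_type.intros)

text \<open>Both values must have the same type: after the encoding an address and an integer can
  coincide, and only the type tells them apart.\<close>

lemma enc_with_inj:
  assumes "inj g"
  shows "has_type D v t \<Longrightarrow> has_type D w t \<Longrightarrow> enc_with g v = enc_with g w \<Longrightarrow> v = w"
proof (induction arbitrary: w rule: has_type.induct)
  case (2 a)
  then show ?case using assms by (auto elim!: has_type_AddrT dest: injD)
next
  case (3 c vs)
  from \<open>has_type D w ObjT\<close> obtain d ws
    where w: "w = ObjV d ws" "list_all2 (has_type D) ws (D ! d)"
    by (auto elim: has_type_ObjT)
  with 3 have "d = c" "map (enc_with g) vs = map (enc_with g) ws" by auto
  moreover have "vs = ws"
  proof (rule nth_equalityI)
    show len: "length vs = length ws" using \<open>map (enc_with g) vs = map (enc_with g) ws\<close>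
      by (rule map_eq_imp_length_eq)
    fix j assume j: "j < length vs"
    then have "enc_with g (vs ! j) = enc_with g (ws ! j)"
      using \<open>map (enc_with g) vs = map (enc_with g) ws\<close> len by (metis nth_map)
    then show "vs ! j = ws ! j"
      using 3(2) w \<open>d = c\<close> j len by (auto simp: list_all2_conv_all_nth)
  qed
  ultimately show ?case using w by simp
qed (auto elim!: has_type_IntT)

lemma enc_with_inj_list:
  assumes "inj g" "list_all2 (has_type D) vs ts" "list_all2 (has_type D) ws ts"
    and eq: "map (enc_with g) vs = map (enc_with g) ws"
  shows "vs = ws"
proof (rule nth_equalityI)
  show len: "length vs = length ws" using eq by (rule map_eq_imp_length_eq)
  fix j assume j: "j < length vs"
  then have "enc_with g (vs ! j) = enc_with g (ws ! j)"
    using eq len by (metis nth_map)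
  with j show "vs ! j = ws ! j"
    using assms(2,3) enc_with_inj[OF \<open>inj g\<close>] by (auto simp: list_all2_conv_all_nth)
qed

section \<open>Evaluation of encoded expressions\<close>

lemma has_type_default_val: "wf_adt A \<Longrightarrow> has_type (ctors A) (default_val A t) t"
  by (cases t) (auto simp: wf_adt_def intro: has_type.intros)

lemma enc_with_default_val:
  "renaming A g \<Longrightarrow> enc_with g (default_val A t) = default_val (enc_adt A) (redeclare t)"
  by (cases t) (auto simp: renaming_def enc_adt_def)

lemma enc_with_of_bool_val [simp]: "enc_with g (of_bool_val b) = of_bool_val b"
  by (simp add: of_bool_val_def)

lemma has_type_of_bool_val [simp]: "has_type D (of_bool_val b) IntT"
  by (auto simp: of_bool_val_def intro: has_type.intros)

lemma eval_bin_type [simp]: "has_type D (eval_bin b i j) IntT"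
  by (cases b) (auto intro: has_type.intros)

lemma enc_with_eval_bin [simp]: "enc_with g (eval_bin b i j) = eval_bin b i j"
  by (cases b) auto

text \<open>Typing and evaluation are proved together, since equality tests are preserved only
  through injectivity on values of one type. Agreement is required on \<open>vars e\<close> alone,
  because the encoded allocation overwrites \<open>q\<close> before it evaluates
  \<open>e\<close>.\<close>

lemma eval_enc_exp:
  assumes A: "wf_adt A" "renaming A g" and s: "\<And>x. has_type (ctors A) (s x) (\<Gamma> x)"
  shows "wt_exp (ctors A) \<Gamma> e t \<Longrightarrow> (\<And>x. x \<in> vars e \<Longrightarrow> \<sigma> (Old x) = enc_with g (s x)) \<Longrightarrow>
    has_type (ctors A) (eval A s e) t \<and>
    eval (enc_adt A) \<sigma> (enc_exp e) = enc_with g (eval A s e)"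
proof (induction rule: wt_exp.induct)
  case (4)
  then show ?case using A by (auto simp: wf_adt_def renaming_def enc_adt_def)
next
  case (8 e1 t e2)
  then have "enc_with g (eval A s e1) = enc_with g (eval A s e2) \<longleftrightarrow> eval A s e1 = eval A s e2"
    using enc_with_inj[of g "ctors A" "eval A s e1" t "eval A s e2"] A
    by (auto simp: renaming_def)
  with 8 show ?case by simp
next
  case (9 c es)
  have *: "has_type (ctors A) (eval A s (es ! j)) (ctors A ! c ! j) \<and>
      eval (enc_adt A) \<sigma> (enc_exp (es ! j)) = enc_with g (eval A s (es ! j))"
    if j: "j < length es" for j
  proof -
    have "\<sigma> (Old x) = enc_with g (s x)" if "x \<in> vars (es ! j)" for x
      using 9(3)[of x] that nth_mem[OF j] by auto
    then show ?thesis using 9 j by (auto simp: list_all2_conv_all_nth)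
  qed
  have "has_type (ctors A) (ObjV c (map (eval A s) es)) ObjT"
    using 9 * by (intro has_type.intros) (auto simp: list_all2_conv_all_nth)
  then show ?case using * by (auto simp: in_set_conv_nth)
next
  case (10 c i e)
  then obtain d vs where v: "eval A s e = ObjV d vs" "list_all2 (has_type (ctors A)) vs (ctors A ! d)"
    by (auto elim: has_type_ObjT)
  then show ?case
    using 10 has_type_default_val[OF A(1)] enc_with_default_val[OF A(2), of "ctors A ! c ! i"]
    by (auto simp: enc_adt_def list_all2_conv_all_nth)
next
  case (11 e c)
  then show ?case by (auto elim!: has_type_ObjT)
qed (use s A in \<open>auto simp: renaming_def elim!: has_type_IntT intro: has_type.intros\<close>)

lemma eval_enc_exps:
  assumes A: "wf_adt A" "renaming A g" and s: "\<And>x. has_type (ctors A) (s x) (\<Gamma> x)"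
    and es: "list_all2 (wt_exp (ctors A) \<Gamma>) es ts"
    and \<sigma>: "\<And>x. \<sigma> (Old x) = enc_with g (s x)"
  shows "list_all2 (has_type (ctors A)) (map (eval A s) es) ts \<and>
    map (eval (enc_adt A) \<sigma>) (map enc_exp es) = map (enc_with g) (map (eval A s) es)"
proof -
  have "j < length es \<Longrightarrow> has_type (ctors A) (eval A s (es ! j)) (ts ! j) \<and>
      eval (enc_adt A) \<sigma> (enc_exp (es ! j)) = enc_with g (eval A s (es ! j))" for j
    using eval_enc_exp[where e = "es ! j" and t = "ts ! j" and \<sigma> = \<sigma>, OF A s] es \<sigma>
    by (auto simp: list_all2_conv_all_nth)
  then show ?thesis using es by (auto simp: list_all2_conv_all_nth in_set_conv_nth)
qed

lemma is_true_enc_exp: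
  assumes "wf_adt A" "renaming A g" "\<And>x. has_type (ctors A) (s x) (\<Gamma> x)"
    "wt_exp (ctors A) \<Gamma> e IntT" "\<And>x. \<sigma> (Old x) = enc_with g (s x)"
  shows "is_true (eval (enc_adt A) \<sigma> (enc_exp e)) \<longleftrightarrow> is_true (eval A s e)"
  using eval_enc_exp[OF assms(1-4), of \<sigma>] assms(5) by (auto elim!: has_type_IntT)

section \<open>Invariants of the encoded run\<close>

definition typed_state :: "adt \<Rightarrow> ('v \<Rightarrow> ty) \<Rightarrow> 'v stack \<Rightarrow> heap \<Rightarrow> bool" where
  "typed_state A \<Gamma> s h \<longleftrightarrow>
     (\<forall>x. has_type (ctors A) (s x) (\<Gamma> x)) \<and> (\<forall>v \<in> set h. has_type (ctors A) v ObjT)"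

text \<open>\<open>n\<close> counts the heap operations performed so far, and \<open>L a\<close> is the number of the operation
  that last wrote to address \<open>a\<close>.\<close>

definition tracks ::
  "(nat \<Rightarrow> int) \<Rightarrow> 'v stack \<Rightarrow> heap \<Rightarrow> nat \<Rightarrow> (nat \<Rightarrow> nat) \<Rightarrow> 'v enc_var stack \<Rightarrow> bool" where
  "tracks g s h n L \<sigma> \<longleftrightarrow>
     (\<forall>x. \<sigma> (Old x) = enc_with g (s x)) \<and> \<sigma> CntAlloc = IntV (int (length h)) \<and>
     \<sigma> Cnt = IntV (int n) \<and>
     (\<forall>a. \<sigma> LastAddr = IntV (g a) \<longrightarrow> \<sigma> CntLast = IntV (int (L a)))"

lemma heap_read_type:
  assumes "wf_adt A" "typed_state A \<Gamma> s h"
  shows "has_type (ctors A) (heap_read A h a) ObjT"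
  using assms by (auto simp: heap_read_def typed_state_def wf_adt_def)

lemma heap_read_alloc:
  "heap_read A (h @ [v]) a = (if a = Suc (length h) then v else heap_read A h a)"
  by (auto simp: heap_read_def nth_append)

lemma heap_read_write:
  "heap_read A (heap_write h b v) a =
     (if a = b \<and> 0 < b \<and> b \<le> length h then v else heap_read A h a)"
  by (auto simp: heap_read_def heap_write_def nth_list_update)

lemma length_heap_write [simp]: "length (heap_write h a v) = length h"
  by (simp add: heap_write_def)

lemma typed_stateD: "typed_state A \<Gamma> s h \<Longrightarrow> has_type (ctors A) (s x) (\<Gamma> x)"
  by (simp add: typed_state_def)

lemma typed_state_upd:
  "typed_state A \<Gamma> s h \<Longrightarrow> has_type (ctors A) v (\<Gamma> x) \<Longrightarrow> typed_state A \<Gamma> (s(x := v)) h"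
  by (simp add: typed_state_def)

lemma typed_state_alloc:
  "typed_state A \<Gamma> s h \<Longrightarrow> has_type (ctors A) v ObjT \<Longrightarrow> typed_state A \<Gamma> s (h @ [v])"
  by (auto simp: typed_state_def)

lemma typed_state_write:
  "typed_state A \<Gamma> s h \<Longrightarrow> has_type (ctors A) v ObjT \<Longrightarrow> typed_state A \<Gamma> s (heap_write h a v)"
  by (auto simp: typed_state_def heap_write_def dest!: set_update_subset_insert[THEN subsetD])

section \<open>Choosing the seed backwards\<close>

text \<open>Each \<open>havoc\<close> consumes low bits of the seed, so the seed that produces prescribed values is
  computed from the end of a run to its beginning.\<close>

definition runs ::
  "adt \<Rightarrow> 'q interp \<Rightarrow> ('v enc_var, 'q) stmt \<Rightarrow> 'v enc_var stack \<Rightarrow> 'v enc_var stack \<Rightarrow> bool" where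
  "runs B J C \<sigma> \<sigma>' \<longleftrightarrow>
     (\<forall>k'. \<exists>k. big_step B J C (\<sigma>(Seed := IntV k)) [] Top (\<sigma>'(Seed := IntV k')) [])"

text \<open>Nothing remains to be prescribed once a run has failed, so one suitable initial seed is
  enough.\<close>

definition fails ::
  "adt \<Rightarrow> 'q interp \<Rightarrow> ('v enc_var, 'q) stmt \<Rightarrow> 'v enc_var stack \<Rightarrow> bool" where
  "fails B J C \<sigma> \<longleftrightarrow> (\<exists>k P vs \<sigma>' h'. big_step B J C (\<sigma>(Seed := IntV k)) [] (Bot P vs) \<sigma>' h')"

lemma runs_Skip: "runs B J Skip \<sigma> \<sigma>"
  by (auto simp: runs_def intro: BSkip)

text \<open>The quantifiers compose from right to left: the seed wanted after \<open>C2\<close>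
  yields one before it, which is the seed wanted after \<open>C1\<close>.\<close>

lemma runs_Seq: "runs B J C1 \<sigma> \<sigma>1 \<Longrightarrow> runs B J C2 \<sigma>1 \<sigma>2 \<Longrightarrow> runs B J (C1 ;; C2) \<sigma> \<sigma>2"
  by (meson runs_def BSeq)

lemma fails_Seq1: "fails B J C1 \<sigma> \<Longrightarrow> fails B J (C1 ;; C2) \<sigma>"
  by (meson fails_def BSeqFail)

lemma fails_Seq2: "runs B J C1 \<sigma> \<sigma>1 \<Longrightarrow> fails B J C2 \<sigma>1 \<Longrightarrow> fails B J (C1 ;; C2) \<sigma>"
  by (meson runs_def fails_def BSeq)

lemma eval_Seed:
  "Seed \<notin> vars e \<Longrightarrow> eval B (\<sigma>(Seed := v)) e = eval B \<sigma> e"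
proof (induction e)
  case (Ctor c es)
  then have "map (eval B (\<sigma>(Seed := v))) es = map (eval B \<sigma>) es"
    by (simp del: fun_upd_apply)
  then show ?case by (simp del: fun_upd_apply)
qed auto

lemma runs_Assign:
  assumes "Seed \<notin> vars e" "x \<noteq> Seed" "eval B \<sigma> e = v"
  shows "runs B J (Assign x e) \<sigma> (\<sigma>(x := v))"
  unfolding runs_def
proof
  fix k
  have "big_step B J (Assign x e) (\<sigma>(Seed := IntV k)) [] Top
      ((\<sigma>(Seed := IntV k))(x := eval B (\<sigma>(Seed := IntV k)) e)) []"
    by (rule BAssign)
  then show "\<exists>k'. big_step B J (Assign x e) (\<sigma>(Seed := IntV k')) [] Top (\<sigma>(x := v, Seed := IntV k)) []"
    using assms by (auto simp: eval_Seed fun_upd_twist)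
qed

lemma big_step_If_iff:
  "big_step A I (If e C1 C2) s h r s' h' \<longleftrightarrow>
     big_step A I (if is_true (eval A s e) then C1 else C2) s h r s' h'"
  by (auto intro: BIfTrue BIfFalse elim: BIfE)

lemma runs_If:
  assumes "Seed \<notin> vars e" "runs B J (if is_true (eval B \<sigma> e) then C1 else C2) \<sigma> \<sigma>'"
  shows "runs B J (If e C1 C2) \<sigma> \<sigma>'"
  using assms by (simp add: runs_def big_step_If_iff eval_Seed del: fun_upd_apply)

lemma fails_If:
  assumes "Seed \<notin> vars e" "fails B J (if is_true (eval B \<sigma> e) then C1 else C2) \<sigma>"
  shows "fails B J (If e C1 C2) \<sigma>"
  using assms by (simp add: fails_def big_step_If_iff eval_Seed del: fun_upd_apply)

lemma runs_WhileTrue: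
  assumes "Seed \<notin> vars e" "is_true (eval B \<sigma> e)" "runs B J (C ;; While e C) \<sigma> \<sigma>'"
  shows "runs B J (While e C) \<sigma> \<sigma>'"
  using assms unfolding runs_def by (metis BWhileTrue eval_Seed)

lemma fails_WhileTrue:
  assumes "Seed \<notin> vars e" "is_true (eval B \<sigma> e)" "fails B J (C ;; While e C) \<sigma>"
  shows "fails B J (While e C) \<sigma>"
  using assms unfolding fails_def by (metis BWhileTrue eval_Seed)

lemma runs_WhileFalse:
  assumes "Seed \<notin> vars e" "\<not> is_true (eval B \<sigma> e)"
  shows "runs B J (While e C) \<sigma> \<sigma>"
  using assms unfolding runs_def by (metis BWhileFalse eval_Seed)

lemma runs_Assume:
  assumes "Seed \<notin> vars e" "is_true (eval B \<sigma> e)"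
  shows "runs B J (Assume e) \<sigma> \<sigma>"
  using assms unfolding runs_def by (metis BAssume eval_Seed)

lemma runs_Assert:
  assumes "Seed \<notin> vars e" "is_true (eval B \<sigma> e)"
  shows "runs B J (Assert e) \<sigma> \<sigma>"
  using assms unfolding runs_def by (metis BAssert eval_Seed)

lemma fails_Assert:
  assumes "Seed \<notin> vars e" "\<not> is_true (eval B \<sigma> e)"
  shows "fails B J (Assert e) \<sigma>"
  using assms unfolding fails_def by (metis BAssertFail eval_Seed)

lemma map_eval_Seed:
  "Seed \<notin> (\<Union>e\<in>set es. vars e) \<Longrightarrow> map (eval B (\<sigma>(Seed := v))) es = map (eval B \<sigma>) es"
  by (auto simp: eval_Seed)

lemma runs_AssumeP:
  assumes "Seed \<notin> (\<Union>e\<in>set es. vars e)" "map (eval B \<sigma>) es \<in> J P"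
  shows "runs B J (AssumeP P es) \<sigma> \<sigma>"
  using assms unfolding runs_def by (metis BAssumeP map_eval_Seed)

lemma runs_AssertP:
  assumes "Seed \<notin> (\<Union>e\<in>set es. vars e)" "map (eval B \<sigma>) es \<in> J P"
  shows "runs B J (AssertP P es) \<sigma> \<sigma>"
  using assms unfolding runs_def by (metis BAssertP map_eval_Seed)

lemma fails_AssertP:
  assumes "Seed \<notin> (\<Union>e\<in>set es. vars e)" "map (eval B \<sigma>) es \<notin> J P"
  shows "fails B J (AssertP P es) \<sigma>"
  using assms unfolding fails_def by (metis BAssertPFail map_eval_Seed)

section \<open>Steering \<open>havoc\<close> to a prescribed value\<close>

abbreviation havoc_loop :: "'v enc_var \<Rightarrow> ('v enc_var, 'q) stmt" where
  "havoc_loop x \<equiv> While (Eq (Bin Mod (Var Seed) (Num 2)) (Num 1))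
      (Assign Seed (Bin Div (Var Seed) (Num 2)) ;;
       Assign x (Bin Plus (Bin Times (Num 2) (Var x)) (Bin Mod (Var Seed) (Num 2))) ;;
       Assign Seed (Bin Div (Var Seed) (Num 2)))"

lemma BAssignI: "eval B \<sigma> e = v \<Longrightarrow> \<sigma>' = \<sigma>(x := v) \<Longrightarrow> big_step B J (Assign x e) \<sigma> h Top \<sigma>' h"
  using BAssign by fastforce

text \<open>One iteration read backwards: \<open>v\<close> is
  \<open>2 * (v div 2) + v mod 2\<close>, and the seed acquires two low bits, the continuation bit
  \<open>1\<close> and above it the digit \<open>v mod 2\<close>.\<close>

lemma havoc_loop_once:
  assumes "x \<noteq> Seed"
    and "big_step B J (havoc_loop x) (\<sigma>(x := IntV v, Seed := IntV k)) h Top \<sigma>' h'"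
  shows "big_step B J (havoc_loop x)
    (\<sigma>(x := IntV (v div 2), Seed := IntV (1 + 2 * (v mod 2 + 2 * k)))) h Top \<sigma>' h'"
proof (rule BWhileTrue)
  define w where "w = v mod 2 + 2 * k"
  have w: "w mod 2 = v mod 2" "w div 2 = k" unfolding w_def by presburger+
  let ?\<sigma> = "\<sigma>(x := IntV (v div 2), Seed := IntV (1 + 2 * w))"
  let ?\<sigma>1 = "\<sigma>(x := IntV (v div 2), Seed := IntV w)"
  let ?\<sigma>2 = "\<sigma>(x := IntV v, Seed := IntV w)"
  let ?\<sigma>3 = "\<sigma>(x := IntV v, Seed := IntV k)"
  show "is_true (eval B (\<sigma>(x := IntV (v div 2), Seed := IntV (1 + 2 * (v mod 2 + 2 * k))))
      (Eq (Bin Mod (Var Seed) (Num 2)) (Num 1)))"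
    unfolding w_def[symmetric] by (simp add: is_true_def of_bool_val_def)
  have 1: "big_step B J (Assign Seed (Bin Div (Var Seed) (Num 2))) ?\<sigma> h Top ?\<sigma>1 h"
    by (rule BAssignI) auto
  have 2: "big_step B J (Assign x (Bin Plus (Bin Times (Num 2) (Var x)) (Bin Mod (Var Seed) (Num 2))))
      ?\<sigma>1 h Top ?\<sigma>2 h"
    by (rule BAssignI) (use w assms(1) in \<open>auto simp: fun_eq_iff\<close>)
  have 3: "big_step B J (Assign Seed (Bin Div (Var Seed) (Num 2))) ?\<sigma>2 h Top ?\<sigma>3 h"
    by (rule BAssignI) (use w in auto)
  show "big_step B J ((Assign Seed (Bin Div (Var Seed) (Num 2)) ;;
       Assign x (Bin Plus (Bin Times (Num 2) (Var x)) (Bin Mod (Var Seed) (Num 2))) ;;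
       Assign Seed (Bin Div (Var Seed) (Num 2))) ;; havoc_loop x)
      (\<sigma>(x := IntV (v div 2), Seed := IntV (1 + 2 * (v mod 2 + 2 * k)))) h Top \<sigma>' h'"
    unfolding w_def[symmetric] by (rule BSeq[OF BSeq[OF 1 BSeq[OF 2 3]] assms(2)])
qed

text \<open>Undoing iterations halves \<open>v\<close>, rounding towards minus infinity, until
  \<open>0\<close> or \<open>-1\<close> is left. These are exactly the values that the first
  assignment of \<open>havoc\<close> can give to \<open>x\<close>.\<close>

lemma havoc_loop_prefix:
  assumes "x \<noteq> Seed"
    and "big_step B J (havoc_loop x) (\<sigma>(x := IntV v, Seed := IntV k)) h Top \<sigma>' h'"
  shows "\<exists>k0. \<exists>b \<in> {0, 1}.
    big_step B J (havoc_loop x) (\<sigma>(x := IntV (- b), Seed := IntV k0)) h Top \<sigma>' h'"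
  using assms(2)
\<comment> \<open>The measure is twice the distance to \<open>-1/2\<close>, the midpoint of the two
  fixed points \<open>0\<close> and \<open>-1\<close> of halving; it drops strictly everywhere
  else.\<close>
proof (induction "nat \<bar>2 * v + 1\<bar>" arbitrary: v k rule: less_induct)
  case less
  show ?case
  proof (cases "v = 0 \<or> v = -1")
    case True
    then have "v = - 0 \<or> v = - 1" by simp
    then show ?thesis using less.prems by blast
  next
    case False
    then have "v div 2 < v \<and> 0 \<le> v div 2 \<or> v < v div 2 \<and> v div 2 < 0" by presburger
    then have "nat \<bar>2 * (v div 2) + 1\<bar> < nat \<bar>2 * v + 1\<bar>" by linarith
    then show ?thesis using less.hyps havoc_loop_once[OF assms(1) less.prems] by blast
  qed
qed

lemma runs_havoc:
  assumes "x \<noteq> Seed"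
  shows "runs B J (havoc x) \<sigma> (\<sigma>(x := IntV v))"
  unfolding runs_def
proof
  fix k'
  \<comment> \<open>The seed \<open>2 * k'\<close> carries the bit \<open>0\<close> that stops the
    loop; the last division of \<open>havoc\<close> removes it and leaves \<open>k'\<close>.\<close>
  let ?F = "\<sigma>(x := IntV v, Seed := IntV (2 * k'))"
  have "big_step B J (havoc_loop x) ?F [] Top ?F []"
    by (rule BWhileFalse) (simp add: is_true_def of_bool_val_def)
  from havoc_loop_prefix[OF assms this] obtain k0 b where b: "b \<in> {0, 1}"
    and loop: "big_step B J (havoc_loop x) (\<sigma>(x := IntV (- b), Seed := IntV k0)) [] Top ?F []"
    by blast
  \<comment> \<open>The lowest bit selects the sign, and the rest is the seed that the loop
    expects.\<close>
  let ?k = "b + 2 * k0"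
  let ?\<sigma> = "\<sigma>(Seed := IntV ?k)"
  have 1: "big_step B J (Assign x (Neg (Bin Mod (Var Seed) (Num 2)))) ?\<sigma> [] Top (?\<sigma>(x := IntV (- b))) []"
    by (rule BAssignI) (use b in auto)
  have 2: "big_step B J (Assign Seed (Bin Div (Var Seed) (Num 2))) (?\<sigma>(x := IntV (- b))) [] Top
      (\<sigma>(x := IntV (- b), Seed := IntV k0)) []"
    by (rule BAssignI) (use b assms in \<open>auto simp: fun_eq_iff\<close>)
  have 3: "big_step B J (Assign Seed (Bin Div (Var Seed) (Num 2))) ?F [] Top
      (\<sigma>(x := IntV v, Seed := IntV k')) []"
    by (rule BAssignI) auto
  show "\<exists>k. big_step B J (havoc x) (\<sigma>(Seed := IntV k)) [] Top (\<sigma>(x := IntV v, Seed := IntV k')) []"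
    unfolding havoc_def using BSeq[OF 1 BSeq[OF 2 BSeq[OF loop 3]]] by blast
qed

lemma runs_havoc_args:
  "runs B J (havoc_args n) \<sigma>
     (\<lambda>y. case y of HArg i \<Rightarrow> if i < n then IntV (f i) else \<sigma> y | _ \<Rightarrow> \<sigma> y)"
proof -
  \<comment> \<open>The index list is generalised, because \<open>foldr\<close> peels off its head
    and leaves an interval that no longer starts at \<open>0\<close>.\<close>
  have "runs B J (foldr (\<lambda>i S. havoc (HArg i) ;; S) is Skip) \<sigma>
     (\<lambda>y. case y of HArg i \<Rightarrow> if i \<in> set is then IntV (f i) else \<sigma> y | _ \<Rightarrow> \<sigma> y)" for "is"
  proof (induction "is" arbitrary: \<sigma>)
    case Nil
    have "(\<lambda>y. case y of HArg i \<Rightarrow> if i \<in> set [] then IntV (f i) else \<sigma> y | _ \<Rightarrow> \<sigma> y) = \<sigma>"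
      by (auto simp: fun_eq_iff split: enc_var.splits)
    then show ?case by (simp add: runs_Skip)
  next
    case (Cons j js)
    let ?\<sigma> = "\<sigma>(HArg j := IntV (f j))"
    have "(\<lambda>y. case y of HArg i \<Rightarrow> if i \<in> set (j # js) then IntV (f i) else \<sigma> y | _ \<Rightarrow> \<sigma> y) =
       (\<lambda>y. case y of HArg i \<Rightarrow> if i \<in> set js then IntV (f i) else ?\<sigma> y | _ \<Rightarrow> ?\<sigma> y)"
      by (auto simp: fun_eq_iff split: enc_var.splits)
    moreover have "runs B J (havoc (HArg j) ;; foldr (\<lambda>i S. havoc (HArg i) ;; S) js Skip) \<sigma>
       (\<lambda>y. case y of HArg i \<Rightarrow> if i \<in> set js then IntV (f i) else ?\<sigma> y | _ \<Rightarrow> ?\<sigma> y)"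
      by (rule runs_Seq[OF runs_havoc Cons.IH]) simp
    ultimately show ?case by simp
  qed
  from this[of "[0..<n]"] show ?thesis by (simp add: havoc_args_def cong: enc_var.case_cong)
qed

lemma runs_havoc_obj:
  assumes c: "c < length D" and v: "v = ObjV c (map IntV zs)" "length zs = length (D ! c)"
  shows "\<exists>\<sigma>'. runs B J (havoc_obj D (Old x)) \<sigma> \<sigma>' \<and> \<sigma>' (Old x) = v \<and>
    (\<forall>y. y \<noteq> Old x \<longrightarrow> y \<noteq> HTag \<longrightarrow> y \<notin> range HArg \<longrightarrow> \<sigma>' y = \<sigma> y)"
proof -
  define \<sigma>1 where "\<sigma>1 = \<sigma>(HTag := IntV (int c))"
  define n where "n = length (D ! c)"
  define \<sigma>2 where "\<sigma>2 = (\<lambda>y. case y of HArg i \<Rightarrow> if i < n then IntV (zs ! i) else \<sigma>1 y | _ \<Rightarrow> \<sigma>1 y)"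
  define \<sigma>3 where "\<sigma>3 = \<sigma>2(Old x := v)"
  have "map (\<lambda>i. \<sigma>2 (HArg i)) [0..<n] = map IntV zs"
    using v by (auto simp: \<sigma>2_def n_def intro!: nth_equalityI)
  then have ev: "eval B \<sigma>2 (Ctor c (map (\<lambda>i. Var (HArg i)) [0..<n])) = v"
    using v by (simp add: comp_def)
  have tag: "eval B \<sigma>1 (Eq (Var HTag) (Num (int d))) = of_bool_val (c = d)" for d
    by (simp add: \<sigma>1_def)
  have branch: "runs B J (havoc_args n ;; Assign (Old x) (Ctor c (map (\<lambda>i. Var (HArg i)) [0..<n]))) \<sigma>1 \<sigma>3"
    unfolding \<sigma>3_def
    by (rule runs_Seq[OF _ runs_Assign[OF _ _ ev]])
      (use runs_havoc_args[of B J n \<sigma>1 "\<lambda>i. zs ! i"] in \<open>auto simp: \<sigma>2_def\<close>)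
  \<comment> \<open>Any list of tags containing \<open>c\<close> will do: the tests before
    \<open>c\<close> fail, and the branch for \<open>c\<close> ends in
    \<open>\<sigma>3\<close>.\<close>
  have "c \<in> set cs \<Longrightarrow> runs B J (foldr (\<lambda>c S. If (Eq (Var HTag) (Num (int c)))
                    (havoc_args (length (D ! c)) ;;
                     Assign (Old x) (Ctor c (map (\<lambda>i. Var (HArg i)) [0..<length (D ! c)])))
                    S) cs (Assign (Old x) DefObj)) \<sigma>1 \<sigma>3" for cs
  proof (induction cs)
    case (Cons d ds)
    show ?case
    proof (cases "d = c")
      case True
      then show ?thesis using branch
        by (auto simp del: eval.simps simp: tag is_true_def of_bool_val_def n_def intro!: runs_If)
    next
      case False
      then show ?thesis using Cons
        by (auto simp del: eval.simps simp: tag is_true_def of_bool_val_def intro!: runs_If)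
    qed
  qed simp
  then have "runs B J (havoc_obj D (Old x)) \<sigma> \<sigma>3"
    unfolding havoc_obj_def using c by (intro runs_Seq[OF runs_havoc[where v = "int c"]]) (auto simp: \<sigma>1_def)
  moreover have "\<sigma>3 y = \<sigma> y" if "y \<noteq> Old x" "y \<noteq> HTag" "y \<notin> range HArg" for y
    using that by (auto simp: \<sigma>3_def \<sigma>2_def \<sigma>1_def split: enc_var.splits)
  ultimately show ?thesis by (intro exI[of _ \<sigma>3]) (auto simp: \<sigma>3_def)
qed

text \<open>The data type is non-recursive, so every argument is an integer or an address and
  becomes an integer; \<open>havoc_obj\<close> can therefore produce every encoded object.\<close>

lemma enc_obj_form:
  assumes "wf_adt A" "has_type (ctors A) v ObjT"
  shows "\<exists>c zs. c < length (ctors A) \<and> enc_with g v = ObjV c (map IntV zs) \<and>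
    length zs = length (ctors A ! c)"
proof -
  obtain c vs where v: "v = ObjV c vs" "c < length (ctors A)"
    "list_all2 (has_type (ctors A)) vs (ctors A ! c)"
    using assms(2) by (auto elim: has_type_ObjT)
  have "enc_with g w = IntV (to_int (enc_with g w))" if w: "w \<in> set vs" for w
  proof -
    obtain t where "t \<in> set (ctors A ! c)" "has_type (ctors A) w t"
      using w v(3) by (metis in_set_conv_nth list_all2_conv_all_nth)
    moreover have "t \<noteq> ObjT" using assms(1) v(2) \<open>t \<in> _\<close> by (auto simp: wf_adt_def)
    ultimately show ?thesis by - (cases t, auto elim!: has_type_IntT has_type_AddrT)
  qed
  then have "enc_with g v = ObjV c (map IntV (map (to_int \<circ> enc_with g) vs))"
    using v(1) by simp
  then show ?thesis using v list_all2_lengthD[OF v(3)]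
    by (intro exI[of _ c] exI[of _ "map (to_int \<circ> enc_with g) vs"]) simp
qed

section \<open>Safety of the encoding implies safety\<close>

lemma vars_enc_exp: "vars (enc_exp e) = Old ` vars e"
  by (induction e) auto

lemma Seed_enc_exps: "Seed \<notin> (\<Union>e\<in>set (map enc_exp es). vars e)"
  by (auto simp: vars_enc_exp)

text \<open>The quantifier covers unallocated addresses as well: there \<open>heap_read\<close>
  gives the default object, which the initial assertion on \<open>W\<close> registers under
  operation \<open>0\<close>.\<close>

definition stored :: "adt \<Rightarrow> 'p enc_pred interp \<Rightarrow> int \<Rightarrow> heap \<Rightarrow> (nat \<Rightarrow> nat) \<Rightarrow> bool" where
  "stored A J i h L \<longleftrightarrow> (\<forall>a. [IntV i, IntV (int (L a)), enc_val (heap_read A h a)] \<in> J W)"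

definition tracks_at ::
  "'v stack \<Rightarrow> heap \<Rightarrow> nat \<Rightarrow> (nat \<Rightarrow> nat) \<Rightarrow> nat \<Rightarrow> 'v enc_var stack \<Rightarrow> bool" where
  "tracks_at s h n L a \<sigma> \<longleftrightarrow> tracks int s h n L \<sigma> \<and> \<sigma> LastAddr = IntV (int a)"

text \<open>All values of \<open>LastAddr\<close> are followed at once, and the resulting
  \<open>n'\<close> and \<open>L'\<close> are the same for each of them. An assertion on
  \<open>R\<close> is executed only for the value equal to the address read, which is why
  \<open>sim_fails\<close> asks for one value only.\<close>

definition sim_runs where
  "sim_runs A J C s h n L s' h' n' L' \<longleftrightarrow>
     (\<forall>a \<sigma>. tracks_at s h n L a \<sigma> \<longrightarrow>
        (\<exists>\<sigma>'. runs (enc_adt A) J C \<sigma> \<sigma>' \<and> tracks_at s' h' n' L' a \<sigma>'))"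

definition sim_fails where
  "sim_fails A J C s h n L \<longleftrightarrow>
     (\<exists>a. \<forall>\<sigma>. tracks_at s h n L a \<sigma> \<longrightarrow> fails (enc_adt A) J C \<sigma>)"

lemma sim_runs_Seq:
  "sim_runs A J C1 s h n L s1 h1 n1 L1 \<Longrightarrow> sim_runs A J C2 s1 h1 n1 L1 s2 h2 n2 L2 \<Longrightarrow>
   sim_runs A J (C1 ;; C2) s h n L s2 h2 n2 L2"
  unfolding sim_runs_def by (meson runs_Seq)

lemma sim_fails_Seq1: "sim_fails A J C1 s h n L \<Longrightarrow> sim_fails A J (C1 ;; C2) s h n L"
  unfolding sim_fails_def by (meson fails_Seq1)

lemma sim_fails_Seq2:
  "sim_runs A J C1 s h n L s1 h1 n1 L1 \<Longrightarrow> sim_fails A J C2 s1 h1 n1 L1 \<Longrightarrow>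
   sim_fails A J (C1 ;; C2) s h n L"
  unfolding sim_runs_def sim_fails_def by (meson fails_Seq2)

text \<open>For an assertion that is executed whatever \<open>LastAddr\<close> is, any value serves
  as the witness; \<open>0\<close> is chosen.\<close>

lemma sim_fails_all:
  "(\<And>\<sigma>. tracks_at s h n L 0 \<sigma> \<Longrightarrow> fails (enc_adt A) J C \<sigma>) \<Longrightarrow> sim_fails A J C s h n L"
  unfolding sim_fails_def by blast

lemma tracks_atD:
  assumes "tracks_at s h n L a \<sigma>"
  shows "\<sigma> (Old x) = enc_with int (s x)" "\<sigma> CntAlloc = IntV (int (length h))"
    "\<sigma> Cnt = IntV (int n)" "\<sigma> CntLast = IntV (int (L a))" "\<sigma> LastAddr = IntV (int a)"
  using assms by (auto simp: tracks_at_def tracks_def)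

lemma tracks_atI:
  assumes "\<And>x. \<sigma> (Old x) = enc_with int (s x)" "\<sigma> CntAlloc = IntV (int (length h))"
    "\<sigma> Cnt = IntV (int n)" "\<sigma> CntLast = IntV (int (L a))" "\<sigma> LastAddr = IntV (int a)"
  shows "tracks_at s h n L a \<sigma>"
  using assms by (auto simp: tracks_at_def tracks_def)

lemma runs_CntLast:
  assumes "\<sigma> LastAddr = IntV (int b)" "\<sigma> (Old q) = IntV (int a)" "\<sigma> Cnt = IntV (int n)"
    "\<sigma> CntLast = IntV (int (L b))"
  shows "runs B J (If (Eq (Var LastAddr) (Var (Old q))) (Assign CntLast (Var Cnt)) Skip) \<sigma>
    (\<sigma>(CntLast := IntV (int ((L(a := n)) b))))"
proof (cases "b = a")
  case True
  then show ?thesis using assms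
    by (intro runs_If) (auto simp: is_true_def of_bool_val_def intro!: runs_Assign)
next
  case False
  \<comment> \<open>The update of \<open>L\<close> at \<open>a\<close> is invisible at
    \<open>b\<close>, so the assignment recorded by the uniform conclusion changes nothing.\<close>
  then have "\<sigma>(CntLast := IntV (int ((L(a := n)) b))) = \<sigma>" using assms(4) by (auto simp: fun_eq_iff)
  then show ?thesis using assms False
    by (intro runs_If) (auto simp: is_true_def of_bool_val_def runs_Skip)
qed

section \<open>Simulation of single statements for all values of \<open>LastAddr\<close>\<close>

lemma sim_Alloc:
  assumes A: "wf_adt A" and T: "typed_state A \<Gamma> s h"
    and e: "wt_exp (ctors A) \<Gamma> e ObjT" "q \<notin> vars e" and inp: "s inp = IntV i" "inp \<noteq> q"
  defines "v \<equiv> eval A s e"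
  shows "[IntV i, IntV (int (Suc n)), enc_val v] \<notin> J W \<Longrightarrow>
      sim_fails A J (enc_stmt (ctors A) inp (Alloc q e)) s h n L"
    and "[IntV i, IntV (int (Suc n)), enc_val v] \<in> J W \<Longrightarrow>
      sim_runs A J (enc_stmt (ctors A) inp (Alloc q e)) s h n L
        (s(q := AddrV (Suc (length h)))) (h @ [v]) (Suc n) (L(Suc (length h) := Suc n))"
proof -
  let ?a = "Suc (length h)"
  let ?\<sigma>1 = "\<lambda>\<sigma>. \<sigma>(CntAlloc := IntV (int ?a))"
  let ?\<sigma>2 = "\<lambda>\<sigma>. (?\<sigma>1 \<sigma>)(Old q := IntV (int ?a))"
  let ?\<sigma>3 = "\<lambda>\<sigma>. (?\<sigma>2 \<sigma>)(Cnt := IntV (int (Suc n)))"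
  have 1: "runs B J (Assign CntAlloc (Bin Plus (Var CntAlloc) (Num 1))) \<sigma> (?\<sigma>1 \<sigma>)"
    if "tracks_at s h n L b \<sigma>" for B J b \<sigma>
    by (rule runs_Assign) (use tracks_atD[OF that] in auto)
  have 2: "runs B J (Assign (Old q) (Var CntAlloc)) (?\<sigma>1 \<sigma>) (?\<sigma>2 \<sigma>)" for B J \<sigma>
    by (rule runs_Assign) auto
  have 3: "runs B J (Assign Cnt (Bin Plus (Var Cnt) (Num 1))) (?\<sigma>2 \<sigma>) (?\<sigma>3 \<sigma>)"
    if "tracks_at s h n L b \<sigma>" for B J b \<sigma>
    by (rule runs_Assign) (use tracks_atD[OF that] in auto)
  have args: "map (eval (enc_adt A) (?\<sigma>3 \<sigma>)) [Var (Old inp), Var Cnt, enc_exp e] =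
      [IntV i, IntV (int (Suc n)), enc_val v]" if "tracks_at s h n L b \<sigma>" for b \<sigma>
  proof -
    \<comment> \<open>In this state \<open>q\<close> already holds the new address;
      \<open>q \<notin> vars e\<close> protects the value of \<open>e\<close>.\<close>
    have "eval (enc_adt A) (?\<sigma>3 \<sigma>) (enc_exp e) = enc_with int (eval A s e)"
      by (rule eval_enc_exp[OF A renaming_int typed_stateD[OF T] e(1), THEN conjunct2])
        (use e(2) tracks_atD[OF that] in auto)
    then show ?thesis using tracks_atD[OF that] inp by (simp add: v_def enc_with_int)
  qed
  have seed: "Seed \<notin> (\<Union>e\<in>set [Var (Old inp), Var Cnt, enc_exp e]. vars e)"
    by (auto simp: vars_enc_exp)
  show "sim_fails A J (enc_stmt (ctors A) inp (Alloc q e)) s h n L"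
    if "[IntV i, IntV (int (Suc n)), enc_val v] \<notin> J W"
  proof (rule sim_fails_all)
    fix \<sigma> assume \<sigma>: "tracks_at s h n L 0 \<sigma>"
    show "fails (enc_adt A) J (enc_stmt (ctors A) inp (Alloc q e)) \<sigma>"
      unfolding enc_stmt.simps
      by (rule fails_Seq2[OF 1[OF \<sigma>] fails_Seq2[OF 2 fails_Seq2[OF 3[OF \<sigma>]
            fails_Seq1[OF fails_AssertP[OF seed]]]]])
        (use that args[OF \<sigma>] in auto)
  qed
  show "sim_runs A J (enc_stmt (ctors A) inp (Alloc q e)) s h n L
        (s(q := AddrV ?a)) (h @ [v]) (Suc n) (L(?a := Suc n))"
    if "[IntV i, IntV (int (Suc n)), enc_val v] \<in> J W"
    unfolding sim_runs_def
  proof (intro allI impI)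
    fix b \<sigma> assume \<sigma>: "tracks_at s h n L b \<sigma>"
    let ?\<sigma>4 = "(?\<sigma>3 \<sigma>)(CntLast := IntV (int ((L(?a := Suc n)) b)))"
    have "runs (enc_adt A) J (AssertP W [Var (Old inp), Var Cnt, enc_exp e]) (?\<sigma>3 \<sigma>) (?\<sigma>3 \<sigma>)"
      by (rule runs_AssertP[OF seed]) (use that args[OF \<sigma>] in auto)
    moreover have "runs (enc_adt A) J
        (If (Eq (Var LastAddr) (Var (Old q))) (Assign CntLast (Var Cnt)) Skip) (?\<sigma>3 \<sigma>) ?\<sigma>4"
      by (rule runs_CntLast) (use tracks_atD[OF \<sigma>] in auto)
    ultimately have "runs (enc_adt A) J (enc_stmt (ctors A) inp (Alloc q e)) \<sigma> ?\<sigma>4"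
      unfolding enc_stmt.simps by (intro runs_Seq[OF 1[OF \<sigma>] runs_Seq[OF 2 runs_Seq[OF 3[OF \<sigma>] runs_Seq]]])
    moreover have "tracks_at (s(q := AddrV ?a)) (h @ [v]) (Suc n) (L(?a := Suc n)) b ?\<sigma>4"
      by (rule tracks_atI) (use tracks_atD[OF \<sigma>] in auto)
    ultimately show "\<exists>\<sigma>'. runs (enc_adt A) J (enc_stmt (ctors A) inp (Alloc q e)) \<sigma> \<sigma>' \<and>
        tracks_at (s(q := AddrV ?a)) (h @ [v]) (Suc n) (L(?a := Suc n)) b \<sigma>'" by blast
  qed
qed

lemma sim_Write:
  assumes A: "wf_adt A" and T: "typed_state A \<Gamma> s h"
    and e: "wt_exp (ctors A) \<Gamma> e ObjT" and inp: "s inp = IntV i" and q: "s q = AddrV a"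
  defines "v \<equiv> eval A s e" and "ok \<equiv> 0 < a \<and> a \<le> length h"
  shows "ok \<Longrightarrow> [IntV i, IntV (int (Suc n)), enc_val v] \<notin> J W \<Longrightarrow>
      sim_fails A J (enc_stmt (ctors A) inp (Write q e)) s h n L"
    and "\<not> ok \<or> [IntV i, IntV (int (Suc n)), enc_val v] \<in> J W \<Longrightarrow>
      sim_runs A J (enc_stmt (ctors A) inp (Write q e)) s h n L
        s (heap_write h a v) (Suc n) (if ok then L(a := Suc n) else L)"
proof -
  let ?\<sigma>1 = "\<lambda>\<sigma>. \<sigma>(Cnt := IntV (int (Suc n)))"
  let ?g = "Bin And (Bin Less (Num 0) (Var (Old q))) (Bin Leq (Var (Old q)) (Var CntAlloc)) :: 'a enc_var exp"
  have 1: "runs B J (Assign Cnt (Bin Plus (Var Cnt) (Num 1))) \<sigma> (?\<sigma>1 \<sigma>)"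
    if "tracks_at s h n L b \<sigma>" for B J b \<sigma>
    by (rule runs_Assign) (use tracks_atD[OF that] in auto)
  have args: "map (eval (enc_adt A) (?\<sigma>1 \<sigma>)) [Var (Old inp), Var Cnt, enc_exp e] =
      [IntV i, IntV (int (Suc n)), enc_val v]" if "tracks_at s h n L b \<sigma>" for b \<sigma>
  proof -
    have "eval (enc_adt A) (?\<sigma>1 \<sigma>) (enc_exp e) = enc_with int (eval A s e)"
      by (rule eval_enc_exp[OF A renaming_int typed_stateD[OF T] e(1), THEN conjunct2])
        (use e tracks_atD[OF that] in auto)
    then show ?thesis using tracks_atD[OF that] inp by (simp add: v_def enc_with_int)
  qed
  have guard: "is_true (eval (enc_adt A) (?\<sigma>1 \<sigma>) ?g) \<longleftrightarrow> ok"
    if "tracks_at s h n L b \<sigma>" for b \<sigma>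
    using tracks_atD[OF that] q by (simp add: is_true_def of_bool_val_def ok_def)
  have seed: "Seed \<notin> (\<Union>e\<in>set [Var (Old inp), Var Cnt, enc_exp e]. vars e)" "Seed \<notin> vars ?g"
    by (auto simp: vars_enc_exp)
  show "sim_fails A J (enc_stmt (ctors A) inp (Write q e)) s h n L"
    if "ok" "[IntV i, IntV (int (Suc n)), enc_val v] \<notin> J W"
  proof (rule sim_fails_all)
    fix \<sigma> assume \<sigma>: "tracks_at s h n L 0 \<sigma>"
    have "map (eval (enc_adt A) (?\<sigma>1 \<sigma>)) [Var (Old inp), Var Cnt, enc_exp e] \<notin> J W"
      unfolding args[OF \<sigma>] by (rule that)
    note a = fails_Seq1[OF fails_AssertP[where J = J and P = W, OF seed(1) this]]
    show "fails (enc_adt A) J (enc_stmt (ctors A) inp (Write q e)) \<sigma>"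
      unfolding enc_stmt.simps
      by (intro fails_Seq2[OF 1[OF \<sigma>] fails_If[OF seed(2)]])
        (simp only: guard[OF \<sigma>] that(1) if_True a)
  qed
  show "sim_runs A J (enc_stmt (ctors A) inp (Write q e)) s h n L
        s (heap_write h a v) (Suc n) (if ok then L(a := Suc n) else L)"
    if or: "\<not> ok \<or> [IntV i, IntV (int (Suc n)), enc_val v] \<in> J W"
    unfolding sim_runs_def
  proof (intro allI impI)
    fix b \<sigma> assume \<sigma>: "tracks_at s h n L b \<sigma>"
    show "\<exists>\<sigma>'. runs (enc_adt A) J (enc_stmt (ctors A) inp (Write q e)) \<sigma> \<sigma>' \<and>
        tracks_at s (heap_write h a v) (Suc n) (if ok then L(a := Suc n) else L) b \<sigma>'"
    proof (cases ok)
      case True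
      let ?\<sigma>2 = "(?\<sigma>1 \<sigma>)(CntLast := IntV (int ((L(a := Suc n)) b)))"
      have "map (eval (enc_adt A) (?\<sigma>1 \<sigma>)) [Var (Old inp), Var Cnt, enc_exp e] \<in> J W"
        unfolding args[OF \<sigma>] using or True by simp
      note a = runs_AssertP[where J = J and P = W, OF seed(1) this]
      have b: "runs (enc_adt A) J
          (If (Eq (Var LastAddr) (Var (Old q))) (Assign CntLast (Var Cnt)) Skip) (?\<sigma>1 \<sigma>) ?\<sigma>2"
        by (rule runs_CntLast) (use tracks_atD[OF \<sigma>] q in auto)
      have "runs (enc_adt A) J (enc_stmt (ctors A) inp (Write q e)) \<sigma> ?\<sigma>2"
        unfolding enc_stmt.simps
        by (intro runs_Seq[OF 1[OF \<sigma>] runs_If[OF seed(2)]])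
          (simp only: guard[OF \<sigma>] True if_True runs_Seq[OF a b])
      moreover have "tracks_at s (heap_write h a v) (Suc n) (L(a := Suc n)) b ?\<sigma>2"
        by (rule tracks_atI) (use tracks_atD[OF \<sigma>] in auto)
      ultimately show ?thesis using True by auto
    next
      case False
      have "runs (enc_adt A) J (enc_stmt (ctors A) inp (Write q e)) \<sigma> (?\<sigma>1 \<sigma>)"
        unfolding enc_stmt.simps
        by (intro runs_Seq[OF 1[OF \<sigma>] runs_If[OF seed(2)]])
          (simp only: guard[OF \<sigma>] False if_False runs_Skip)
      moreover have "tracks_at s (heap_write h a v) (Suc n) L b (?\<sigma>1 \<sigma>)"
        by (rule tracks_atI) (use tracks_atD[OF \<sigma>] in auto)
      ultimately show ?thesis using False by auto
    qed
  qed
qed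

text \<open>Only the run with \<open>LastAddr\<close> equal to \<open>a\<close> asserts the fact
  about \<open>R\<close>. If the fact is missing, that run fails; if it holds, the other runs guess
  \<open>L a\<close> and pass their assumption, and \<open>stored\<close> lets all of them guess the
  object read.\<close>

lemma sim_Read:
  assumes A: "wf_adt A" and T: "typed_state A \<Gamma> s h"
    and inp: "s inp = IntV i" "inp \<noteq> x" and q: "s q = AddrV a" and st: "stored A J i h L"
  shows "[IntV i, IntV (int (Suc n)), IntV (int (L a))] \<notin> J R \<Longrightarrow>
      sim_fails A J (enc_stmt (ctors A) inp (Read x q)) s h n L"
    and "[IntV i, IntV (int (Suc n)), IntV (int (L a))] \<in> J R \<Longrightarrow>
      sim_runs A J (enc_stmt (ctors A) inp (Read x q)) s h n L (s(x := heap_read A h a)) h (Suc n) L"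
proof -
  let ?v = "heap_read A h a"
  let ?\<sigma>1 = "\<lambda>\<sigma>. \<sigma>(Cnt := IntV (int (Suc n)))"
  let ?\<sigma>2 = "\<lambda>\<sigma>. (?\<sigma>1 \<sigma>)(T := IntV (int (L a)))"
  let ?g = "Eq (Var LastAddr) (Var (Old q)) :: 'a enc_var exp"
  have 1: "runs B J (Assign Cnt (Bin Plus (Var Cnt) (Num 1))) \<sigma> (?\<sigma>1 \<sigma>)"
    if "tracks_at s h n L b \<sigma>" for B J b \<sigma>
    by (rule runs_Assign) (use tracks_atD[OF that] in auto)
  have guard: "is_true (eval (enc_adt A) (?\<sigma>1 \<sigma>) ?g) \<longleftrightarrow> b = a"
    if "tracks_at s h n L b \<sigma>" for b \<sigma>
    using tracks_atD[OF that] q by (simp add: is_true_def of_bool_val_def)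
  have args: "map (eval (enc_adt A) (?\<sigma>1 \<sigma>)) [Var (Old inp), Var Cnt, Var CntLast] =
      [IntV i, IntV (int (Suc n)), IntV (int (L a))]" if "tracks_at s h n L a \<sigma>" for \<sigma>
    using tracks_atD[OF that] inp by simp
  show "sim_fails A J (enc_stmt (ctors A) inp (Read x q)) s h n L"
    if notR: "[IntV i, IntV (int (Suc n)), IntV (int (L a))] \<notin> J R"
    unfolding sim_fails_def
  proof (intro exI[of _ a] allI impI)
    fix \<sigma> assume \<sigma>: "tracks_at s h n L a \<sigma>"
    have "map (eval (enc_adt A) (?\<sigma>1 \<sigma>)) [Var (Old inp), Var Cnt, Var CntLast] \<notin> J R"
      unfolding args[OF \<sigma>] by (rule notR)
    then have "fails (enc_adt A) J (AssertP R [Var (Old inp), Var Cnt, Var CntLast]) (?\<sigma>1 \<sigma>)"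
      by (intro fails_AssertP) auto
    note a = fails_Seq1[OF this]
    show "fails (enc_adt A) J (enc_stmt (ctors A) inp (Read x q)) \<sigma>"
      unfolding enc_stmt.simps
      by (rule fails_Seq2[OF 1[OF \<sigma>] fails_Seq1[OF fails_If]], simp)
        (simp only: guard[OF \<sigma>] simp_thms if_True a)
  qed
  show "sim_runs A J (enc_stmt (ctors A) inp (Read x q)) s h n L (s(x := ?v)) h (Suc n) L"
    if R: "[IntV i, IntV (int (Suc n)), IntV (int (L a))] \<in> J R"
    unfolding sim_runs_def
  proof (intro allI impI)
    fix b \<sigma> assume \<sigma>: "tracks_at s h n L b \<sigma>"
    let ?ch = "If ?g
      (AssertP R [Var (Old inp), Var Cnt, Var CntLast] ;; Assign T (Var CntLast))
      (havoc T ;; AssumeP R [Var (Old inp), Var Cnt, Var T])"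
    have 2: "runs (enc_adt A) J ?ch (?\<sigma>1 \<sigma>) (?\<sigma>2 \<sigma>)"
    proof (cases "b = a")
      case True
      have *: "map (eval (enc_adt A) (?\<sigma>1 \<sigma>)) [Var (Old inp), Var Cnt, Var CntLast] \<in> J R"
        using args[of \<sigma>] \<sigma> True R by simp
      have "runs (enc_adt A) J
          (AssertP R [Var (Old inp), Var Cnt, Var CntLast] ;; Assign T (Var CntLast)) (?\<sigma>1 \<sigma>) (?\<sigma>2 \<sigma>)"
        by (rule runs_Seq[OF runs_AssertP[where J = J and P = R, OF _ *] runs_Assign]) (use tracks_atD[OF \<sigma>] True in auto)
      then show ?thesis using guard[OF \<sigma>] True by (intro runs_If) simp_all
    next
      case False
      have *: "map (eval (enc_adt A) (?\<sigma>2 \<sigma>)) [Var (Old inp), Var Cnt, Var T] \<in> J R"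
        using tracks_atD[OF \<sigma>] inp R by simp
      have "runs (enc_adt A) J (havoc T ;; AssumeP R [Var (Old inp), Var Cnt, Var T]) (?\<sigma>1 \<sigma>) (?\<sigma>2 \<sigma>)"
        by (rule runs_Seq[OF runs_havoc runs_AssumeP[where J = J and P = R, OF _ *]]) auto
      then show ?thesis using guard[OF \<sigma>] False by (intro runs_If) simp_all
    qed
    obtain c zs where c: "c < length (ctors A)" "enc_with int ?v = ObjV c (map IntV zs)"
      "length zs = length (ctors A ! c)"
      using enc_obj_form[OF A heap_read_type[OF A T]] by blast
    obtain \<sigma>3 where 3: "runs (enc_adt A) J (havoc_obj (ctors A) (Old x)) (?\<sigma>2 \<sigma>) \<sigma>3"
      and \<sigma>3: "\<sigma>3 (Old x) = enc_with int ?v"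
        "\<And>y. y \<noteq> Old x \<Longrightarrow> y \<noteq> HTag \<Longrightarrow> y \<notin> range HArg \<Longrightarrow> \<sigma>3 y = (?\<sigma>2 \<sigma>) y"
      using runs_havoc_obj[OF c, of "enc_adt A" J x "?\<sigma>2 \<sigma>"] by blast
    have "map (eval (enc_adt A) \<sigma>3) [Var (Old inp), Var T, Var (Old x)] \<in> J W"
      using \<sigma>3 inp tracks_atD[OF \<sigma>] st by (simp add: stored_def enc_with_int image_iff)
    then have "runs (enc_adt A) J (enc_stmt (ctors A) inp (Read x q)) \<sigma> \<sigma>3"
      unfolding enc_stmt.simps
      by (intro runs_Seq[OF 1[OF \<sigma>] runs_Seq[OF 2 runs_Seq[OF 3 runs_AssumeP]]]) auto
    moreover have "tracks_at (s(x := ?v)) h (Suc n) L b \<sigma>3"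
      by (rule tracks_atI) (use tracks_atD[OF \<sigma>] \<sigma>3 in \<open>auto simp: image_iff\<close>)
    ultimately show "\<exists>\<sigma>'. runs (enc_adt A) J (enc_stmt (ctors A) inp (Read x q)) \<sigma> \<sigma>' \<and>
        tracks_at (s(x := ?v)) h (Suc n) L b \<sigma>'" by blast
  qed
qed

lemma sim_Assign:
  assumes "wf_adt A" "typed_state A \<Gamma> s h" "wt_exp (ctors A) \<Gamma> e (\<Gamma> x)"
  shows "sim_runs A J (enc_stmt (ctors A) inp (Assign x e)) s h n L (s(x := eval A s e)) h n L"
  unfolding sim_runs_def
proof (intro allI impI)
  fix a \<sigma> assume \<sigma>: "tracks_at s h n L a \<sigma>"
  have "eval (enc_adt A) \<sigma> (enc_exp e) = enc_with int (eval A s e)"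
    using eval_enc_exp[OF assms(1) renaming_int typed_stateD[OF assms(2)] assms(3)] tracks_atD[OF \<sigma>]
    by blast
  then have "runs (enc_adt A) J (enc_stmt (ctors A) inp (Assign x e)) \<sigma>
      (\<sigma>(Old x := enc_with int (eval A s e)))"
    unfolding enc_stmt.simps by (intro runs_Assign) (auto simp: vars_enc_exp)
  moreover have "tracks_at (s(x := eval A s e)) h n L a (\<sigma>(Old x := enc_with int (eval A s e)))"
    by (rule tracks_atI) (use tracks_atD[OF \<sigma>] in auto)
  ultimately show "\<exists>\<sigma>'. runs (enc_adt A) J (enc_stmt (ctors A) inp (Assign x e)) \<sigma> \<sigma>' \<and>
      tracks_at (s(x := eval A s e)) h n L a \<sigma>'" by blast
qed

lemma sim_runs_same:
  "(\<And>a \<sigma>. tracks_at s h n L a \<sigma> \<Longrightarrow> runs (enc_adt A) J C \<sigma> \<sigma>) \<Longrightarrow> sim_runs A J C s h n L s h n L"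
  unfolding sim_runs_def by blast

lemma Seed_enc_exp: "Seed \<notin> vars (enc_exp e)"
  by (auto simp: vars_enc_exp)

lemma tracks_at_guard:
  assumes "wf_adt A" "typed_state A \<Gamma> s h" "wt_exp (ctors A) \<Gamma> e IntT" "tracks_at s h n L a \<sigma>"
  shows "is_true (eval (enc_adt A) \<sigma> (enc_exp e)) \<longleftrightarrow> is_true (eval A s e)"
  using is_true_enc_exp[OF assms(1) renaming_int typed_stateD[OF assms(2)] assms(3)]
    tracks_atD(1)[OF assms(4)] by blast

lemma tracks_at_args:
  assumes "wf_adt A" "typed_state A \<Gamma> s h" "list_all2 (wt_exp (ctors A) \<Gamma>) es ts"
    "tracks_at s h n L a \<sigma>"
  shows "list_all2 (has_type (ctors A)) (map (eval A s) es) ts"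
    and "map (eval (enc_adt A) \<sigma>) (map enc_exp es) = map enc_val (map (eval A s) es)"
  using eval_enc_exps[OF assms(1) renaming_int typed_stateD[OF assms(2)] assms(3), of \<sigma>]
    tracks_atD(1)[OF assms(4)] by (auto simp: enc_with_int)

text \<open>\<open>I\<close> pulls \<open>J\<close> back along \<open>enc_val\<close> and cuts it to
  well-typed arguments, so the predicate tests of both programs agree. As the second alternative
  includes \<open>r = Top\<close>, a failing run of the program leaves only the first.\<close>

lemma simulates_or_fails:
  fixes p :: "('v, 'p) program" and J :: "'p enc_pred interp"
  defines "I \<equiv> \<lambda>P. {vs. list_all2 (has_type (ctors (obj_type p))) vs (pred_args p P) \<and>
      map enc_val vs \<in> J (OldP P)}"
  assumes A: "wf_adt (obj_type p)"
  shows "big_step (obj_type p) I S s h r s' h' \<Longrightarrow>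
    wt_stmt (ctors (obj_type p)) (pred_args p) (decl p) S \<Longrightarrow> alloc_fresh S \<Longrightarrow> inp \<notin> assigned S \<Longrightarrow>
    typed_state (obj_type p) (decl p) s h \<Longrightarrow> s inp = IntV i \<Longrightarrow> stored (obj_type p) J i h L \<Longrightarrow>
    sim_fails (obj_type p) J (enc_stmt (ctors (obj_type p)) inp S) s h n L \<or>
    r = Top \<and> typed_state (obj_type p) (decl p) s' h' \<and> s' inp = IntV i \<and>
    (\<exists>n' L'. stored (obj_type p) J i h' L' \<and>
      sim_runs (obj_type p) J (enc_stmt (ctors (obj_type p)) inp S) s h n L s' h' n' L')"
proof (induction arbitrary: n L rule: big_step.induct)
  case (BSkip s h)
  then show ?case by (auto intro!: exI sim_runs_same runs_Skip)
next
  case (BAssign x e s h)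
  then have e: "wt_exp (ctors (obj_type p)) (decl p) e (decl p x)" by (auto elim: wt_stmt.cases)
  \<comment> \<open>Only the typing half of \<open>eval_enc_exp\<close> is wanted, so any encoded
    stack that agrees with \<open>s\<close> will do.\<close>
  have "has_type (ctors (obj_type p)) (eval (obj_type p) s e) (decl p x)"
    using eval_enc_exp[OF A renaming_int typed_stateD[OF BAssign(4)] e, of "\<lambda>y. case y of Old z \<Rightarrow> enc_with int (s z)"]
    by simp
  then have "typed_state (obj_type p) (decl p) (s(x := eval (obj_type p) s e)) h"
    by (intro typed_state_upd BAssign)
  moreover have "(s(x := eval (obj_type p) s e)) inp = IntV i" using BAssign by auto
  ultimately show ?case using BAssign(6) sim_Assign[OF A BAssign(4) e] by blast
next
  case (BAlloc h s e h' a q)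
  then have e: "wt_exp (ctors (obj_type p)) (decl p) e ObjT" "q \<notin> vars e" "decl p q = AddrT" "inp \<noteq> q"
    by (auto elim: wt_stmt.cases)
  have ha: "h' = h @ [eval (obj_type p) s e]" "a = Suc (length h)"
    using BAlloc(1) by (auto simp: allocate_def)
  have v: "has_type (ctors (obj_type p)) (eval (obj_type p) s e) ObjT"
    using eval_enc_exp[OF A renaming_int typed_stateD[OF BAlloc(5)] e(1), of "\<lambda>y. case y of Old z \<Rightarrow> enc_with int (s z)"]
    by simp
  show ?case
  proof (cases "[IntV i, IntV (int (Suc n)), enc_val (eval (obj_type p) s e)] \<in> J W")
    case False
    then show ?thesis using sim_Alloc(1)[where J = J, OF A BAlloc(5) e(1,2) BAlloc(6) e(4)] by blast
  next
    case True
    have "stored (obj_type p) J i h' (L(Suc (length h) := Suc n))"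
      using BAlloc(7) True by (auto simp: stored_def ha heap_read_alloc)
    moreover have "typed_state (obj_type p) (decl p) (s(q := AddrV a)) h'"
      unfolding ha by (intro typed_state_alloc typed_state_upd BAlloc(5) v)
        (simp add: e has_type.intros)
    moreover have "(s(q := AddrV a)) inp = IntV i" using BAlloc(6) e(4) by simp
    ultimately show ?thesis
      using sim_Alloc(2)[where J = J, OF A BAlloc(5) e(1,2) BAlloc(6) e(4) True] unfolding ha by blast
  qed
next
  case (BRead s q a x h)
  then have x: "decl p x = ObjT" "inp \<noteq> x" by (auto elim: wt_stmt.cases)
  have "typed_state (obj_type p) (decl p) (s(x := heap_read (obj_type p) h a)) h"
    by (intro typed_state_upd BRead) (simp add: x heap_read_type[OF A BRead(5)])
  moreover have "(s(x := heap_read (obj_type p) h a)) inp = IntV i" using BRead(6) x by simp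
  ultimately show ?case
    using sim_Read[where J = J, OF A BRead(5) BRead(6) x(2) BRead(1) BRead(7), of n] BRead(7) by blast
next
  case (BWrite s q a e h)
  then have e: "wt_exp (ctors (obj_type p)) (decl p) e ObjT" by (auto elim: wt_stmt.cases)
  have v: "has_type (ctors (obj_type p)) (eval (obj_type p) s e) ObjT"
    using eval_enc_exp[OF A renaming_int typed_stateD[OF BWrite(5)] e(1), of "\<lambda>y. case y of Old z \<Rightarrow> enc_with int (s z)"]
    by simp
  let ?ok = "0 < a \<and> a \<le> length h"
  show ?case
  proof (cases "\<not> ?ok \<or> [IntV i, IntV (int (Suc n)), enc_val (eval (obj_type p) s e)] \<in> J W")
    case False
    then show ?thesis using sim_Write(1)[where J = J, OF A BWrite(5) e(1) BWrite(6) BWrite(1)] by blast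
  next
    case True
    have "stored (obj_type p) J i (heap_write h a (eval (obj_type p) s e)) (if ?ok then L(a := Suc n) else L)"
      using BWrite(7) True by (auto simp: stored_def heap_read_write)
    then show ?thesis
      using sim_Write(2)[where J = J, OF A BWrite(5) e(1) BWrite(6) BWrite(1) True] BWrite(6)
        typed_state_write[OF BWrite(5) v] by blast
  qed
next
  case (BSeq S1 s h s' h' S2 r s'' h'')
  from BSeq.prems have wt: "wt_stmt (ctors (obj_type p)) (pred_args p) (decl p) S1"
    "wt_stmt (ctors (obj_type p)) (pred_args p) (decl p) S2" by (auto elim: wt_stmt.cases)
  from BSeq.IH(1)[OF wt(1), of L n] BSeq.prems consider
    "sim_fails (obj_type p) J (enc_stmt (ctors (obj_type p)) inp S1) s h n L"
    | n1 L1 where "typed_state (obj_type p) (decl p) s' h'" "s' inp = IntV i"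
      "stored (obj_type p) J i h' L1"
      "sim_runs (obj_type p) J (enc_stmt (ctors (obj_type p)) inp S1) s h n L s' h' n1 L1"
    by auto
  then show ?case
  proof cases
    case 1
    then show ?thesis by (simp add: sim_fails_Seq1)
  next
    case 2
    then show ?thesis using BSeq.IH(2)[OF wt(2), of L1 n1] BSeq.prems
      by (auto intro: sim_fails_Seq2 sim_runs_Seq)
  qed
next
  case (BSeqFail S1 s h P vs s' h' S2)
  from BSeqFail.prems have "wt_stmt (ctors (obj_type p)) (pred_args p) (decl p) S1"
    by (auto elim: wt_stmt.cases)
  then show ?case using BSeqFail.IH[of L n] BSeqFail.prems by (auto simp: sim_fails_Seq1)
next
  case (BIfTrue s e S1 h r s' h' S2)
  from BIfTrue.prems have wt: "wt_exp (ctors (obj_type p)) (decl p) e IntT"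
    "wt_stmt (ctors (obj_type p)) (pred_args p) (decl p) S1" by (auto elim: wt_stmt.cases)
  note g = tracks_at_guard[OF A BIfTrue.prems(4) wt(1)]
  have "runs (enc_adt (obj_type p)) J (enc_stmt (ctors (obj_type p)) inp (If e S1 S2)) \<sigma> \<sigma>'"
    if "tracks_at s h n L a \<sigma>" "runs (enc_adt (obj_type p)) J (enc_stmt (ctors (obj_type p)) inp S1) \<sigma> \<sigma>'" for a \<sigma> \<sigma>'
    using that BIfTrue.hyps(1) by (simp add: runs_If Seed_enc_exp g)
  moreover have "fails (enc_adt (obj_type p)) J (enc_stmt (ctors (obj_type p)) inp (If e S1 S2)) \<sigma>"
    if "tracks_at s h n L a \<sigma>" "fails (enc_adt (obj_type p)) J (enc_stmt (ctors (obj_type p)) inp S1) \<sigma>" for a \<sigma>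
    using that BIfTrue.hyps(1) by (simp add: fails_If Seed_enc_exp g)
  ultimately show ?case using BIfTrue.IH[OF wt(2), of L n] BIfTrue.prems
    unfolding sim_runs_def sim_fails_def by simp meson
next
  case (BIfFalse s e S2 h r s' h' S1)
  from BIfFalse.prems have wt: "wt_exp (ctors (obj_type p)) (decl p) e IntT"
    "wt_stmt (ctors (obj_type p)) (pred_args p) (decl p) S2" by (auto elim: wt_stmt.cases)
  note g = tracks_at_guard[OF A BIfFalse.prems(4) wt(1)]
  have "runs (enc_adt (obj_type p)) J (enc_stmt (ctors (obj_type p)) inp (If e S1 S2)) \<sigma> \<sigma>'"
    if "tracks_at s h n L a \<sigma>" "runs (enc_adt (obj_type p)) J (enc_stmt (ctors (obj_type p)) inp S2) \<sigma> \<sigma>'" for a \<sigma> \<sigma>'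
    using that BIfFalse.hyps(1) by (simp add: runs_If Seed_enc_exp g)
  moreover have "fails (enc_adt (obj_type p)) J (enc_stmt (ctors (obj_type p)) inp (If e S1 S2)) \<sigma>"
    if "tracks_at s h n L a \<sigma>" "fails (enc_adt (obj_type p)) J (enc_stmt (ctors (obj_type p)) inp S2) \<sigma>" for a \<sigma>
    using that BIfFalse.hyps(1) by (simp add: fails_If Seed_enc_exp g)
  ultimately show ?case using BIfFalse.IH[OF wt(2), of L n] BIfFalse.prems
    unfolding sim_runs_def sim_fails_def by simp meson
next
  case (BWhileTrue s e S h r s' h')
  from BWhileTrue.prems have wt: "wt_exp (ctors (obj_type p)) (decl p) e IntT"
    "wt_stmt (ctors (obj_type p)) (pred_args p) (decl p) S" by (auto elim: wt_stmt.cases)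
  have wt2: "wt_stmt (ctors (obj_type p)) (pred_args p) (decl p) (S ;; While e S)"
    by (intro wt_stmt.intros wt)
  note g = tracks_at_guard[OF A BWhileTrue.prems(4) wt(1)]
  have "runs (enc_adt (obj_type p)) J (enc_stmt (ctors (obj_type p)) inp (While e S)) \<sigma> \<sigma>'"
    if "tracks_at s h n L a \<sigma>" "runs (enc_adt (obj_type p)) J (enc_stmt (ctors (obj_type p)) inp (S ;; While e S)) \<sigma> \<sigma>'" for a \<sigma> \<sigma>'
    using that BWhileTrue.hyps(1) by (simp add: runs_WhileTrue Seed_enc_exp g)
  moreover have "fails (enc_adt (obj_type p)) J (enc_stmt (ctors (obj_type p)) inp (While e S)) \<sigma>"
    if "tracks_at s h n L a \<sigma>" "fails (enc_adt (obj_type p)) J (enc_stmt (ctors (obj_type p)) inp (S ;; While e S)) \<sigma>" for a \<sigma>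
    using that BWhileTrue.hyps(1) by (simp add: fails_WhileTrue Seed_enc_exp g)
  ultimately show ?case using BWhileTrue.IH[OF wt2, of L n] BWhileTrue.prems
    unfolding sim_runs_def sim_fails_def by (simp del: enc_stmt.simps) meson
next
  case (BWhileFalse s e S h)
  then have wt: "wt_exp (ctors (obj_type p)) (decl p) e IntT" by (auto elim: wt_stmt.cases)
  note g = tracks_at_guard[OF A BWhileFalse.prems(4) wt(1)]
  have "sim_runs (obj_type p) J (enc_stmt (ctors (obj_type p)) inp (While e S)) s h n L s h n L"
    by (rule sim_runs_same) (use BWhileFalse.hyps in \<open>simp add: runs_WhileFalse Seed_enc_exp g\<close>)
  then show ?case using BWhileFalse.prems by auto
next
  case (BAssume s e h)
  then have wt: "wt_exp (ctors (obj_type p)) (decl p) e IntT" by (auto elim: wt_stmt.cases)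
  note g = tracks_at_guard[OF A BAssume.prems(4) wt(1)]
  have "sim_runs (obj_type p) J (enc_stmt (ctors (obj_type p)) inp (Assume e)) s h n L s h n L"
    by (rule sim_runs_same) (use BAssume.hyps in \<open>simp add: runs_Assume Seed_enc_exp g\<close>)
  then show ?case using BAssume.prems by auto
next
  case (BAssert s e h)
  then have wt: "wt_exp (ctors (obj_type p)) (decl p) e IntT" by (auto elim: wt_stmt.cases)
  note g = tracks_at_guard[OF A BAssert.prems(4) wt(1)]
  have "sim_runs (obj_type p) J (enc_stmt (ctors (obj_type p)) inp (Assert e)) s h n L s h n L"
    by (rule sim_runs_same) (use BAssert.hyps in \<open>simp add: runs_Assert Seed_enc_exp g\<close>)
  then show ?case using BAssert.prems by auto
next
  case (BAssertFail s e h)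
  then have wt: "wt_exp (ctors (obj_type p)) (decl p) e IntT" by (auto elim: wt_stmt.cases)
  note g = tracks_at_guard[OF A BAssertFail.prems(4) wt(1)]
  have "sim_fails (obj_type p) J (enc_stmt (ctors (obj_type p)) inp (Assert e)) s h n L"
    by (rule sim_fails_all) (use BAssertFail.hyps in \<open>simp add: fails_Assert Seed_enc_exp g\<close>)
  then show ?case by auto
next
  case (BAssumeP s es P h)
  then have wt: "list_all2 (wt_exp (ctors (obj_type p)) (decl p)) es (pred_args p P)"
    by (auto elim: wt_stmt.cases)
  note g = tracks_at_args[OF A BAssumeP.prems(4) wt]
  have "sim_runs (obj_type p) J (enc_stmt (ctors (obj_type p)) inp (AssumeP P es)) s h n L s h n L"
    unfolding enc_stmt.simps
    by (rule sim_runs_same, rule runs_AssumeP[OF Seed_enc_exps], subst g(2), assumption)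
      (use BAssumeP.hyps in \<open>simp add: I_def\<close>)
  then show ?case using BAssumeP.prems by auto
next
  case (BAssertP s es P h)
  then have wt: "list_all2 (wt_exp (ctors (obj_type p)) (decl p)) es (pred_args p P)"
    by (auto elim: wt_stmt.cases)
  note g = tracks_at_args[OF A BAssertP.prems(4) wt]
  have "sim_runs (obj_type p) J (enc_stmt (ctors (obj_type p)) inp (AssertP P es)) s h n L s h n L"
    unfolding enc_stmt.simps
    by (rule sim_runs_same, rule runs_AssertP[OF Seed_enc_exps], subst g(2), assumption)
      (use BAssertP.hyps in \<open>simp add: I_def\<close>)
  then show ?case using BAssertP.prems by auto
next
  case (BAssertPFail s es P h)
  then have wt: "list_all2 (wt_exp (ctors (obj_type p)) (decl p)) es (pred_args p P)"
    by (auto elim: wt_stmt.cases)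
  note g = tracks_at_args[OF A BAssertPFail.prems(4) wt]
  have "sim_fails (obj_type p) J (enc_stmt (ctors (obj_type p)) inp (AssertP P es)) s h n L"
    unfolding enc_stmt.simps
    by (rule sim_fails_all, rule fails_AssertP[OF Seed_enc_exps], subst g(2), assumption)
      (use BAssertPFail.hyps g(1) in \<open>auto simp: I_def\<close>)
  then show ?case by auto
qed

lemma safe_if_Enc_RW_safe:
  assumes wf: "wf_program p" and inp: "input_var p inp" and af: "alloc_fresh (body p)"
    and safe: "safe (Enc_RW inp p)"
  shows "safe p"
proof -
  let ?A = "obj_type p"
  from wf have A: "wf_adt ?A" and wt: "wt_stmt (ctors ?A) (pred_args p) (decl p) (body p)"
    by (auto simp: wf_program_def)
  from safe obtain J where J: "is_interp (Enc_RW inp p) J"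
    and nofail: "\<And>s P vs s' h'. is_stack (Enc_RW inp p) s \<Longrightarrow>
      \<not> big_step (enc_adt ?A) J (body (Enc_RW inp p)) s [] (Bot P vs) s' h'"
    by (auto simp: safe_def Enc_RW_def)
  define I where "I = (\<lambda>P. {vs. list_all2 (has_type (ctors ?A)) vs (pred_args p P) \<and>
      map enc_val vs \<in> J (OldP P)})"
  show ?thesis unfolding safe_def
  proof (intro exI[of _ I] conjI allI impI notI)
    show "is_interp p I" by (auto simp: is_interp_def I_def)
    fix s assume s: "is_stack p s"
    assume "\<exists>P vs s' h'. big_step ?A I (body p) s [] (Bot P vs) s' h'"
    then obtain P vs s' h' where bs: "big_step ?A I (body p) s [] (Bot P vs) s' h'" by blast
    have T: "typed_state ?A (decl p) s []" using s by (simp add: typed_state_def is_stack_def)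
    have "has_type (ctors ?A) (s inp) IntT" using s inp unfolding is_stack_def input_var_def by metis
    then obtain i where i: "s inp = IntV i" by (auto elim: has_type_IntT)
    \<comment> \<open>All counters are \<open>0\<close> here, so the initial assignments leave this
      stack unchanged and it is already the state in which the encoded body starts.\<close>
    define \<sigma> where "\<sigma> = (\<lambda>a y. case y of Old x \<Rightarrow> enc_val (s x) | LastAddr \<Rightarrow> IntV (int a) | _ \<Rightarrow> IntV 0)"
    have stack: "is_stack (Enc_RW inp p) ((\<sigma> a)(Seed := IntV k))" for a k
      using s has_type_enc_with[of "ctors ?A" _ _ int]
      by (auto simp: is_stack_def Enc_RW_def enc_adt_def \<sigma>_def enc_with_int intro: has_type.intros
        split: enc_var.splits)
    have tr: "tracks_at s [] 0 (\<lambda>_. 0) a (\<sigma> a)" for a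
      by (rule tracks_atI) (auto simp: \<sigma>_def enc_with_int)
    have zero: "runs B K (Assign x (Num 0)) (\<sigma> a) (\<sigma> a)"
      if "x \<in> {CntAlloc, Cnt, CntLast, T}" for B K x a
    proof -
      have "(\<sigma> a)(x := IntV 0) = \<sigma> a" using that by (auto simp: \<sigma>_def fun_eq_iff)
      then show ?thesis using runs_Assign[of "Num 0" x B "\<sigma> a" "IntV 0" K] that by auto
    qed
    have args: "map (eval (enc_adt ?A) (\<sigma> a)) [Var (Old inp), Num 0, DefObj] =
        [IntV i, IntV 0, enc_val (def_obj ?A)]" for a
      by (simp add: \<sigma>_def i enc_adt_def)
    have nofail': "\<not> fails (enc_adt ?A) J (body (Enc_RW inp p)) (\<sigma> a)" for a
      using nofail[OF stack] by (auto simp: fails_def)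
    have prefix: "fails (enc_adt ?A) J (AssertP W [Var (Old inp), Num 0, DefObj] ;;
        enc_stmt (ctors ?A) inp (body p)) (\<sigma> a) \<Longrightarrow>
      fails (enc_adt ?A) J (body (Enc_RW inp p)) (\<sigma> a)" for a
      unfolding Enc_RW_def program.simps by (intro fails_Seq2[OF zero]) auto
    \<comment> \<open>Were this fact missing, the initial assertion would fail in a safe
      program.\<close>
    have W: "[IntV i, IntV 0, enc_val (def_obj ?A)] \<in> J W"
    proof (rule ccontr)
      assume "\<not> ?thesis"
      then have "fails (enc_adt ?A) J (AssertP W [Var (Old inp), Num 0, DefObj]) (\<sigma> 0)"
        by (intro fails_AssertP) (auto simp: args[simplified])
      then show False using fails_Seq1 prefix nofail' by blast
    qed
    then have st: "stored ?A J i [] (\<lambda>_. 0)"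
      by (auto simp: stored_def heap_read_def)
    from simulates_or_fails[OF A bs[unfolded I_def] wt af _ T i st, of 0] inp
    obtain a where "fails (enc_adt ?A) J (enc_stmt (ctors ?A) inp (body p)) (\<sigma> a)"
      using tr by (auto simp: sim_fails_def input_var_def)
    moreover have "runs (enc_adt ?A) J (AssertP W [Var (Old inp), Num 0, DefObj]) (\<sigma> a) (\<sigma> a)"
      by (rule runs_AssertP) (use W args[of a] in auto)
    ultimately show False using fails_Seq2 prefix nofail' by blast
  qed
qed

section \<open>Traces\<close>

lemma step_deterministic:
  "step A I C ev C' \<Longrightarrow> step A I C ev2 C2 \<Longrightarrow> ev2 = ev \<and> C2 = C'"
proof (induction arbitrary: ev2 C2 rule: step.induct)
  case (SSeq S1 s h ev S1' s' h' S2)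
  from SSeq.prems show ?case by (cases rule: step.cases) (use SSeq.IH in blast)+
next
  case (SSeqTop S1 s h ev s' h' S2)
  from SSeqTop.prems show ?case by (cases rule: step.cases) (use SSeqTop.IH in blast)+
next
  case (SSeqFail S1 s h ev P vs s' h' S2)
  from SSeqFail.prems show ?case by (cases rule: step.cases) (use SSeqFail.IH in blast)+
qed (erule step.cases; simp)+

lemma steps_events_unique:
  "steps A I C evs C1 \<Longrightarrow> steps A I C evs' C2 \<Longrightarrow> length evs = length evs' \<Longrightarrow> evs = evs'"
proof (induction arbitrary: evs' C2 rule: steps.induct)
  case (steps_Cons C ev C' evs C'')
  then obtain ev2 C2' evs2 where *: "evs' = ev2 # evs2" "step A I C ev2 C2'" "steps A I C2' evs2 C2"
    by (auto elim: steps.cases)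
  then have "ev2 = ev \<and> C2' = C'" using step_deterministic steps_Cons.hyps(1) by blast
  then show ?case using * steps_Cons by auto
qed simp

lemma steps_prefix: "steps A I C (evs @ evs') C' \<Longrightarrow> \<exists>C1. steps A I C evs C1"
proof (induction evs arbitrary: C)
  case Nil
  then show ?case by (auto intro: steps_Nil)
next
  case (Cons ev evs)
  then show ?case by (auto elim!: steps.cases[of _ _ _ "ev # _"] intro: steps.intros) (metis steps_Cons)
qed

text \<open>The prefixes of all executions with input \<open>i\<close> are merged. For a program
  determined by its input they form one chain under the prefix order, also when the run diverges or
  is blocked.\<close>

definition traces :: "('v, 'p) program \<Rightarrow> 'v \<Rightarrow> 'p interp \<Rightarrow> int \<Rightarrow> ('v, 'p) event list set" where
  "traces p inp I i = {evs. \<exists>s. is_stack p s \<and> s inp = IntV i \<and> evs \<in> execution p I s}"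

lemma traces_prefix: "evs @ evs' \<in> traces p inp I i \<Longrightarrow> evs \<in> traces p inp I i"
  by (auto simp: traces_def execution_def dest: steps_prefix)

lemma traces_unique:
  assumes "determined_by p inp" "is_interp p I"
    and "evs \<in> traces p inp I i" "evs' \<in> traces p inp I i" "length evs = length evs'"
  shows "evs = evs'"
proof -
  obtain s s' where s: "is_stack p s" "s inp = IntV i" "evs \<in> execution p I s"
    "is_stack p s'" "s' inp = IntV i" "evs' \<in> execution p I s'"
    using assms(3,4) unfolding traces_def by blast
  then have "execution p I s = execution p I s'"
    using assms(1,2) unfolding determined_by_def by metis
  with s have "evs' \<in> execution p I s" by simp
  with s(3) show ?thesis
    using steps_events_unique assms(5) unfolding execution_def by blast
qed

text \<open>The longer trace is cut to the length of the shorter one; prefixes of traces are traces,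
  and traces of equal length coincide.\<close>

lemma traces_append:
  assumes "determined_by p inp" "is_interp p I"
    and "evs \<in> traces p inp I i" "evs' \<in> traces p inp I i" "length evs \<le> length evs'"
  shows "\<exists>zs. evs' = evs @ zs"
proof -
  have "evs' = take (length evs) evs' @ drop (length evs) evs'" by simp
  moreover from this have "take (length evs) evs' \<in> traces p inp I i"
    using assms(4) traces_prefix by metis
  ultimately show ?thesis using traces_unique[OF assms(1-3)] assms(5) by (metis length_take min.absorb2)
qed

fun failing :: "('v, 'p) event \<Rightarrow> bool" where
  "failing (EAssert b) \<longleftrightarrow> \<not> b"
| "failing (EAssertP P vs b) \<longleftrightarrow> \<not> b"
| "failing _ \<longleftrightarrow> False"

lemma step_failing: "step A I C ev C' \<Longrightarrow> failing ev \<Longrightarrow> \<exists>P vs s h. C' = Halt (Bot P vs) s h"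
  by (induction rule: step.induct) auto

text \<open>A failing event halts the execution, so it can only be the last one.\<close>

lemma steps_failing:
  "steps A I C evs C' \<Longrightarrow> ev \<in> set evs \<Longrightarrow> failing ev \<Longrightarrow> \<exists>P vs s h. C' = Halt (Bot P vs) s h"
proof (induction rule: steps.induct)
  case (steps_Cons C ev' C' evs C'')
  show ?case
  proof (cases "ev = ev'")
    case True
    then show ?thesis using step_failing steps_Cons by (fastforce elim: steps.cases HaltE)
  next
    case False
    then show ?thesis using steps_Cons by auto
  qed
qed simp

lemma steps_Seq_lift:
  "steps A I (Run S1 s h) evs C \<Longrightarrow> \<exists>C'. steps A I (Run (S1 ;; S2) s h) evs C'"
proof (induction "Run S1 s h" evs C arbitrary: S1 s h rule: steps.induct)
  case steps_Nil
  then show ?case by (blast intro: steps.steps_Nil)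
next
  case (steps_Cons ev C' evs C'')
  show ?case
  proof (cases C')
    case (Run S1' s1 h1)
    then show ?thesis using steps_Cons by (metis SSeq steps.steps_Cons)
  next
    case (Halt r s1 h1)
    then have "evs = []" using steps_Cons(2) by (auto elim: steps.cases HaltE)
    moreover obtain C1 where "step A I (Run (S1 ;; S2) s h) ev C1"
      using steps_Cons(1) Halt by (cases r) (blast intro: SSeqTop SSeqFail)+
    ultimately show ?thesis by (blast intro: steps.intros)
  qed
qed

text \<open>The log of a trace: the number of heap operations, the number of allocations, for each
  address the number of the operation that last wrote to it, and the object written by each
  operation that took effect. Number \<open>0\<close> stands for the initial default object.\<close>

type_synonym log = "nat \<times> nat \<times> (nat \<Rightarrow> nat) \<times> (nat \<rightharpoonup> val)"

fun log_event :: "log \<Rightarrow> ('v, 'p) event \<Rightarrow> log" where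
  "log_event (n, m, L, M) (EAlloc q v a) = (Suc n, Suc m, L(a := Suc n), M(Suc n \<mapsto> v))"
| "log_event (n, m, L, M) (EWrite a v) =
     (if 0 < a \<and> a \<le> m then (Suc n, m, L(a := Suc n), M(Suc n \<mapsto> v)) else (Suc n, m, L, M))"
| "log_event (n, m, L, M) (ERead x a v) = (Suc n, m, L, M)"
| "log_event l _ = l"

definition log_of :: "adt \<Rightarrow> ('v, 'p) event list \<Rightarrow> log" where
  "log_of A evs = foldl log_event (0, 0, \<lambda>_. 0, [0 \<mapsto> def_obj A]) evs"

lemma log_of_Nil: "log_of A [] = (0, 0, \<lambda>_. 0, [0 \<mapsto> def_obj A])"
  by (simp add: log_of_def)

lemma log_of_snoc: "log_of A (evs @ [ev]) = log_event (log_of A evs) ev"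
  by (simp add: log_of_def)

text \<open>Keeps the number \<open>Suc n\<close> of the next operation fresh, so that logging it
  overwrites nothing.\<close>

lemma log_of_dom:
  "log_of A evs = (n, m, L, M) \<Longrightarrow> M k = Some v \<Longrightarrow> k \<le> n"
proof (induction evs arbitrary: n m L M rule: rev_induct)
  case Nil
  then show ?case by (auto simp: log_of_Nil split: if_splits)
next
  case (snoc ev evs)
  obtain n0 m0 L0 M0 where l: "log_of A evs = (n0, m0, L0, M0)" by (metis prod_cases4)
  from snoc.IH[OF l] snoc.prems show ?case
    by (cases ev) (fastforce simp: log_of_snoc l split: if_splits)+
qed

lemma log_of_append:
  assumes "log_of A evs = (n, m, L, M)"
  shows "log_of A (evs @ zs) = (n', m', L', M') \<Longrightarrow> n \<le> n' \<and> (\<forall>k v. M k = Some v \<longrightarrow> M' k = Some v)"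
proof (induction zs arbitrary: n' m' L' M' rule: rev_induct)
  case Nil
  then show ?case using assms by simp
next
  case (snoc ev zs)
  obtain n0 m0 L0 M0 where l: "log_of A (evs @ zs) = (n0, m0, L0, M0)" by (metis prod_cases4)
  have snoc': "log_of A (evs @ zs @ [ev]) = log_event (n0, m0, L0, M0) ev"
    using log_of_snoc[of A "evs @ zs" ev] l by simp
  from snoc.IH[OF l] have *: "n \<le> n0" "\<And>k v. M k = Some v \<Longrightarrow> M0 k = Some v" by auto
  have "M k = Some v \<Longrightarrow> k \<noteq> Suc n0" for k v
    using log_of_dom[OF assms] *(1) by fastforce
  moreover have "log_event (n0, m0, L0, M0) ev = (n', m', L', M')" using snoc' snoc.prems by simp
  ultimately show ?case using * by (cases ev) (auto split: if_splits)
qed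

text \<open>This is the functionality of \<open>W\<close>: of two traces with the same input one
  extends the other, and extension keeps the logged entries.\<close>

lemma log_determines_value:
  assumes "determined_by p inp" "is_interp p I"
    and "evs \<in> traces p inp I i" "log_of A evs = (n, m, L, M)" "M k = Some v"
    and "evs' \<in> traces p inp I i" "log_of A evs' = (n', m', L', M')" "M' k = Some v'"
  shows "v = v'"
proof (cases "length evs \<le> length evs'")
  case True
  then obtain zs where "evs' = evs @ zs" using traces_append[OF assms(1-3,6)] by blast
  then show ?thesis using log_of_append[OF assms(4)] assms by fastforce
next
  case False
  then obtain zs where "evs = evs' @ zs" using traces_append[OF assms(1,2,6,3)] by auto
  then show ?thesis using log_of_append[OF assms(7)] assms by fastforce
qed

text \<open>This is the functionality of \<open>R\<close>: every read raises the operation count, so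
  two reads on one input at the same count are the same event.\<close>

lemma read_determined:
  assumes "determined_by p inp" "is_interp p I"
    and "evs @ [ERead x a v] \<in> traces p inp I i" "log_of A evs = (n, m, L, M)"
    and "evs' @ [ERead x' a' v'] \<in> traces p inp I i" "log_of A evs' = (n, m', L', M')"
  shows "evs' = evs \<and> a' = a"
proof -
  have False if f: "evs1 @ [ERead x1 a1 v1] \<in> traces p inp I i" "log_of A evs1 = (n, m1, L1, M1)"
    "evs2 @ [ERead x2 a2 v2] \<in> traces p inp I i" "log_of A evs2 = (n, m2, L2, M2)"
    "length evs1 < length evs2" for evs1 x1 a1 v1 m1 L1 M1 evs2 x2 a2 v2 m2 L2 M2
  proof -
    obtain zs where zs: "evs2 = (evs1 @ [ERead x1 a1 v1]) @ zs"
      using traces_append[OF assms(1,2) f(1) traces_prefix[OF f(3)]] f(5) by auto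
    have "log_of A (evs1 @ [ERead x1 a1 v1]) = (Suc n, m1, L1, M1)"
      by (simp add: log_of_snoc f(2))
    from log_of_append[OF this f(4)[unfolded zs]] show False by simp
  qed
  from this[OF assms(3,4,5,6)] this[OF assms(5,6,3,4)] have "length evs = length evs'"
    by (meson linorder_neqE_nat)
  with traces_unique[OF assms(1,2,3,5)] show ?thesis by simp
qed

section \<open>Frame properties of big steps\<close>

lemma big_step_frame: "big_step A I S s h r s' h' \<Longrightarrow> y \<notin> assigned S \<Longrightarrow> s' y = s y"
  by (induction rule: big_step.induct) auto

text \<open>A sequence that starts with such a statement, in particular with \<open>havoc\<close>,
  has only the regular case \<open>BSeq\<close>.\<close>

fun assert_free :: "('v, 'p) stmt \<Rightarrow> bool" where
  "assert_free (S1 ;; S2) \<longleftrightarrow> assert_free S1 \<and> assert_free S2"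
| "assert_free (If e S1 S2) \<longleftrightarrow> assert_free S1 \<and> assert_free S2"
| "assert_free (While e S) \<longleftrightarrow> assert_free S"
| "assert_free (Assert e) \<longleftrightarrow> False"
| "assert_free (AssertP P es) \<longleftrightarrow> False"
| "assert_free _ \<longleftrightarrow> True"

lemma assert_free_Top: "big_step A I S s h r s' h' \<Longrightarrow> assert_free S \<Longrightarrow> r = Top"
  by (induction rule: big_step.induct) auto

text \<open>Guarantees that the allocation counter never decreases: a bound on its final value then
  bounds the heap throughout the run.\<close>

fun incr_only :: "('v enc_var, 'q) stmt \<Rightarrow> bool" where
  "incr_only (Assign x e) \<longleftrightarrow> (x = CntAlloc \<longrightarrow> e = Bin Plus (Var CntAlloc) (Num 1))"
| "incr_only (Alloc x e) \<longleftrightarrow> x \<noteq> CntAlloc"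
| "incr_only (Read x q) \<longleftrightarrow> x \<noteq> CntAlloc"
| "incr_only (S1 ;; S2) \<longleftrightarrow> incr_only S1 \<and> incr_only S2"
| "incr_only (If e S1 S2) \<longleftrightarrow> incr_only S1 \<and> incr_only S2"
| "incr_only (While e S) \<longleftrightarrow> incr_only S"
| "incr_only _ \<longleftrightarrow> True"

lemma incr_only_mono:
  "big_step A I S \<sigma> h r \<sigma>' h' \<Longrightarrow> incr_only S \<Longrightarrow> to_int (\<sigma> CntAlloc) \<le> to_int (\<sigma>' CntAlloc)"
  by (induction rule: big_step.induct) auto

lemma havoc_props:
  "assigned (havoc x) = {x, Seed}" "assert_free (havoc x)" "x \<noteq> CntAlloc \<Longrightarrow> incr_only (havoc x)"
  by (auto simp: havoc_def)

lemma havoc_args_props: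
  "assigned (havoc_args n) \<subseteq> {Seed} \<union> range HArg" "assert_free (havoc_args n)"
  "incr_only (havoc_args n)"
proof -
  have "assigned (foldr (\<lambda>i S. havoc (HArg i) ;; S) is Skip) \<subseteq> {Seed} \<union> range HArg \<and>
    assert_free (foldr (\<lambda>i S. havoc (HArg i) ;; S) is Skip) \<and>
    incr_only (foldr (\<lambda>i S. havoc (HArg i) ;; S) is Skip)" for "is"
    by (induction "is") (auto simp: havoc_props)
  then show "assigned (havoc_args n) \<subseteq> {Seed} \<union> range HArg" "assert_free (havoc_args n)"
    "incr_only (havoc_args n)" by (auto simp: havoc_args_def)
qed

lemma havoc_obj_props:
  "assigned (havoc_obj D (Old x)) \<subseteq> {Old x, Seed, HTag} \<union> range HArg"
  "assert_free (havoc_obj D (Old x))" "incr_only (havoc_obj D (Old x))"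
proof -
  let ?f = "\<lambda>c S. If (Eq (Var HTag) (Num (int c)))
                    (havoc_args (length (D ! c)) ;;
                     Assign (Old x) (Ctor c (map (\<lambda>i. Var (HArg i)) [0..<length (D ! c)])))
                    S"
  have "assigned (foldr ?f cs (Assign (Old x) DefObj)) \<subseteq> {Old x, Seed} \<union> range HArg \<and>
    assert_free (foldr ?f cs (Assign (Old x) DefObj)) \<and>
    incr_only (foldr ?f cs (Assign (Old x) DefObj))" for cs
    by (induction cs) (use havoc_args_props in \<open>fastforce+\<close>)
  then show "assigned (havoc_obj D (Old x)) \<subseteq> {Old x, Seed, HTag} \<union> range HArg"
    "assert_free (havoc_obj D (Old x))" "incr_only (havoc_obj D (Old x))"
    unfolding havoc_obj_def by (auto simp: havoc_props)
qed

lemma incr_only_enc_stmt: "incr_only (enc_stmt D inp S)"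
  by (induction S) (auto simp: havoc_props havoc_obj_props)

lemma big_step_Seq_Assign:
  "big_step A I (Assign x e ;; C) s h r s' h' \<longleftrightarrow> big_step A I C (s(x := eval A s e)) h r s' h'"
  by (auto elim!: BSeqE BAssignE intro: BSeq BAssign)

lemma big_step_Assign:
  "big_step A I (Assign x e) s h r s' h' \<longleftrightarrow> r = Top \<and> s' = s(x := eval A s e) \<and> h' = h"
  by (auto elim!: BAssignE intro: BAssign)

lemma big_step_Skip: "big_step A I Skip s h r s' h' \<longleftrightarrow> r = Top \<and> s' = s \<and> h' = h"
  by (auto elim!: BSkipE intro: BSkip)

lemma big_step_Seq_AssertP:
  "map (eval A s) es \<in> I P \<Longrightarrow>
   big_step A I (AssertP P es ;; C) s h r s' h' \<longleftrightarrow> big_step A I C s h r s' h'"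
  by (auto elim!: BSeqE BAssertPE intro: BSeq BAssertP)

lemma big_step_Seq_assert_free:
  "assert_free C1 \<Longrightarrow> big_step A I (C1 ;; C2) s h r s' h' \<longleftrightarrow>
     (\<exists>s1 h1. big_step A I C1 s h Top s1 h1 \<and> big_step A I C2 s1 h1 r s' h')"
  by (auto elim!: BSeqE intro: BSeq dest: assert_free_Top)

section \<open>Safety implies safety of the encoding\<close>

text \<open>\<open>R\<close> contains \<open>Suc n\<close> because the encoding raises
  \<open>Cnt\<close> before using it, while the log is taken before the read. The type condition in
  \<open>W\<close> makes this an interpretation without an invariant on logged objects.\<close>

fun enc_interp :: "('v, 'p) program \<Rightarrow> 'v \<Rightarrow> 'p interp \<Rightarrow> 'p enc_pred interp" where
  "enc_interp p inp I (OldP P) = map enc_val ` I P"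
| "enc_interp p inp I R =
     {[IntV i, IntV (int (Suc n)), IntV (int (L a))] | i n L a m M evs x v.
        evs @ [ERead x a v] \<in> traces p inp I i \<and> log_of (obj_type p) evs = (n, m, L, M)}"
| "enc_interp p inp I W =
     {[IntV i, IntV (int k), enc_val v] | i k v evs n m L M.
        evs \<in> traces p inp I i \<and> log_of (obj_type p) evs = (n, m, L, M) \<and> M k = Some v \<and>
        has_type (ctors (obj_type p)) v ObjT}"

lemma is_interp_enc_interp:
  assumes "is_interp p I"
  shows "is_interp (Enc_RW inp p) (enc_interp p inp I)"
  unfolding is_interp_def
proof (intro allI subsetI CollectI)
  fix P vs assume vs: "vs \<in> enc_interp p inp I P"
  show "list_all2 (has_type (ctors (obj_type (Enc_RW inp p)))) vs (pred_args (Enc_RW inp p) P)"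
  proof (cases P)
    case (OldP Q)
    then obtain ws where ws: "ws \<in> I Q" "vs = map enc_val ws" using vs by auto
    then have "list_all2 (has_type (ctors (obj_type p))) ws (pred_args p Q)"
      using assms by (auto simp: is_interp_def)
    then show ?thesis using ws OldP has_type_enc_with[of _ _ _ int]
      by (auto simp: Enc_RW_def enc_adt_def list_all2_conv_all_nth enc_with_int)
  next
    case R
    then show ?thesis using vs by (auto simp: Enc_RW_def intro: has_type.intros)
  next
    case W
    then show ?thesis using vs has_type_enc_with[of _ _ ObjT int]
      by (auto simp: Enc_RW_def enc_adt_def enc_with_int intro: has_type.intros)
  qed
qed

fun atomic :: "('v, 'p) stmt \<Rightarrow> bool" where
  "atomic (S1 ;; S2) \<longleftrightarrow> False"
| "atomic (If e S1 S2) \<longleftrightarrow> False"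
| "atomic (While e S) \<longleftrightarrow> False"
| "atomic _ \<longleftrightarrow> True"

definition full_interp :: "('v, 'p) program \<Rightarrow> 'p interp" where
  "full_interp p P = {vs. list_all2 (has_type (ctors (obj_type p))) vs (pred_args p P)}"

text \<open>The initial values of address variables may be negative in the encoding, so an encoded stack
  is decoded along a renaming \<open>g b\<close> of the addresses above a bound \<open>N\<close> for the run at hand. Two such
  renamings are run side by side: since the execution depends on the input only, both runs produce
  the same events, hence no address above \<open>N\<close> occurs in an event. An assumption \<open>AssumeP\<close>
  that does not hold produces no event; there the run under \<open>full_interp\<close>, where it does hold, is
  used.\<close>

locale encoded_run =
  fixes p :: "('v, 'p) program" and inp :: 'v and I :: "'p interp" and i :: int
    and N :: nat and g :: "bool \<Rightarrow> nat \<Rightarrow> int"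
  assumes A: "wf_adt (obj_type p)"
    and det: "determined_by p inp"
    and interp: "is_interp p I"
    and safe: "is_stack p s \<Longrightarrow> \<not> big_step (obj_type p) I (body p) s [] (Bot P vs) s' h'"
    and ren: "renaming (obj_type p) (g b)"
    and fix_low: "a \<le> N \<Longrightarrow> g b a = int a"
    and differ_high: "N < a \<Longrightarrow> g True a \<noteq> g False a"
begin

abbreviation "A \<equiv> obj_type p"
abbreviation "D \<equiv> ctors (obj_type p)"
abbreviation "J \<equiv> enc_interp p inp I"
abbreviation "interps \<equiv> {I, full_interp p}"

lemma inj_g: "inj (g b)"
  using ren by (simp add: renaming_def)

text \<open>Addresses up to \<open>N\<close> are fixed, and by injectivity no other address is sent
  into their range; so the bounds test of an encoded write agrees with that of
  \<open>heap_write\<close>.\<close>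

lemma g_range: "0 < g b a \<and> g b a \<le> int m \<longleftrightarrow> 0 < a \<and> a \<le> m" if "m \<le> N"
proof
  assume *: "0 < g b a \<and> g b a \<le> int m"
  then have "g b (nat (g b a)) = g b a" using fix_low[of "nat (g b a)" b] that by auto
  then have "nat (g b a) = a" using inj_g by (auto dest: injD)
  with * show "0 < a \<and> a \<le> m" by auto
qed (use fix_low[of a b] that in auto)

text \<open>The two renamings differ at every address above \<open>N\<close>, so a value on which
  they agree contains only fixed addresses.\<close>

lemma pure_value:
  "enc_with (g True) v = enc_with (g False) v \<Longrightarrow> enc_with (g b) v = enc_val v"
proof (induction v)
  case (AddrV a)
  then have "a \<le> N" using differ_high[of a] by fastforce
  then show ?case by (simp add: fix_low)
qed auto

lemma interps_is_interp: "K \<in> interps \<Longrightarrow> is_interp p K"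
  using interp by (auto simp: is_interp_def full_interp_def)

lemma traces_not_failing: "pre @ [ev] \<in> traces p inp I i \<Longrightarrow> \<not> failing ev"
proof
  assume "pre @ [ev] \<in> traces p inp I i" "failing ev"
  then obtain s C where s: "is_stack p s" "steps A I (Run (body p) s []) (pre @ [ev]) C"
    by (auto simp: traces_def execution_def)
  with \<open>failing ev\<close> obtain P vs s' h' where "C = Halt (Bot P vs) s' h'"
    using steps_failing[OF s(2), of ev] by auto
  with s safe show False using big_step_iff_steps by metis
qed

text \<open>Whatever \<open>S\<close> does next continues an execution of the whole program after
  \<open>pre\<close>, for either interpretation and either decoding. This is what allows
  \<open>traces_unique\<close> to compare the next events of the two decodings.\<close>

definition extends :: "('v, 'p) event list \<Rightarrow> ('v, 'p) stmt \<Rightarrow> (bool \<Rightarrow> 'v stack) \<Rightarrow> heap \<Rightarrow> bool" where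
  "extends pre S s h \<longleftrightarrow> (\<forall>K \<in> interps. \<forall>b evs C.
     steps A K (Run S (s b) h) evs C \<longrightarrow> pre @ evs \<in> traces p inp K i)"

text \<open>One stack of the encoding is decoded in two ways, while the heap is shared: objects
  enter it through events, which coincide for both decodings. Logged objects look the same under
  both renamings and \<open>enc_val\<close>, so they match the entries of \<open>W\<close>.\<close>

definition related ::
  "('v, 'p) event list \<Rightarrow> (bool \<Rightarrow> 'v stack) \<Rightarrow> heap \<Rightarrow> 'v enc_var stack \<Rightarrow> bool" where
  "related pre s h \<sigma> \<longleftrightarrow> (\<exists>n L M. log_of A pre = (n, length h, L, M) \<and>
     (\<forall>a. M (L a) = Some (heap_read A h a)) \<and>
     (\<forall>k v b. M k = Some v \<longrightarrow> enc_with (g b) v = enc_val v) \<and>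
     (\<forall>b. tracks (g b) (s b) h n L \<sigma> \<and> typed_state A (decl p) (s b) h \<and> s b inp = IntV i))"

text \<open>The same events are required under \<open>I\<close> and \<open>full_interp\<close>, so
  that the latter still describes the run at hand when the next \<open>AssumeP\<close> is
  reached.\<close>

definition simulated ::
  "('v, 'p) event list \<Rightarrow> ('v, 'p) stmt \<Rightarrow> (bool \<Rightarrow> 'v stack) \<Rightarrow> heap \<Rightarrow> 'v enc_var stack \<Rightarrow>
   'p enc_pred outcome \<Rightarrow> bool" where
  "simulated pre S s h \<sigma>' r \<longleftrightarrow> r = Top \<and> (\<exists>evs s' h'.
     (\<forall>K \<in> interps. \<forall>b. steps A K (Run S (s b) h) evs (Halt Top (s' b) h')) \<and>
     related (pre @ evs) s' h' \<sigma>')"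

lemma extends_trace:
  assumes "extends pre S s h" "K \<in> interps" "step A K (Run S (s b) h) ev C"
  shows "pre @ [ev] \<in> traces p inp K i"
  using assms steps.intros unfolding extends_def by metis

lemma extends_same_event:
  assumes "extends pre S s h" "K \<in> interps"
    and "step A K (Run S (s True) h) ev C" "step A K (Run S (s False) h) ev' C'"
  shows "ev = ev'"
  using traces_unique[OF det interps_is_interp[OF assms(2)] extends_trace[OF assms(1,2,3)]
      extends_trace[OF assms(1,2,4)]] by simp

lemma extends_no_failure:
  assumes "extends pre S s h" "step A I (Run S (s b) h) ev C"
  shows "\<not> failing ev"
  using extends_trace[OF assms(1) _ assms(2)] traces_not_failing by blast

lemma extends_Seq1: "extends pre (S1 ;; S2) s h \<Longrightarrow> extends pre S1 s h"
  unfolding extends_def by (meson steps_Seq_lift)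

lemma extends_Seq2:
  assumes "extends pre (S1 ;; S2) s h"
    and "\<forall>K \<in> interps. \<forall>b. steps A K (Run S1 (s b) h) evs (Halt Top (s' b) h')"
  shows "extends (pre @ evs) S2 s' h'"
  unfolding extends_def
proof (intro ballI allI impI)
  fix K b evs' C assume "K \<in> interps" "steps A K (Run S2 (s' b) h') evs' C"
  then show "(pre @ evs) @ evs' \<in> traces p inp K i"
    using assms steps_append[OF steps_Seq_Top] unfolding extends_def by fastforce
qed

lemma extends_step:
  assumes "extends pre S s h"
    and "\<forall>K \<in> interps. \<forall>b. step A K (Run S (s b) h) ev (Run S' (s' b) h')"
  shows "extends (pre @ [ev]) S' s' h'"
  unfolding extends_def
proof (intro ballI allI impI)
  fix K b evs' C assume K: "K \<in> interps" and st: "steps A K (Run S' (s' b) h') evs' C"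
  have "steps A K (Run S (s b) h) (ev # evs') C"
    using assms(2) K st by (blast intro: steps_Cons)
  then show "(pre @ [ev]) @ evs' \<in> traces p inp K i"
    using assms(1) K unfolding extends_def by fastforce
qed

lemma simulated_step:
  assumes "\<forall>K \<in> interps. \<forall>b. step A K (Run S (s b) h) ev (Halt Top (s' b) h')"
    and "related (pre @ [ev]) s' h' \<sigma>'"
  shows "simulated pre S s h \<sigma>' Top"
  unfolding simulated_def
  by (intro conjI exI[of _ "[ev]"] exI[of _ s'] exI[of _ h'])
    (use assms in \<open>auto intro: steps_Cons steps_Nil\<close>)

lemma simulated_after_step:
  assumes "\<forall>K \<in> interps. \<forall>b. step A K (Run S (s b) h) ev (Run S' (s' b) h')"
    and "simulated (pre @ [ev]) S' s' h' \<sigma>' r"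
  shows "simulated pre S s h \<sigma>' r"
proof -
  from assms(2) obtain evs s2 h2 where *: "r = Top"
    "\<forall>K \<in> interps. \<forall>b. steps A K (Run S' (s' b) h') evs (Halt Top (s2 b) h2)"
    "related ((pre @ [ev]) @ evs) s2 h2 \<sigma>'" unfolding simulated_def by blast
  show ?thesis unfolding simulated_def
    by (intro conjI exI[of _ "ev # evs"] exI[of _ s2] exI[of _ h2])
      (use * assms(1) in \<open>auto intro: steps_Cons\<close>)
qed

lemma simulated_Seq:
  assumes "\<forall>K \<in> interps. \<forall>b. steps A K (Run S1 (s b) h) evs (Halt Top (s' b) h')"
    and "simulated (pre @ evs) S2 s' h' \<sigma>' r"
  shows "simulated pre (S1 ;; S2) s h \<sigma>' r"
proof -
  from assms(2) obtain evs2 s2 h2 where *: "r = Top"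
    "\<forall>K \<in> interps. \<forall>b. steps A K (Run S2 (s' b) h') evs2 (Halt Top (s2 b) h2)"
    "related ((pre @ evs) @ evs2) s2 h2 \<sigma>'" unfolding simulated_def by blast
  have "steps A K (Run (S1 ;; S2) (s b) h) (evs @ evs2) (Halt Top (s2 b) h2)"
    if "K \<in> interps" for K b
    using steps_append[OF steps_Seq_Top] assms(1) *(2) that by blast
  then show ?thesis unfolding simulated_def using *(1,3) by (metis append.assoc)
qed

lemma related_silent:
  "(\<And>l. log_event l ev = l) \<Longrightarrow> related pre s h \<sigma> \<Longrightarrow> related (pre @ [ev]) s h \<sigma>"
  unfolding related_def log_of_snoc by simp

lemma related_typed: "related pre s h \<sigma> \<Longrightarrow> typed_state A (decl p) (s b) h"
  and related_Old: "related pre s h \<sigma> \<Longrightarrow> \<sigma> (Old x) = enc_with (g b) (s b x)"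
  unfolding related_def tracks_def by blast+

lemma related_exp:
  assumes "related pre s h \<sigma>" "wt_exp D (decl p) e t"
    and "\<And>x. x \<in> vars e \<Longrightarrow> \<sigma>' (Old x) = \<sigma> (Old x)"
  shows "has_type D (eval A (s b) e) t"
    and "eval (enc_adt A) \<sigma>' (enc_exp e) = enc_with (g b) (eval A (s b) e)"
proof -
  have "\<sigma>' (Old x) = enc_with (g b) (s b x)" if "x \<in> vars e" for x
    using assms(3)[OF that] related_Old[OF assms(1)] by simp
  from eval_enc_exp[OF A ren typed_stateD[OF related_typed[OF assms(1)]] assms(2) this]
  show "has_type D (eval A (s b) e) t"
    "eval (enc_adt A) \<sigma>' (enc_exp e) = enc_with (g b) (eval A (s b) e)" by auto
qed

lemma related_guard:
  assumes "related pre s h \<sigma>" "wt_exp D (decl p) e IntT"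
  shows "is_true (eval (enc_adt A) \<sigma> (enc_exp e)) \<longleftrightarrow> is_true (eval A (s b) e)"
  using is_true_enc_exp[OF A ren typed_stateD[OF related_typed[OF assms(1)]] assms(2)
      related_Old[OF assms(1)]] .

lemma related_args:
  assumes "related pre s h \<sigma>" "list_all2 (wt_exp D (decl p)) es ts"
  shows "list_all2 (has_type D) (map (eval A (s b)) es) ts"
    and "map (eval (enc_adt A) \<sigma>) (map enc_exp es) = map (enc_with (g b)) (map (eval A (s b)) es)"
  using eval_enc_exps[OF A ren typed_stateD[OF related_typed[OF assms(1)]] assms(2)
      related_Old[OF assms(1)]] by blast+

section \<open>Simulation of atomic statements under both renamings\<close>

lemma simulated_Assign:
  assumes wt: "wt_exp D (decl p) e (decl p x)" "inp \<noteq> x" and rel: "related pre s h \<sigma>"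
    and bs: "big_step (enc_adt A) J (enc_stmt D inp (Assign x e)) \<sigma> k r \<sigma>' k'"
    and ext: "extends pre (Assign x e) s h"
  shows "simulated pre (Assign x e) s h \<sigma>' r"
proof -
  define v where "v = (\<lambda>b. eval A (s b) e)"
  have st: "step A K (Run (Assign x e) (s b) h) (EAssign x (v b)) (Halt Top ((s b)(x := v b)) h)" for K b
    by (rule SAssign) (simp add: v_def)
  \<comment> \<open>The event records the assigned value, so this value is the same for both
    decodings.\<close>
  have vv: "EAssign x (v True) = EAssign x (v False)"
    using extends_same_event[OF ext _ st st] by blast
  have v: "v b = v True" for b using vv by (cases b) auto
  have enc: "enc_with (g b) (v True) = eval (enc_adt A) \<sigma> (enc_exp e)"
    and ty: "has_type D (v True) (decl p x)" for b
    using related_exp[OF rel wt(1), of \<sigma> b] v[of b] unfolding v_def by auto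
  from bs have \<sigma>': "r = Top" "\<sigma>' = \<sigma>(Old x := eval (enc_adt A) \<sigma> (enc_exp e))"
    by (auto simp: big_step_Assign)
  have "related (pre @ [EAssign x (v True)]) (\<lambda>b. (s b)(x := v True)) h \<sigma>'"
  proof (rule related_silent)
    from rel obtain n L M where "log_of A pre = (n, length h, L, M)"
      "\<forall>a. M (L a) = Some (heap_read A h a)"
      "\<forall>k v b. M k = Some v \<longrightarrow> enc_with (g b) v = enc_val v"
      "\<forall>b. tracks (g b) (s b) h n L \<sigma> \<and> typed_state A (decl p) (s b) h \<and> s b inp = IntV i"
      unfolding related_def by blast
    then show "related pre (\<lambda>b. (s b)(x := v True)) h \<sigma>'"
      unfolding related_def using enc ty wt(2)
      by (intro exI[of _ n] exI[of _ L] exI[of _ M]) (auto simp: \<sigma>' tracks_def intro!: typed_state_upd)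
  qed simp
  then show ?thesis using simulated_step[where s' = "\<lambda>b. (s b)(x := v True)"] st v \<sigma>'(1) by metis
qed

text \<open>\<open>LastAddr\<close> comes from the initial stack and may be any integer, so the
  counter is described for whichever address is renamed to it; injectivity of \<open>g b\<close>
  separates that address from \<open>a\<close>.\<close>

lemma LastAddr_case:
  assumes "\<forall>a'. \<sigma> LastAddr = IntV (g b a') \<longrightarrow> \<sigma> CntLast = IntV (int (L a'))"
    and "\<sigma> (Old q) = IntV (g b a)" "\<sigma> Cnt = IntV (int n)"
    and "big_step B K (If (Eq (Var LastAddr) (Var (Old q))) (Assign CntLast (Var Cnt)) Skip) \<sigma> k r \<sigma>' k'"
  shows "r = Top" "\<And>y. y \<noteq> CntLast \<Longrightarrow> \<sigma>' y = \<sigma> y"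
    "\<And>a'. \<sigma>' LastAddr = IntV (g b a') \<Longrightarrow> \<sigma>' CntLast = IntV (int ((L(a := n)) a'))"
proof -
  have eq: "r = Top" "\<sigma>' = (if \<sigma> LastAddr = IntV (g b a) then \<sigma>(CntLast := IntV (int n)) else \<sigma>)"
    using assms(2-4) by (auto simp: big_step_If_iff big_step_Assign big_step_Skip is_true_def
        of_bool_val_def split: if_splits)
  show "r = Top" by (rule eq)
  show "\<sigma>' y = \<sigma> y" if "y \<noteq> CntLast" for y using eq(2) that by simp
  show "\<sigma>' CntLast = IntV (int ((L(a := n)) a'))" if "\<sigma>' LastAddr = IntV (g b a')" for a'
  proof (cases "a' = a")
    case True
    then show ?thesis using eq(2) that by (simp split: if_splits)
  next
    case False
    then have "g b a' \<noteq> g b a" using inj_g[of b] by (auto dest: injD)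
    then show ?thesis using eq(2) that assms(1) False by (simp split: if_splits)
  qed
qed

lemma write_registered:
  assumes "evs \<in> traces p inp I i" "log_of A evs = (n, m, L, M)" "M k = Some v"
    and "has_type D v ObjT"
  shows "[IntV i, IntV (int k), enc_val v] \<in> J W"
  using assms by simp blast

text \<open>\<open>L a\<close> is a logged number, hence at most \<open>n\<close>, so logging
  operation \<open>Suc n\<close> does not change the object found at \<open>L a\<close>.\<close>

lemma M_fresh:
  assumes "log_of A pre = (n, m, L, M)" "\<And>a. M (L a) = Some (w a)"
  shows "L a \<noteq> Suc n"
  using log_of_dom[OF assms(1) assms(2), of a] by auto

lemma simulated_Alloc:
  assumes wt: "decl p q = AddrT" "wt_exp D (decl p) e ObjT" "q \<notin> vars e" "inp \<noteq> q"
    and rel: "related pre s h \<sigma>"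
    and bs: "big_step (enc_adt A) J (enc_stmt D inp (Alloc q e)) \<sigma> k r \<sigma>' k'"
    and ext: "extends pre (Alloc q e) s h" and N: "to_int (\<sigma>' CntAlloc) \<le> int N"
  shows "simulated pre (Alloc q e) s h \<sigma>' r"
proof -
  from rel obtain n L M where l: "log_of A pre = (n, length h, L, M)"
    and M: "\<And>a. M (L a) = Some (heap_read A h a)"
    and pure: "\<And>k v b. M k = Some v \<Longrightarrow> enc_with (g b) v = enc_val v"
    and tr: "\<And>b. tracks (g b) (s b) h n L \<sigma>" and T: "\<And>b. typed_state A (decl p) (s b) h"
      and i: "\<And>b. s b inp = IntV i"
    unfolding related_def by blast
  let ?a = "Suc (length h)"
  define v where "v = (\<lambda>b. eval A (s b) e)"
  have st: "step A K (Run (Alloc q e) (s b) h) (EAlloc q (v b) ?a)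
      (Halt Top ((s b)(q := AddrV ?a)) (h @ [v b]))" for K b
    by (rule SAlloc) (auto simp: v_def allocate_def)
  have "EAlloc q (v True) ?a = EAlloc q (v False) ?a"
    using extends_same_event[OF ext _ st st] by blast
  then have v: "v b = v True" for b by (cases b) auto
  let ?\<sigma>3 = "\<sigma>(CntAlloc := IntV (int ?a), Old q := IntV (int ?a), Cnt := IntV (int (Suc n)))"
  have cnt: "\<sigma> CntAlloc = IntV (int (length h))" "\<sigma> Cnt = IntV (int n)"
    using tr[of True] by (auto simp: tracks_def)
  have ev3: "eval (enc_adt A) ?\<sigma>3 (enc_exp e) = enc_with (g b) (v True)"
    and ty: "has_type D (v True) ObjT" for b
    using related_exp[OF rel wt(2), of ?\<sigma>3 b] wt(3) v[of b] unfolding v_def by fastforce+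
  \<comment> \<open>The encoded expression has a single value, so both renamings encode
    \<open>v True\<close> alike.\<close>
  then have pv: "enc_with (g b) (v True) = enc_val (v True)" for b
    by (intro pure_value) metis
  have l': "log_of A (pre @ [EAlloc q (v True) ?a]) =
      (Suc n, Suc (length h), L(?a := Suc n), M(Suc n \<mapsto> v True))"
    by (simp add: log_of_snoc l)
  have "pre @ [EAlloc q (v True) ?a] \<in> traces p inp I i"
    by (rule extends_trace[OF ext _ st]) simp
  from write_registered[OF this l', of "Suc n" "v True"]
  have "[IntV i, IntV (int (Suc n)), enc_val (v True)] \<in> J W" using ty by simp
  then have W: "map (eval (enc_adt A) ?\<sigma>3) [Var (Old inp), Var Cnt, enc_exp e] \<in> J W"
    using related_Old[OF rel, of inp True] i wt(4) by (simp only: list.map ev3[of True] pv) simp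
  have "big_step (enc_adt A) J (AssertP W [Var (Old inp), Var Cnt, enc_exp e] ;;
      If (Eq (Var LastAddr) (Var (Old q))) (Assign CntLast (Var Cnt)) Skip) ?\<sigma>3 k r \<sigma>' k'"
    using bs cnt by (simp add: big_step_Seq_Assign add.commute[of 1])
  then have bs': "big_step (enc_adt A) J (If (Eq (Var LastAddr) (Var (Old q))) (Assign CntLast (Var Cnt)) Skip)
      ?\<sigma>3 k r \<sigma>' k'"
    unfolding big_step_Seq_AssertP[where I = J and P = W, OF W] .
  have CA: "\<sigma>' CntAlloc = IntV (int ?a)"
    using big_step_frame[OF bs', of CntAlloc] by simp
  \<comment> \<open>The bound on the final counter places the new address among the fixed ones, so
    the integer stored in \<open>q\<close> is its encoding under both renamings.\<close>
  then have aN: "g b ?a = int ?a" for b using N fix_low[of ?a b] by simp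
  have upd: "r = Top" "\<And>y. y \<noteq> CntLast \<Longrightarrow> \<sigma>' y = ?\<sigma>3 y"
    "\<And>a'. \<sigma>' LastAddr = IntV (g b a') \<Longrightarrow> \<sigma>' CntLast = IntV (int ((L(?a := Suc n)) a'))" for b
  proof -
    have 1: "\<forall>a'. ?\<sigma>3 LastAddr = IntV (g b a') \<longrightarrow> ?\<sigma>3 CntLast = IntV (int (L a'))"
      using tr[of b] by (simp add: tracks_def)
    have 2: "?\<sigma>3 (Old q) = IntV (g b ?a)" "?\<sigma>3 Cnt = IntV (int (Suc n))" by (auto simp: aN)
    show "r = Top" "\<And>y. y \<noteq> CntLast \<Longrightarrow> \<sigma>' y = ?\<sigma>3 y"
      "\<And>a'. \<sigma>' LastAddr = IntV (g b a') \<Longrightarrow> \<sigma>' CntLast = IntV (int ((L(?a := Suc n)) a'))"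
      by (fact LastAddr_case[OF 1 2 bs'])+
  qed
  have "related (pre @ [EAlloc q (v True) ?a]) (\<lambda>b. (s b)(q := AddrV ?a)) (h @ [v True]) \<sigma>'"
    unfolding related_def
  proof (intro exI conjI allI impI)
    show "log_of A (pre @ [EAlloc q (v True) ?a]) =
      (Suc n, length (h @ [v True]), L(?a := Suc n), M(Suc n \<mapsto> v True))" using l' by simp
    show "(M(Suc n \<mapsto> v True)) ((L(?a := Suc n)) a) = Some (heap_read A (h @ [v True]) a)" for a
      using M M_fresh[OF l M, of a] by (simp add: heap_read_alloc)
    show "enc_with (g b) w = enc_val w" if "(M(Suc n \<mapsto> v True)) j = Some w" for j w b
      using that pure pv by (auto split: if_splits)
    show "tracks (g b) ((s b)(q := AddrV ?a)) (h @ [v True]) (Suc n) (L(?a := Suc n)) \<sigma>'" for b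
      using upd(2) upd(3)[of b] tr[of b] aN[of b] unfolding tracks_def by simp
    show "typed_state A (decl p) ((s b)(q := AddrV ?a)) (h @ [v True])" for b
      by (intro typed_state_alloc typed_state_upd T ty) (simp add: wt(1) has_type.intros)
    show "((s b)(q := AddrV ?a)) inp = IntV i" for b using i wt(4) by simp
  qed
  then show ?thesis
    using simulated_step[where s' = "\<lambda>b. (s b)(q := AddrV ?a)" and h' = "h @ [v True]"] st v upd(1)
    by metis
qed

lemma related_addr:
  assumes "related pre s h \<sigma>" "decl p q = AddrT"
  shows "\<exists>a. s b q = AddrV a"
  using typed_stateD[OF related_typed[OF assms(1)], where x = q] assms(2)
  by (metis has_type_AddrT)

lemma simulated_Write:
  assumes wt: "decl p q = AddrT" "wt_exp D (decl p) e ObjT"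
    and rel: "related pre s h \<sigma>"
    and bs: "big_step (enc_adt A) J (enc_stmt D inp (Write q e)) \<sigma> k r \<sigma>' k'"
    and ext: "extends pre (Write q e) s h" and N: "to_int (\<sigma>' CntAlloc) \<le> int N"
  shows "simulated pre (Write q e) s h \<sigma>' r"
proof -
  from rel obtain n L M where l: "log_of A pre = (n, length h, L, M)"
    and M: "\<And>a. M (L a) = Some (heap_read A h a)"
    and pure: "\<And>k v b. M k = Some v \<Longrightarrow> enc_with (g b) v = enc_val v"
    and tr: "\<And>b. tracks (g b) (s b) h n L \<sigma>" and T: "\<And>b. typed_state A (decl p) (s b) h"
      and i: "\<And>b. s b inp = IntV i"
    unfolding related_def by blast
  define v where "v = (\<lambda>b. eval A (s b) e)"
  obtain a where sq: "\<And>b. s b q = AddrV (a b)"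
    using related_addr[OF rel wt(1)] by metis
  have st: "step A K (Run (Write q e) (s b) h) (EWrite (a b) (v b))
      (Halt Top (s b) (heap_write h (a b) (v b)))" for K b
    by (rule SWrite) (auto simp: v_def sq)
  have "EWrite (a True) (v True) = EWrite (a False) (v False)"
    using extends_same_event[OF ext _ st st] by blast
  then have v: "v b = v True" "a b = a True" for b by (cases b; simp)+
  let ?a = "a True" and ?v = "v True"
  let ?ok = "0 < ?a \<and> ?a \<le> length h"
  let ?\<sigma>1 = "\<sigma>(Cnt := IntV (int (Suc n)))"
  have cnt: "\<sigma> CntAlloc = IntV (int (length h))" "\<sigma> Cnt = IntV (int n)"
    using tr[of True] by (auto simp: tracks_def)
  have q: "\<sigma> (Old q) = IntV (g b ?a)" for b
    using related_Old[OF rel, of q b] sq[of b] v(2)[of b] by simp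
  have ev1: "eval (enc_adt A) ?\<sigma>1 (enc_exp e) = enc_with (g b) ?v"
    and ty: "has_type D ?v ObjT" for b
    using related_exp[OF rel wt(2), of ?\<sigma>1 b] v(1)[of b] unfolding v_def by fastforce+
  then have pv: "enc_with (g b) ?v = enc_val ?v" for b
    by (intro pure_value) metis
  have bs1: "big_step (enc_adt A) J
      (If (Bin And (Bin Less (Num 0) (Var (Old q))) (Bin Leq (Var (Old q)) (Var CntAlloc)))
        (AssertP W [Var (Old inp), Var Cnt, enc_exp e] ;;
         If (Eq (Var LastAddr) (Var (Old q))) (Assign CntLast (Var Cnt)) Skip)
        Skip) ?\<sigma>1 k r \<sigma>' k'"
    using bs cnt by (simp add: big_step_Seq_Assign add.commute[of 1])
  have "\<sigma>' CntAlloc = IntV (int (length h))"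
    using big_step_frame[OF bs1, of CntAlloc] cnt by simp
  then have hN: "length h \<le> N" using N by simp
  \<comment> \<open>The heap lies within the bound \<open>N\<close>, so the encoded test is correct
    even if \<open>q\<close> holds a negative integer.\<close>
  have guard: "is_true (eval (enc_adt A) ?\<sigma>1
      (Bin And (Bin Less (Num 0) (Var (Old q))) (Bin Leq (Var (Old q)) (Var CntAlloc)))) \<longleftrightarrow> ?ok"
    using g_range[OF hN, of True ?a] q[of True] cnt by (auto simp: is_true_def of_bool_val_def)
  note bs2 = bs1[unfolded big_step_If_iff guard]
  have trace: "pre @ [EWrite ?a ?v] \<in> traces p inp I i"
    by (rule extends_trace[OF ext _ st]) simp
  have main: "r = Top \<and> related (pre @ [EWrite ?a ?v]) s (heap_write h ?a ?v) \<sigma>'"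
  proof (cases ?ok)
    case True
    have l': "log_of A (pre @ [EWrite ?a ?v]) =
        (Suc n, length h, L(?a := Suc n), M(Suc n \<mapsto> ?v))"
      using True by (simp add: log_of_snoc l)
    from write_registered[OF trace l', of "Suc n" ?v]
    have "[IntV i, IntV (int (Suc n)), enc_val ?v] \<in> J W" using ty by simp
    then have W: "map (eval (enc_adt A) ?\<sigma>1) [Var (Old inp), Var Cnt, enc_exp e] \<in> J W"
      using related_Old[OF rel, of inp True] i by (simp only: list.map ev1[of True] pv) simp
    have bs': "big_step (enc_adt A) J (If (Eq (Var LastAddr) (Var (Old q))) (Assign CntLast (Var Cnt)) Skip)
        ?\<sigma>1 k r \<sigma>' k'"
      using bs2 True big_step_Seq_AssertP[where I = J and P = W, OF W] by simp
    have upd: "r = Top" "\<And>y. y \<noteq> CntLast \<Longrightarrow> \<sigma>' y = ?\<sigma>1 y"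
      "\<And>a'. \<sigma>' LastAddr = IntV (g b a') \<Longrightarrow> \<sigma>' CntLast = IntV (int ((L(?a := Suc n)) a'))" for b
    proof -
      have 1: "\<forall>a'. ?\<sigma>1 LastAddr = IntV (g b a') \<longrightarrow> ?\<sigma>1 CntLast = IntV (int (L a'))"
        using tr[of b] by (simp add: tracks_def)
      have 2: "?\<sigma>1 (Old q) = IntV (g b ?a)" "?\<sigma>1 Cnt = IntV (int (Suc n))" using q by auto
      show "r = Top" "\<And>y. y \<noteq> CntLast \<Longrightarrow> \<sigma>' y = ?\<sigma>1 y"
        "\<And>a'. \<sigma>' LastAddr = IntV (g b a') \<Longrightarrow> \<sigma>' CntLast = IntV (int ((L(?a := Suc n)) a'))"
        by (fact LastAddr_case[OF 1 2 bs'])+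
    qed
    have "related (pre @ [EWrite ?a ?v]) s (heap_write h ?a ?v) \<sigma>'"
      unfolding related_def
    proof (intro exI conjI allI impI)
      show "log_of A (pre @ [EWrite ?a ?v]) =
        (Suc n, length (heap_write h ?a ?v), L(?a := Suc n), M(Suc n \<mapsto> ?v))" using l' by simp
      show "(M(Suc n \<mapsto> ?v)) ((L(?a := Suc n)) c) = Some (heap_read A (heap_write h ?a ?v) c)" for c
        using M M_fresh[OF l M, of c] True by (simp add: heap_read_write)
      show "enc_with (g b) w = enc_val w" if "(M(Suc n \<mapsto> ?v)) j = Some w" for j w b
        using that pure pv by (auto split: if_splits)
      show "tracks (g b) (s b) (heap_write h ?a ?v) (Suc n) (L(?a := Suc n)) \<sigma>'" for b
        using upd(2) upd(3)[of b] tr[of b] unfolding tracks_def by simp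
      show "typed_state A (decl p) (s b) (heap_write h ?a ?v)" for b
        by (intro typed_state_write T ty)
    qed (rule i)
    with upd(1) show ?thesis by blast
  next
    case False
    with bs2 have \<sigma>': "r = Top" "\<sigma>' = ?\<sigma>1" by (auto simp: big_step_Skip)
    have h: "heap_write h ?a ?v = h" using False by (auto simp: heap_write_def)
    have "log_of A (pre @ [EWrite ?a ?v]) = (Suc n, length h, L, M)"
      using False by (auto simp: log_of_snoc l)
    moreover have "tracks (g b) (s b) h (Suc n) L ?\<sigma>1" for b
      using tr[of b] by (simp add: tracks_def)
    ultimately show ?thesis unfolding related_def h \<sigma>' using M pure T i by blast
  qed
  then show ?thesis
    using simulated_step[where s' = s and h' = "heap_write h ?a ?v"] st v by metis
qed

lemma simulated_Read:
  assumes wt: "decl p x = ObjT" "decl p q = AddrT" "inp \<noteq> x"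
    and rel: "related pre s h \<sigma>"
    and bs: "big_step (enc_adt A) J (enc_stmt D inp (Read x q)) \<sigma> k r \<sigma>' k'"
    and ext: "extends pre (Read x q) s h"
  shows "simulated pre (Read x q) s h \<sigma>' r"
proof -
  from rel obtain n L M where l: "log_of A pre = (n, length h, L, M)"
    and M: "\<And>a. M (L a) = Some (heap_read A h a)"
    and pure: "\<And>k v b. M k = Some v \<Longrightarrow> enc_with (g b) v = enc_val v"
    and tr: "\<And>b. tracks (g b) (s b) h n L \<sigma>" and T: "\<And>b. typed_state A (decl p) (s b) h"
      and i: "\<And>b. s b inp = IntV i"
    unfolding related_def by blast
  obtain a where sq: "\<And>b. s b q = AddrV (a b)"
    using related_addr[OF rel wt(2)] by metis
  have st: "step A K (Run (Read x q) (s b) h) (ERead x (a b) (heap_read A h (a b)))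
      (Halt Top ((s b)(x := heap_read A h (a b))) h)" for K b
    by (rule SRead) (auto simp: sq)
  have "ERead x (a True) (heap_read A h (a True)) = ERead x (a False) (heap_read A h (a False))"
    using extends_same_event[OF ext _ st st] by blast
  then have a: "a b = a True" for b by (cases b; simp)
  let ?a = "a True" let ?v = "heap_read A h ?a"
  let ?\<sigma>1 = "\<sigma>(Cnt := IntV (int (Suc n)))"
  have cnt: "\<sigma> Cnt = IntV (int n)" using tr[of True] by (auto simp: tracks_def)
  have q: "\<sigma> (Old q) = IntV (g True ?a)"
    using related_Old[OF rel, of q True] sq[of True] by simp
  have trace: "pre @ [ERead x ?a ?v] \<in> traces p inp I i"
    by (rule extends_trace[OF ext _ st]) simp
  have oinp: "\<sigma> (Old inp) = IntV i" using related_Old[OF rel, of inp True] i by simp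
  let ?g = "Eq (Var LastAddr) (Var (Old q)) :: 'v enc_var exp"
  let ?C1 = "AssertP R [Var (Old inp), Var Cnt, Var CntLast] ;; Assign T (Var CntLast)"
  let ?C2 = "havoc T ;; AssumeP R [Var (Old inp), Var Cnt, Var T]"
  have bs1: "big_step (enc_adt A) J
      (If ?g ?C1 ?C2 ;; havoc_obj D (Old x) ;; AssumeP W [Var (Old inp), Var T, Var (Old x)])
      ?\<sigma>1 k r \<sigma>' k'"
    using bs cnt by (simp add: big_step_Seq_Assign add.commute[of 1])
  \<comment> \<open>Both branches leave \<open>L ?a\<close> in \<open>T\<close>: one copies it, the
    other has to guess it, since \<open>R\<close> admits no other number at this count.\<close>
  have choice: "r1 = Top \<and> \<sigma>2 T = IntV (int (L ?a))"
    if "big_step (enc_adt A) J (If ?g ?C1 ?C2) ?\<sigma>1 k r1 \<sigma>2 k2" for r1 \<sigma>2 k2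
  proof (cases "\<sigma> LastAddr = IntV (g True ?a)")
    case True
    have last: "\<sigma> CntLast = IntV (int (L ?a))" using tr[of True] True by (simp add: tracks_def)
    have "[IntV i, IntV (int (Suc n)), IntV (int (L ?a))] \<in> J R"
      unfolding enc_interp.simps
      by (rule CollectI, rule exI[of _ i], rule exI[of _ n], rule exI[of _ L], rule exI[of _ ?a])
        (use trace l in blast)
    then have "map (eval (enc_adt A) ?\<sigma>1) [Var (Old inp), Var Cnt, Var CntLast] \<in> J R"
      using last oinp by simp
    from big_step_Seq_AssertP[where I = J and P = R, OF this] that True q last show ?thesis
      by (simp add: big_step_If_iff is_true_def of_bool_val_def big_step_Assign)
  next
    case False
    then have "big_step (enc_adt A) J ?C2 ?\<sigma>1 k r1 \<sigma>2 k2"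
      using that q by (simp add: big_step_If_iff is_true_def of_bool_val_def)
    then obtain \<sigma>3 k3 where h: "big_step (enc_adt A) J (havoc T) ?\<sigma>1 k Top \<sigma>3 k3"
      and as: "big_step (enc_adt A) J (AssumeP R [Var (Old inp), Var Cnt, Var T]) \<sigma>3 k3 r1 \<sigma>2 k2"
      by (auto simp: big_step_Seq_assert_free havoc_props)
    from as have eq: "r1 = Top" "\<sigma>2 = \<sigma>3" and R: "[\<sigma>3 (Old inp), \<sigma>3 Cnt, \<sigma>3 T] \<in> J R"
      by (auto elim: BAssumePE)
    have "\<sigma>3 (Old inp) = IntV i" "\<sigma>3 Cnt = IntV (int (Suc n))"
      using big_step_frame[OF h] oinp by (auto simp: havoc_props)
    with R obtain L' a' m' M' evs x' v' where
      "evs @ [ERead x' a' v'] \<in> traces p inp I i" "log_of A evs = (n, m', L', M')"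
      "\<sigma>3 T = IntV (int (L' a'))"
      by auto
    with read_determined[OF det interp trace l] l eq show ?thesis by fastforce
  qed
  from bs1 obtain \<sigma>2 k2 where first: "big_step (enc_adt A) J (If ?g ?C1 ?C2) ?\<sigma>1 k Top \<sigma>2 k2"
    and rest: "big_step (enc_adt A) J
      (havoc_obj D (Old x) ;; AssumeP W [Var (Old inp), Var T, Var (Old x)]) \<sigma>2 k2 r \<sigma>' k'"
    by (rule BSeqE) (blast, drule choice, simp)
  from rest obtain \<sigma>3 k3 where hv: "big_step (enc_adt A) J (havoc_obj D (Old x)) \<sigma>2 k2 Top \<sigma>3 k3"
    and as: "big_step (enc_adt A) J (AssumeP W [Var (Old inp), Var T, Var (Old x)]) \<sigma>3 k3 r \<sigma>' k'"
    unfolding big_step_Seq_assert_free[OF havoc_obj_props(2)] by blast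
  from as have "r = Top \<and> \<sigma>' = \<sigma>3 \<and>
      map (eval (enc_adt A) \<sigma>3) [Var (Old inp), Var T, Var (Old x)] \<in> J W"
    by (rule BAssumePE) blast
  then have r: "r = Top" and \<sigma>3: "\<sigma>3 = \<sigma>'" and W: "[\<sigma>' (Old inp), \<sigma>' T, \<sigma>' (Old x)] \<in> J W"
    by (simp_all del: enc_interp.simps)
  note hv = hv[unfolded \<sigma>3]
  have fr2: "\<sigma>' y = \<sigma>2 y" if "y \<notin> {Old x, Seed, HTag} \<union> range HArg" for y
    by (rule big_step_frame[OF hv]) (use subsetD[OF havoc_obj_props(1)] that in metis)
  have fr1: "\<sigma>2 y = ?\<sigma>1 y" if "y \<noteq> T" "y \<noteq> Seed" for y
    using big_step_frame[OF first, of y] that by (simp add: havoc_props)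
  have fr: "\<sigma>' y = ?\<sigma>1 y" if "y \<notin> {T, Old x, Seed, HTag} \<union> range HArg" for y
    using fr1[of y] fr2[of y] that by auto
  have "\<sigma>' T = IntV (int (L ?a))" using choice[OF first] fr2[of T] by auto
  moreover have "\<sigma>' (Old inp) = IntV i" using fr[of "Old inp"] oinp wt(3) by auto
  ultimately obtain evs n' m' L' M' v' where W': "\<sigma>' (Old x) = enc_val v'"
    "evs \<in> traces p inp I i" "log_of A evs = (n', m', L', M')" "M' (L ?a) = Some v'"
    using W by auto
  \<comment> \<open>The guessed object can only be the one that the program reads, because
    \<open>W\<close> is functional.\<close>
  have v': "v' = ?v"
    using log_determines_value[OF det interp W'(2-4) traces_prefix[OF trace] l M] .
  have "related (pre @ [ERead x ?a ?v]) (\<lambda>b. (s b)(x := ?v)) h \<sigma>'"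
    unfolding related_def
  proof (intro exI conjI allI impI)
    show "log_of A (pre @ [ERead x ?a ?v]) = (Suc n, length h, L, M)"
      by (simp add: log_of_snoc l)
    show "tracks (g b) ((s b)(x := ?v)) h (Suc n) L \<sigma>'" for b
      using tr[of b] fr W'(1) v' pure[OF M, of b ?a] unfolding tracks_def by (simp add: image_iff)
    show "typed_state A (decl p) ((s b)(x := ?v)) h" for b
      by (intro typed_state_upd T) (simp add: wt(1) heap_read_type[OF A T])
    show "((s b)(x := ?v)) inp = IntV i" for b using i wt(3) by simp
  qed (use M pure in auto)
  then show ?thesis
    using simulated_step[where s' = "\<lambda>b. (s b)(x := ?v)" and h' = h] st a r by metis
qed

lemma simulated_Assume:
  assumes wt: "wt_exp D (decl p) e IntT" and rel: "related pre s h \<sigma>"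
    and bs: "big_step (enc_adt A) K (enc_stmt D inp (Assume e)) \<sigma> k r \<sigma>' k'"
  shows "simulated pre (Assume e) s h \<sigma>' r"
proof -
  from bs have *: "r = Top" "\<sigma>' = \<sigma>" "is_true (eval A (s b) e)" for b
    using related_guard[OF rel wt] by (auto elim: BAssumeE)
  then have "\<forall>K \<in> interps. \<forall>b. step A K (Run (Assume e) (s b) h) EAssume (Halt Top (s b) h)"
    by (simp add: SAssume)
  from simulated_step[OF this related_silent[OF _ rel]] * show ?thesis by simp
qed

lemma simulated_Assert:
  assumes wt: "wt_exp D (decl p) e IntT" and rel: "related pre s h \<sigma>"
    and bs: "big_step (enc_adt A) K (enc_stmt D inp (Assert e)) \<sigma> k r \<sigma>' k'"
    and ext: "extends pre (Assert e) s h"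
  shows "simulated pre (Assert e) s h \<sigma>' r"
proof -
  \<comment> \<open>A failing assertion would be an event in the execution of a safe
    program.\<close>
  have t: "is_true (eval A (s b) e)" for b
    using extends_no_failure[OF ext SAssertFail] by fastforce
  then have *: "r = Top" "\<sigma>' = \<sigma>"
    using bs related_guard[OF rel wt] by (auto elim: BAssertE)
  have "\<forall>K \<in> interps. \<forall>b. step A K (Run (Assert e) (s b) h) (EAssert True) (Halt Top (s b) h)"
    using t by (simp add: SAssert)
  from simulated_step[OF this related_silent[OF _ rel]] * show ?thesis by simp
qed

lemma pure_values:
  assumes "map (enc_with (g True)) vs = map (enc_with (g False)) vs"
  shows "map (enc_with (g b)) vs = map enc_val vs"
  using assms by (auto intro: pure_value)

lemma simulated_AssumeP:
  assumes wt: "list_all2 (wt_exp D (decl p)) es (pred_args p P)" and rel: "related pre s h \<sigma>"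
    and bs: "big_step (enc_adt A) J (enc_stmt D inp (AssumeP P es)) \<sigma> k r \<sigma>' k'"
    and ext: "extends pre (AssumeP P es) s h"
  shows "simulated pre (AssumeP P es) s h \<sigma>' r"
proof -
  define vs where "vs = (\<lambda>b. map (eval A (s b)) es)"
  note args = related_args[OF rel wt, folded vs_def]
  have full: "vs b \<in> full_interp p P" for b using args(1) by (simp add: full_interp_def vs_def)
  have "step A (full_interp p) (Run (AssumeP P es) (s b) h) (EAssumeP P (vs b)) (Halt Top (s b) h)" for b
    by (rule SAssumeP) (use full[of b] in \<open>auto simp: vs_def\<close>)
  from extends_same_event[OF ext _ this this] have "vs True = vs False" by simp
  then have vs: "vs b = vs True" for b by (cases b) auto
  have enc: "map (eval (enc_adt A) \<sigma>) (map enc_exp es) = map (enc_with (g b)) (vs True)" for b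
    using args(2)[of b] vs[of b] by (simp add: vs_def)
  then have "map (enc_with (g True)) (vs True) = map (enc_with (g False)) (vs True)" by metis
  note pure = pure_values[OF this]
  from bs have "r = Top" "\<sigma>' = \<sigma>" "map (eval (enc_adt A) \<sigma>) (map enc_exp es) \<in> J (OldP P)"
    by (auto elim: BAssumePE)
  then have *: "r = Top" "\<sigma>' = \<sigma>" "map enc_val (vs True) \<in> J (OldP P)"
    unfolding enc[of True] pure by auto
  \<comment> \<open>Membership in the image under \<open>enc_val\<close> yields only some
    \<open>ws\<close>; both lists have the declared types, so injectivity identifies them.\<close>
  then obtain ws where ws: "ws \<in> I P" "map (enc_with int) (vs True) = map (enc_with int) ws"
    by (auto simp: enc_with_int)
  have "list_all2 (has_type D) ws (pred_args p P)" using ws(1) interp by (auto simp: is_interp_def)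
  moreover have "list_all2 (has_type D) (vs True) (pred_args p P)" using args(1) by (simp add: vs_def)
  ultimately have "vs True = ws" using enc_with_inj_list[OF _ _ _ ws(2)] by (simp add: inj_def)
  with ws(1) full[of True] have "vs True \<in> K P" if "K \<in> interps" for K using that by blast
  moreover have "map (eval A (s b)) es = vs True" for b using vs[of b] by (simp only: vs_def)
  ultimately have "\<forall>K \<in> interps. \<forall>b.
      step A K (Run (AssumeP P es) (s b) h) (EAssumeP P (vs True)) (Halt Top (s b) h)"
    by (blast intro: SAssumeP)
  from simulated_step[OF this related_silent[OF _ rel]] * show ?thesis by simp
qed

lemma simulated_AssertP:
  assumes wt: "list_all2 (wt_exp D (decl p)) es (pred_args p P)" and rel: "related pre s h \<sigma>"
    and bs: "big_step (enc_adt A) J (enc_stmt D inp (AssertP P es)) \<sigma> k r \<sigma>' k'"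
    and ext: "extends pre (AssertP P es) s h"
  shows "simulated pre (AssertP P es) s h \<sigma>' r"
proof -
  define vs where "vs = (\<lambda>b. map (eval A (s b)) es)"
  note args = related_args[OF rel wt, folded vs_def]
  have full: "vs b \<in> full_interp p P" for b using args(1) by (simp add: full_interp_def vs_def)
  have I: "vs b \<in> I P" for b
    using extends_no_failure[OF ext SAssertPFail[of A "s b" es "vs b"]] by (auto simp: vs_def)
  have "step A I (Run (AssertP P es) (s b) h) (EAssertP P (vs b) True) (Halt Top (s b) h)" for b
    by (rule SAssertP) (use I[of b] in \<open>auto simp: vs_def\<close>)
  from extends_same_event[OF ext _ this this] have "vs True = vs False" by simp
  then have vs: "vs b = vs True" for b by (cases b) auto
  have enc: "map (eval (enc_adt A) \<sigma>) (map enc_exp es) = map (enc_with (g b)) (vs True)" for b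
    using args(2)[of b] vs[of b] by (simp add: vs_def)
  then have "map (enc_with (g True)) (vs True) = map (enc_with (g False)) (vs True)" by metis
  note pure = pure_values[OF this]
  have "map (eval (enc_adt A) \<sigma>) (map enc_exp es) \<in> J (OldP P)"
    unfolding enc[of True] pure using I by simp
  with bs have *: "r = Top" "\<sigma>' = \<sigma>" by (auto elim!: BAssertPE)
  have "vs True \<in> K P" if "K \<in> interps" for K using that I[of True] full[of True] by blast
  moreover have "map (eval A (s b)) es = vs True" for b using vs[of b] by (simp only: vs_def)
  ultimately have "\<forall>K \<in> interps. \<forall>b.
      step A K (Run (AssertP P es) (s b) h) (EAssertP P (vs True) True) (Halt Top (s b) h)"
    by (blast intro: SAssertP)
  from simulated_step[OF this related_silent[OF _ rel]] * show ?thesis by simp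
qed

section \<open>Induction over the encoded run\<close>

lemma simulated_atomic:
  assumes "atomic S" "wt_stmt D (pred_args p) (decl p) S" "alloc_fresh S" "inp \<notin> assigned S"
    and rel: "related pre s h \<sigma>" and ext: "extends pre S s h"
    and bs: "big_step (enc_adt A) J (enc_stmt D inp S) \<sigma> k r \<sigma>' k'"
    and N: "to_int (\<sigma>' CntAlloc) \<le> int N"
  shows "simulated pre S s h \<sigma>' r"
  using assms(2)
proof cases
  case 1
  then have "r = Top" "\<sigma>' = \<sigma>" using bs by (auto elim: BSkipE)
  moreover have "\<forall>K \<in> interps. \<forall>b. step A K (Run S (s b) h) ESkip (Halt Top (s b) h)"
    using 1 by (simp add: SSkip)
  ultimately show ?thesis using simulated_step[OF _ related_silent[OF _ rel]] by simp
next
  case (2 e x)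
  then show ?thesis using assms simulated_Assign by auto
next
  case (3 q e)
  then show ?thesis using assms simulated_Alloc[of q e pre s h \<sigma> k r \<sigma>' k'] by simp
next
  case (4 x q)
  then show ?thesis using assms simulated_Read[of x q pre s h \<sigma> k r \<sigma>' k'] by simp
next
  case (5 q e)
  then show ?thesis using assms simulated_Write[of q e pre s h \<sigma> k r \<sigma>' k'] by simp
next
  case (9 e)
  then show ?thesis using assms simulated_Assume by blast
next
  case (10 e)
  then show ?thesis using assms simulated_Assert by blast
next
  case (11 es P)
  then show ?thesis using assms simulated_AssumeP by blast
next
  case (12 es P)
  then show ?thesis using assms simulated_AssertP by blast
qed (use assms(1) in auto)

lemma simulated_leaf:
  assumes "C = enc_stmt D inp S" "wt_stmt D (pred_args p) (decl p) S" "alloc_fresh S"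
    "inp \<notin> assigned S" "related pre s h \<sigma>" "extends pre S s h" "to_int (\<sigma>' CntAlloc) \<le> int N"
    and "atomic C" "big_step (enc_adt A) J C \<sigma> k r \<sigma>' k'"
  shows "simulated pre S s h \<sigma>' r"
proof -
  have "atomic S" using assms(1,8) by (cases S) auto
  then show ?thesis using simulated_atomic assms by blast
qed

text \<open>The induction follows the run of the encoding, since that is the run known to end. A
  sequence in it encodes either a sequence of the program or a single heap operation, hence the case
  distinction on \<open>atomic S\<close>.\<close>

lemma simulated_enc:
  "big_step (enc_adt A) J C \<sigma> k r \<sigma>' k' \<Longrightarrow> C = enc_stmt D inp S \<Longrightarrow>
   wt_stmt D (pred_args p) (decl p) S \<Longrightarrow> alloc_fresh S \<Longrightarrow> inp \<notin> assigned S \<Longrightarrow>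
   related pre s h \<sigma> \<Longrightarrow> extends pre S s h \<Longrightarrow> to_int (\<sigma>' CntAlloc) \<le> int N \<Longrightarrow>
   simulated pre S s h \<sigma>' r"
proof (induction arbitrary: S pre s h rule: big_step.induct)
  case (BSeq C1 \<sigma> k \<sigma>1 k1 C2 r \<sigma>' k')
  have bs: "big_step (enc_adt A) J (enc_stmt D inp S) \<sigma> k r \<sigma>' k'"
    using big_step.BSeq[OF BSeq.hyps] BSeq.prems(1) by simp
  show ?case
  proof (cases "atomic S")
    case True
    then show ?thesis using simulated_atomic[OF _ BSeq.prems(2-6) bs] BSeq.prems by blast
  next
    case False
    then obtain S1 S2 where S: "S = S1 ;; S2" "C1 = enc_stmt D inp S1" "C2 = enc_stmt D inp S2"
      using BSeq.prems(1) by (cases S) auto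
    have wt: "wt_stmt D (pred_args p) (decl p) S1" "wt_stmt D (pred_args p) (decl p) S2"
      using BSeq.prems(2) S(1) by (auto elim: wt_stmt.cases)
    \<comment> \<open>The counter never decreases, so the bound on its final value also holds
      between the two parts.\<close>
    have "to_int (\<sigma>1 CntAlloc) \<le> int N"
      using incr_only_mono[OF BSeq.hyps(2)] BSeq.prems(7) by (simp add: S incr_only_enc_stmt)
    with BSeq.IH(1)[OF S(2) wt(1), of pre s h] BSeq.prems S(1) extends_Seq1
    have "simulated pre S1 s h \<sigma>1 Top" by simp
    then obtain evs s1 h1 where ev: "\<forall>K \<in> interps. \<forall>b. steps A K (Run S1 (s b) h) evs (Halt Top (s1 b) h1)"
      and rel: "related (pre @ evs) s1 h1 \<sigma>1" unfolding simulated_def by blast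
    have "simulated (pre @ evs) S2 s1 h1 \<sigma>' r"
      using BSeq.IH(2)[OF S(3) wt(2) _ _ rel extends_Seq2[OF _ ev]] BSeq.prems S(1) by simp
    then show ?thesis using simulated_Seq[OF ev] S(1) by simp
  qed
next
  case (BSeqFail C1 \<sigma> k P vs \<sigma>' k' C2)
  have bs: "big_step (enc_adt A) J (enc_stmt D inp S) \<sigma> k (Bot P vs) \<sigma>' k'"
    using big_step.BSeqFail[OF BSeqFail.hyps, of C2] BSeqFail.prems(1) by simp
  show ?case
  proof (cases "atomic S")
    case True
    then show ?thesis using simulated_atomic[OF _ BSeqFail.prems(2-6) bs] BSeqFail.prems by blast
  next
    case False
    then obtain S1 S2 where S: "S = S1 ;; S2" "C1 = enc_stmt D inp S1"
      using BSeqFail.prems(1) by (cases S) auto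
    have wt: "wt_stmt D (pred_args p) (decl p) S1"
      using BSeqFail.prems(2) S(1) by (auto elim: wt_stmt.cases)
    have "simulated pre S1 s h \<sigma>' (Bot P vs)"
      using BSeqFail.IH[OF S(2) wt, of pre s h] BSeqFail.prems S(1) extends_Seq1 by simp
    then show ?thesis unfolding simulated_def by simp
  qed
next
  case (BIfTrue \<sigma> e' C1 k r \<sigma>' k' C2)
  then obtain e S1 S2 where S: "S = If e S1 S2" "e' = enc_exp e" "C1 = enc_stmt D inp S1"
    by (cases S) auto
  have wt: "wt_exp D (decl p) e IntT" "wt_stmt D (pred_args p) (decl p) S1"
    using BIfTrue.prems(2) S(1) by (auto elim: wt_stmt.cases)
  have st: "\<forall>K \<in> interps. \<forall>b. step A K (Run S (s b) h) (EBranch True) (Run S1 (s b) h)"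
    using BIfTrue.hyps(1) related_guard[OF BIfTrue.prems(5) wt(1)] S by (simp add: SIfTrue)
  have rel: "related (pre @ [EBranch True]) s h \<sigma>"
    using related_silent[OF _ BIfTrue.prems(5)] by simp
  show ?case
    using simulated_after_step[OF st] BIfTrue.IH[OF S(3) wt(2) _ _ rel extends_step[OF _ st]]
      BIfTrue.prems S(1) by simp
next
  case (BIfFalse \<sigma> e' C2 k r \<sigma>' k' C1)
  then obtain e S1 S2 where S: "S = If e S1 S2" "e' = enc_exp e" "C2 = enc_stmt D inp S2"
    by (cases S) auto
  have wt: "wt_exp D (decl p) e IntT" "wt_stmt D (pred_args p) (decl p) S2"
    using BIfFalse.prems(2) S(1) by (auto elim: wt_stmt.cases)
  have st: "\<forall>K \<in> interps. \<forall>b. step A K (Run S (s b) h) (EBranch False) (Run S2 (s b) h)"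
    using BIfFalse.hyps(1) related_guard[OF BIfFalse.prems(5) wt(1)] S by (simp add: SIfFalse)
  have rel: "related (pre @ [EBranch False]) s h \<sigma>"
    using related_silent[OF _ BIfFalse.prems(5)] by simp
  show ?case
    using simulated_after_step[OF st] BIfFalse.IH[OF S(3) wt(2) _ _ rel extends_step[OF _ st]]
      BIfFalse.prems S(1) by simp
next
  case (BWhileTrue \<sigma> e' C k r \<sigma>' k')
  then obtain e S1 where S: "S = While e S1" "e' = enc_exp e" "C = enc_stmt D inp S1"
    by (cases S) auto
  have wt: "wt_exp D (decl p) e IntT" "wt_stmt D (pred_args p) (decl p) S1"
    using BWhileTrue.prems(2) S(1) by (auto elim: wt_stmt.cases)
  have wt2: "wt_stmt D (pred_args p) (decl p) (S1 ;; While e S1)"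
    by (intro wt_stmt.intros wt)
  have C: "C ;; While e' C = enc_stmt D inp (S1 ;; While e S1)" using S by simp
  have st: "\<forall>K \<in> interps. \<forall>b. step A K (Run S (s b) h) (EBranch True) (Run (S1 ;; While e S1) (s b) h)"
    using BWhileTrue.hyps(1) related_guard[OF BWhileTrue.prems(5) wt(1)] S by (simp add: SWhileTrue)
  have rel: "related (pre @ [EBranch True]) s h \<sigma>"
    using related_silent[OF _ BWhileTrue.prems(5)] by simp
  show ?case
    using simulated_after_step[OF st] BWhileTrue.IH[OF C wt2 _ _ rel extends_step[OF _ st]]
      BWhileTrue.prems S(1) by simp
next
  case (BWhileFalse \<sigma> e' C k)
  then obtain e S1 where S: "S = While e S1" "e' = enc_exp e" "C = enc_stmt D inp S1"
    by (cases S) auto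
  have wt: "wt_exp D (decl p) e IntT"
    using BWhileFalse.prems(2) S(1) by (auto elim: wt_stmt.cases)
  have st: "\<forall>K \<in> interps. \<forall>b. step A K (Run S (s b) h) (EBranch False) (Halt Top (s b) h)"
    using BWhileFalse.hyps(1) related_guard[OF BWhileFalse.prems(5) wt(1)] S by (simp add: SWhileFalse)
  show ?case
    using simulated_step[OF st related_silent[OF _ BWhileFalse.prems(5)]] by simp
qed ((rule simulated_leaf, assumption+, simp (no_asm), (rule big_step.intros; assumption))[1])+

end

section \<open>Surjective renamings and the decoding of stacks\<close>

fun addrs :: "val \<Rightarrow> nat set" where
  "addrs (IntV i) = {}"
| "addrs (AddrV a) = {a}"
| "addrs (ObjV c vs) = (\<Union>v\<in>set vs. addrs v)"

lemma finite_addrs: "finite (addrs v)"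
  by (induction v) auto

lemma enc_with_fixed: "(\<And>a. a \<in> addrs v \<Longrightarrow> g a = int a) \<Longrightarrow> enc_with g v = enc_val v"
  by (induction v) auto

text \<open>An encoded integer may stand for an integer or an address, so the source type
  \<open>t\<close> is prescribed; surjectivity supplies an address for any integer.\<close>

lemma enc_with_surj:
  assumes "surj g"
  shows "has_type (map (map redeclare) D) v t' \<Longrightarrow> t' = redeclare t \<Longrightarrow>
    \<exists>w. has_type D w t \<and> enc_with g w = v"
proof (induction arbitrary: t rule: has_type.induct)
  case (1 z)
  obtain a where "z = g a" using assms by (metis surjD)
  then show ?case using 1
    by (cases t) (auto intro: exI[of _ "IntV z"] exI[of _ "AddrV a"] has_type.intros)
next
  case (2 a)
  then show ?case by (cases t) auto
next
  case (3 c vs)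
  then have c: "c < length D" and t: "t = ObjT" by (cases t; simp)+
  have "\<forall>j < length vs. \<exists>w. has_type D w (D ! c ! j) \<and> enc_with g w = vs ! j"
    using 3(2) c by (auto simp: list_all2_conv_all_nth)
  then obtain w where w: "\<And>j. j < length vs \<Longrightarrow> has_type D (w j) (D ! c ! j) \<and> enc_with g (w j) = vs ! j"
    by metis
  have len: "length vs = length (D ! c)" using 3(2) c by (auto dest: list_all2_lengthD)
  have "has_type D (ObjV c (map w [0..<length vs])) ObjT"
    by (rule has_type.intros(3)[OF c]) (use w len in \<open>auto simp: list_all2_conv_all_nth\<close>)
  moreover have "enc_with g (ObjV c (map w [0..<length vs])) = ObjV c vs"
    using w by (auto intro: nth_equalityI)
  ultimately show ?case using t by blast
qed

text \<open>The addresses above \<open>N\<close> alternate between the integers above \<open>N\<close> and the negative ones.\<close>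

definition alternating :: "nat \<Rightarrow> bool \<Rightarrow> nat \<Rightarrow> int" where
  "alternating N b a =
     (if a \<le> N then int a
      else if even (a - N) = b then int (N + Suc (a - N) div 2) else - int (Suc (a - N) div 2))"

lemma alternating_low: "a \<le> N \<Longrightarrow> alternating N b a = int a"
  by (simp add: alternating_def)

text \<open>The offsets \<open>2 * k - 1\<close> and \<open>2 * k\<close> share
  \<open>k = Suc d div 2\<close>; one of them is sent to \<open>N + k\<close> and the other to
  \<open>- k\<close>, and \<open>b\<close> exchanges the two.\<close>

lemma alternating_high:
  assumes "d > 0" "k = Suc d div 2"
  shows "0 < k \<and> alternating N b (N + d) = (if even d = b then int N + int k else - int k)"
proof
  show "0 < k" using assms by presburger
  show "alternating N b (N + d) = (if even d = b then int N + int k else - int k)"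
    using assms(1) by (simp only: alternating_def assms(2)) simp
qed

lemma alternating_differ: "N < a \<Longrightarrow> alternating N True a \<noteq> alternating N False a"
  using alternating_high[OF _ refl, of "a - N" N True] alternating_high[OF _ refl, of "a - N" N False]
  by (cases "even (a - N)") fastforce+

lemma alternating_inj: "inj (alternating N b)"
proof (rule injI)
  fix a c assume eq: "alternating N b a = alternating N b c"
  have low_high: False if "a \<le> N" "N < c" "alternating N b a = alternating N b c" for a c
    using that alternating_high[OF _ refl, of "c - N" N b] by (auto simp: alternating_low split: if_splits)
  consider "a \<le> N" "c \<le> N" | "a \<le> N" "N < c" | "c \<le> N" "N < a" | "N < a" "N < c" by linarith
  then show "a = c"
  proof cases
    case 4
    obtain d e where de: "a = N + d" "c = N + e" "d > 0" "e > 0"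
      using 4 less_imp_add_positive by metis
    define k l where "k = Suc d div 2" and "l = Suc e div 2"
    \<comment> \<open>The sign of the image reveals the parity of the offset and its size reveals
      \<open>k\<close>; together they recover the offset.\<close>
    have "(even d \<longleftrightarrow> even e) \<and> k = l"
      using eq alternating_high[OF de(3) k_def, of N b] alternating_high[OF de(4) l_def, of N b]
      unfolding de by (auto split: if_splits)
    then show ?thesis unfolding de k_def l_def by presburger
  qed (use eq low_high[of a c] low_high[of c a] in \<open>auto simp: alternating_low\<close>)
qed

lemma alternating_surj: "surj (alternating N b)"
  unfolding surj_def
proof
  fix z :: int
  \<comment> \<open>Of the two offsets that belong to \<open>k\<close>, the one with the wanted
    parity is taken.\<close>
  have high: "\<exists>d > 0. k = Suc d div 2 \<and> (even d \<longleftrightarrow> c)" if "k > 0" for k c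
    using that by (intro exI[of _ "if c then 2 * k else 2 * k - 1"]) auto
  consider "0 \<le> z" "z \<le> int N" | "int N < z" | "z < 0" by linarith
  then show "\<exists>a. z = alternating N b a"
  proof cases
    case 1
    then show ?thesis by (intro exI[of _ "nat z"]) (simp add: alternating_low)
  next
    case 2
    then obtain d where "d > 0" "nat (z - int N) = Suc d div 2" "even d \<longleftrightarrow> b"
      using high[of "nat (z - int N)" b] by auto
    then show ?thesis using alternating_high[of d _ N b] 2 by (intro exI[of _ "N + d"]) auto
  next
    case 3
    then obtain d where "d > 0" "nat (- z) = Suc d div 2" "even d \<longleftrightarrow> \<not> b"
      using high[of "nat (- z)" "\<not> b"] by auto
    then show ?thesis using alternating_high[of d _ N b] 3 by (intro exI[of _ "N + d"]) auto
  qed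
qed

lemma Enc_RW_safe_if_safe:
  assumes wf: "wf_program p" and inp: "input_var p inp" and det: "determined_by p inp"
    and af: "alloc_fresh (body p)" and safe: "safe p"
  shows "safe (Enc_RW inp p)"
proof -
  let ?A = "obj_type p"
  from wf have A: "wf_adt ?A" and wt: "wt_stmt (ctors ?A) (pred_args p) (decl p) (body p)"
    by (auto simp: wf_program_def)
  from safe obtain I where I: "is_interp p I"
    and nofail: "\<And>s P vs s' h'. is_stack p s \<Longrightarrow> \<not> big_step ?A I (body p) s [] (Bot P vs) s' h'"
    unfolding safe_def by blast
  let ?J = "enc_interp p inp I"
  have False if stack: "is_stack (Enc_RW inp p) \<sigma>"
    and bs: "big_step (enc_adt ?A) ?J (body (Enc_RW inp p)) \<sigma> [] (Bot P vs) \<sigma>' k'" for \<sigma> P vs \<sigma>' k'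
  proof -
    have ty: "has_type (map (map redeclare) (ctors ?A)) (\<sigma> y) (enc_decl (decl p) y)" for y
      using stack by (simp add: is_stack_def Enc_RW_def enc_adt_def)
    have "decl p inp = IntT" and ninp: "inp \<notin> assigned (body p)" using inp by (auto simp: input_var_def)
    then obtain i where i: "\<sigma> (Old inp) = IntV i" using ty[of "Old inp"] by (auto elim: has_type_IntT)
    obtain m where m: "\<forall>a \<in> addrs (def_obj ?A). a \<le> m"
      using finite_addrs finite_nat_set_iff_bounded_le by blast
    \<comment> \<open>The renamings depend on the run: \<open>m\<close> bounds the addresses inside
      the default object, which must be preserved, and the final allocation counter is available
      because a failing run ends.\<close>
    define N where "N = max m (nat (to_int (\<sigma>' CntAlloc)))"
    let ?g = "alternating N"
    have ren: "renaming ?A (?g b)" for b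
      unfolding renaming_def
      using alternating_inj alternating_low[of 0] m
      by (auto simp: N_def intro!: enc_with_fixed alternating_low)
    interpret encoded_run p inp I i N ?g
      by unfold_locales (use A det I nofail ren alternating_low alternating_differ in blast)+
    \<comment> \<open>Surjectivity decodes the whole initial stack, negative address variables
      included, once for each renaming.\<close>
    have "\<forall>b x. \<exists>w. has_type D w (decl p x) \<and> enc_with (?g b) w = \<sigma> (Old x)"
      using enc_with_surj[OF alternating_surj ty[of "Old _"]] by simp
    then have "\<exists>s. \<forall>b x. has_type D (s b x) (decl p x) \<and> enc_with (?g b) (s b x) = \<sigma> (Old x)"
      by (simp only: choice_iff)
    then obtain s where s: "\<And>b x. has_type D (s b x) (decl p x)"
      "\<And>b x. enc_with (?g b) (s b x) = \<sigma> (Old x)"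
      by blast
    have sinp: "s b inp = IntV i" for b
      using s[of b inp] i \<open>decl p inp = IntT\<close> by (auto elim: has_type_IntT)
    have stk: "is_stack p (s b)" for b using s by (simp add: is_stack_def)
    let ?\<sigma>1 = "\<sigma>(CntAlloc := IntV 0, Cnt := IntV 0, CntLast := IntV 0, T := IntV 0)"
    have nil: "[] \<in> traces p inp I i"
      unfolding traces_def execution_def using stk sinp steps_Nil by blast
    have "[IntV i, IntV (int 0), enc_val (def_obj ?A)] \<in> ?J W"
      by (rule write_registered[OF nil log_of_Nil]) (use A in \<open>simp_all add: wf_adt_def\<close>)
    then have W: "map (eval (enc_adt ?A) ?\<sigma>1) [Var (Old inp), Num 0, DefObj] \<in> ?J W"
      using i by (simp add: enc_adt_def del: enc_interp.simps)
    have "big_step (enc_adt ?A) ?J (AssertP W [Var (Old inp), Num 0, DefObj] ;; enc_stmt D inp (body p))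
        ?\<sigma>1 [] (Bot P vs) \<sigma>' k'"
      using bs by (simp add: Enc_RW_def big_step_Seq_Assign del: enc_interp.simps)
    then have run: "big_step (enc_adt ?A) ?J (enc_stmt D inp (body p)) ?\<sigma>1 [] (Bot P vs) \<sigma>' k'"
      unfolding big_step_Seq_AssertP[where I = ?J and P = W, OF W] .
    have "related [] s [] ?\<sigma>1"
      unfolding related_def
    proof (intro exI conjI allI impI)
      show "log_of A [] = (0, length [], \<lambda>_. 0, [0 \<mapsto> def_obj A])" by (simp add: log_of_Nil)
      show "enc_with (?g b) v = enc_val v" if "[0 \<mapsto> def_obj A] k = Some v" for k v b
        using that ren[of b] by (auto simp: renaming_def split: if_splits)
      show "tracks (?g b) (s b) [] 0 (\<lambda>_. 0) ?\<sigma>1" for b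
        using s(2) by (simp add: tracks_def)
      show "typed_state A (decl p) (s b) []" for b using s(1) by (simp add: typed_state_def)
    qed (auto simp: heap_read_def sinp)
    moreover have "extends [] (body p) s []"
      unfolding extends_def traces_def execution_def using stk sinp by fastforce
    ultimately have "simulated [] (body p) s [] \<sigma>' (Bot P vs)"
      using simulated_enc[OF run refl wt af ninp] by (simp add: N_def)
    then show False by (simp add: simulated_def)
  qed
  then show ?thesis
    unfolding safe_def using is_interp_enc_interp[OF I]
    by (intro exI[of _ ?J]) (auto simp: Enc_RW_def del: enc_interp.simps)
qed

theorem theoremA5:
  fixes p :: "('v, 'p) program" and inp :: 'v
  assumes "wf_program p"
    and "input_var p inp"
    and "determined_by p inp"
    and "alloc_fresh (body p)"
  shows "equi_safe p (Enc_RW inp p)"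
  unfolding equi_safe_def
  using Enc_RW_safe_if_safe[OF assms] safe_if_Enc_RW_safe[OF assms(1,2,4)] by (rule iffI)

end
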